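(* Let $\alpha\in\{0,1\}$ and $m\in\mathbb N$. Then for any $\epsilon>0$ there exists initial data $\mathbf u_0\in X^m(\Omega)$ (both components in $X^m(\Omega)$) such that the solution $\mathbf u=(v_d,\theta)^T$ with $\mathbf u(0)=\mathbf u_0$ of the linear system $$\partial_t\mathscr F_b\mathbf u(t,\eta)+M(\eta)\,\mathscr F_b\mathbf u(t,\eta)=0,\quad \eta\in J,\qquad M(\eta)=\begin{pmatrix}|\eta|^{2\alpha}&-\frac{|\tilde n|^2}{|\eta|^2}\\ 1&0\end{pmatrix},$$ satisfies $$\|\bar\theta(t)\|_{H^s}\ge C\,t^{-\frac{m-s}{2(1+\alpha)}-\epsilon}\qquad\text{and}\qquad \|v_d(t)\|_{H^s}\ge C\,t^{-1-\frac{m-s}{2(1+\alpha)}-\epsilon}$$ for any $s\in[0,m]$ and all $t\ge C$.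
   Context: $d\ge2$, $\mathbb T=\mathbb R/\mathbb Z$, $\Omega=\mathbb T^{d-1}\times[-1,1]$, $x=(x_h,x_d)$. $C$ denotes positive constants, independent of $t$, that may differ from one occurrence to another. For $q\in\mathbb N=\{1,2,\dots\}$ let $b_q(x_d)=\sin(\frac\pi2qx_d)$ if $q$ is even and $b_q(x_d)=\cos(\frac\pi2qx_d)$ if $q$ is odd. For $n\in\mathbb Z^{d-1}$ put $\tilde n=2\pi n$, $\tilde q=\frac\pi2q$, $\eta=(\tilde n,\tilde q)$, $J=\{\eta=(\tilde n,\tilde q):(n,q)\in\mathbb Z^{d-1}\times\mathbb N\}$, $\mathscr B_\eta(x)=e^{2\pi in\cdot x_h}b_q(x_d)$, and $\mathscr F_bf(\eta)=\int_\Omega f\,\overline{\mathscr B_\eta}\,dx$ (componentwise for vectors). $X^m(\Omega)=\{f\in H^m(\Omega):\partial_d^kf|_{\partial\Omega}=0,\ k=0,2,\dots,m^*\}$ with $m^*=m-2$ for $m$ even and $m-1$ for $m$ odd; functions in $X^m(\Omega)$ expand as $f=\sum_{\eta\in J}\mathscr F_bf(\eta)\mathscr B_\eta$. $\bar\theta=\theta-\int_{\mathbb T^{d-1}}\theta\,dx_h$. $H^s=H^s(\Omega)$ is the $L^2$-based Sobolev space. *)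

theory Defs
  imports "HOL-Analysis.Analysis"
begin

section \<open>The domain\<close>

text \<open>
  The dimension is \<open>d = CARD('n) + 1\<close>, so \<open>d \<ge> 2\<close> holds automatically. A point is a pair
  \<open>(x\<^sub>h, x\<^sub>d)\<close>. Each point of the torus has exactly one representative in the half-open unit
  cube, so a function on \<open>\<Omega>\<close> is represented by its values on \<open>cell \<times> [-1,1]\<close>;
  its values elsewhere are never used. Periodicity is required only where it matters, namely
  for the smooth functions below.
\<close>

type_synonym 'n pt = "(real ^ 'n) \<times> real"

definition cell :: "(real ^ 'n) set" where
  "cell = {y. \<forall>i. 0 \<le> y $ i \<and> y $ i < 1}"

definition cellM :: "(real ^ 'n::finite) measure" where
  "cellM = restrict_space lborel cell"

definition OmegaM :: "('n::finite) pt measure" where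
  "OmegaM = restrict_space lborel (cell \<times> {-1..1})"

text \<open>The quotient metric of \<open>\<Omega>\<close>.\<close>

definition strip_dist :: "('n::finite) pt \<Rightarrow> 'n pt \<Rightarrow> real" where
  "strip_dist x y =
     (INF k :: int ^ 'n. norm (fst x - fst y + (\<chi> i. real_of_int (k $ i)), snd x - snd y))"


section \<open>Smooth functions and test functions\<close>

text \<open>
  Partial derivatives are indexed by lists of coordinate directions; a list of length \<open>k\<close> is
  an index tuple \<open>(i\<^sub>1, \<dots>, i\<^sub>k)\<close> of the tensor of \<open>k\<close>-th derivatives.
\<close>

primrec partials :: "'a::euclidean_space list \<Rightarrow> ('a \<Rightarrow> real) \<Rightarrow> 'a \<Rightarrow> real" where
  "partials [] f = f"
| "partials (b # bs) f = (\<lambda>x. frechet_derivative (partials bs f) (at x) b)"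

definition smooth :: "('a::euclidean_space \<Rightarrow> real) \<Rightarrow> bool" where
  "smooth f \<longleftrightarrow> (\<forall>bs. set bs \<subseteq> Basis \<longrightarrow> (\<forall>x. partials bs f differentiable (at x)))"

definition horizontally_periodic :: "(('n::finite) pt \<Rightarrow> real) \<Rightarrow> bool" where
  "horizontally_periodic f \<longleftrightarrow> (\<forall>y z i. f (y + axis i 1, z) = f (y, z))"

text \<open>The restrictions of these functions to the closed strip form \<open>C\<^sup>\<infinity>\<close> up to the boundary.\<close>

definition smooth_strip :: "(('n::finite) pt \<Rightarrow> real) set" where
  "smooth_strip = {\<phi>. smooth \<phi> \<and> horizontally_periodic \<phi>}"

definition test_functions :: "(('n::finite) pt \<Rightarrow> real) set" where
  "test_functions =
     {\<phi> \<in> smooth_strip. \<exists>r<1. \<forall>y z. r \<le> \<bar>z\<bar> \<longrightarrow> \<phi> (y, z) = 0}"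


section \<open>Sobolev spaces\<close>

definition L2 :: "(('n::finite) pt \<Rightarrow> real) set" where
  "L2 = {f \<in> borel_measurable OmegaM. integrable OmegaM (\<lambda>x. (f x)\<^sup>2)}"

definition has_weak_deriv ::
  "('n::finite) pt list \<Rightarrow> ('n pt \<Rightarrow> real) \<Rightarrow> ('n pt \<Rightarrow> real) \<Rightarrow> bool" where
  "has_weak_deriv bs f g \<longleftrightarrow> g \<in> L2 \<and>
     (\<forall>\<phi>\<in>test_functions.
        (LINT x|OmegaM. f x * partials bs \<phi> x) = (-1) ^ length bs * (LINT x|OmegaM. g x * \<phi> x))"

definition weak_deriv :: "('n::finite) pt list \<Rightarrow> ('n pt \<Rightarrow> real) \<Rightarrow> 'n pt \<Rightarrow> real" where
  "weak_deriv bs f = (SOME g. has_weak_deriv bs f g)"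

definition sobolev :: "nat \<Rightarrow> (('n::finite) pt \<Rightarrow> real) set" where
  "sobolev k = {f \<in> L2. \<forall>bs. set bs \<subseteq> Basis \<and> length bs \<le> k \<longrightarrow> (\<exists>g. has_weak_deriv bs f g)}"

definition esqrt :: "ennreal \<Rightarrow> ennreal" where
  "esqrt a = (if a = \<infinity> then \<infinity> else ennreal (sqrt (enn2real a)))"

definition gagliardo_sq :: "real \<Rightarrow> (('n::finite) pt \<Rightarrow> real) \<Rightarrow> ennreal" where
  "gagliardo_sq \<sigma> g =
     (\<integral>\<^sup>+ x. \<integral>\<^sup>+ y. ennreal ((g x - g y)\<^sup>2 / strip_dist x y powr (real DIM('n pt) + 2 * \<sigma>))
        \<partial>OmegaM \<partial>OmegaM)"

text \<open>
  The Sobolev-Slobodeckij norm of order \<open>s = k + \<sigma>\<close>, with \<open>k\<close> a natural number and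
  \<open>0 \<le> \<sigma> < 1\<close>; it takes the value \<open>\<infinity>\<close> outside \<open>H\<^sup>s(\<Omega>)\<close>.
\<close>

definition Hnorm :: "real \<Rightarrow> (('n::finite) pt \<Rightarrow> real) \<Rightarrow> ennreal" where
  "Hnorm s f =
     (let k = nat \<lfloor>s\<rfloor>; \<sigma> = s - real k in
      if f \<in> sobolev k then
        esqrt ((\<Sum>bs | set bs \<subseteq> Basis \<and> length bs \<le> k.
                  \<integral>\<^sup>+ x. ennreal ((weak_deriv bs f x)\<^sup>2) \<partial>OmegaM)
             + (if \<sigma> = 0 then 0
                else \<Sum>bs | set bs \<subseteq> Basis \<and> length bs = k. gagliardo_sq \<sigma> (weak_deriv bs f)))
      else \<infinity>)"

text \<open>
  The trace on the boundary \<open>x\<^sub>d = \<plusminus>1\<close> of a function in \<open>H\<^sup>1(\<Omega>)\<close>: the continuous extension, from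
  \<open>H\<^sup>1(\<Omega>)\<close> to \<open>L\<^sup>2(\<partial>\<Omega>)\<close>, of the restriction map on functions that are smooth up to the boundary.
\<close>

definition has_trace :: "(('n::finite) pt \<Rightarrow> real) \<Rightarrow> ('n pt \<Rightarrow> real) \<Rightarrow> bool" where
  "has_trace g \<tau> \<longleftrightarrow>
     (\<exists>\<phi> :: nat \<Rightarrow> 'n pt \<Rightarrow> real. (\<forall>j. \<phi> j \<in> smooth_strip) \<and>
        (\<lambda>j. Hnorm 1 (\<lambda>x. \<phi> j x - g x)) \<longlonglongrightarrow> 0 \<and>
        (\<forall>b\<in>{-1, 1}. (\<lambda>j. \<integral>\<^sup>+ y. ennreal ((\<phi> j (y, b) - \<tau> (y, b))\<^sup>2) \<partial>cellM) \<longlonglongrightarrow> 0))"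

definition vert_deriv :: "nat \<Rightarrow> (('n::finite) pt \<Rightarrow> real) \<Rightarrow> 'n pt \<Rightarrow> real" where
  "vert_deriv k f = weak_deriv (replicate k (0, 1)) f"

text \<open>The space is used for \<open>m \<ge> 1\<close> only.\<close>

definition mstar :: "nat \<Rightarrow> nat" where
  "mstar m = (if even m then m - 2 else m - 1)"

definition X_space :: "nat \<Rightarrow> (('n::finite) pt \<Rightarrow> real) set" where
  "X_space m =
     {f \<in> sobolev m. \<forall>k. even k \<and> k \<le> mstar m \<longrightarrow> has_trace (vert_deriv k f) (\<lambda>_. 0)}"


section \<open>Fourier coefficients and the linear system\<close>

definition eta :: "int ^ 'n::finite \<Rightarrow> nat \<Rightarrow> 'n pt" where
  "eta n q = ((\<chi> i. 2 * pi * real_of_int (n $ i)), pi / 2 * real q)"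

definition b_fun :: "nat \<Rightarrow> real \<Rightarrow> real" where
  "b_fun q z = (if even q then sin (pi / 2 * real q * z) else cos (pi / 2 * real q * z))"

definition B_fun :: "int ^ 'n::finite \<Rightarrow> nat \<Rightarrow> 'n pt \<Rightarrow> complex" where
  "B_fun n q x =
     exp (2 * of_real pi * \<i> * of_real (\<Sum>i\<in>UNIV. real_of_int (n $ i) * fst x $ i))
       * of_real (b_fun q (snd x))"

definition Fb :: "(('n::finite) pt \<Rightarrow> real) \<Rightarrow> int ^ 'n \<Rightarrow> nat \<Rightarrow> complex" where
  "Fb f n q = (LINT x|OmegaM. of_real (f x) * cnj (B_fun n q x))"

definition Fb_vec ::
  "(('n::finite) pt \<Rightarrow> real) \<Rightarrow> ('n pt \<Rightarrow> real) \<Rightarrow> int ^ 'n \<Rightarrow> nat \<Rightarrow> complex ^ 2" where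
  "Fb_vec v \<theta> n q = vector [Fb v n q, Fb \<theta> n q]"

definition M_mat :: "nat \<Rightarrow> ('n::finite) pt \<Rightarrow> complex ^ 2 ^ 2" where
  "M_mat \<alpha> \<eta> =
     vector [vector [of_real (norm \<eta> ^ (2 * \<alpha>)), of_real (- (norm (fst \<eta>))\<^sup>2 / (norm \<eta>)\<^sup>2)],
             vector [1, 0]]"

text \<open>
  A solution is a curve in \<open>X\<^sup>m \<times> X\<^sup>m\<close>; the frequency set \<open>J\<close> is indexed by \<open>(n, q)\<close> with
  \<open>q \<ge> 1\<close>. At \<open>t = 0\<close> the time derivative is one-sided. Initial data are
  attained as elements of \<open>L\<^sup>2\<close>, that is, up to null sets.
\<close>

definition is_solution ::
  "nat \<Rightarrow> nat \<Rightarrow> (('n::finite) pt \<Rightarrow> real) \<Rightarrow> ('n pt \<Rightarrow> real)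
     \<Rightarrow> (real \<Rightarrow> 'n pt \<Rightarrow> real) \<Rightarrow> (real \<Rightarrow> 'n pt \<Rightarrow> real) \<Rightarrow> bool" where
  "is_solution \<alpha> m v0 \<theta>0 v \<theta> \<longleftrightarrow>
     (\<forall>t\<ge>0. v t \<in> X_space m \<and> \<theta> t \<in> X_space m) \<and>
     (AE x in OmegaM. v 0 x = v0 x) \<and> (AE x in OmegaM. \<theta> 0 x = \<theta>0 x) \<and>
     (\<forall>n q. q \<ge> 1 \<longrightarrow> (\<forall>t\<ge>0.
        ((\<lambda>t'. Fb_vec (v t') (\<theta> t') n q) has_vector_derivative
           - (M_mat \<alpha> (eta n q) *v Fb_vec (v t) (\<theta> t) n q)) (at t within {0..})))"

definition fluctuation :: "(('n::finite) pt \<Rightarrow> real) \<Rightarrow> 'n pt \<Rightarrow> real" where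
  "fluctuation f x = f x - (LINT y|cellM. f (y, snd x))"

end

(* The modes cos (2 pi y_i) sin (pi p z) have the slow eigenvalue l(p), comparable to
   p^(-2(1+alpha)); along the slow eigenvector one has v = l(p) theta, and theta decays like
   exp (-l(p) t). The data are lacunary series over p = 2^(j+2) with amplitudes
   p^(-m-delta), so that they converge together with all derivatives of order at most m.
   At time t the dyadic frequency p of size t^(1/(2(1+alpha))) has not yet decayed, and this
   one mode already gives both lower bounds: an H^s norm dominates p^s times the
   coefficient at p. For integer s this is integration by parts, with boundary terms
   killed by the vanishing traces (even orders) or by the sine (odd orders). The
   fractional part is gained by comparing a function with its averages over cells of side
   comparable to 1/p, on each of which the mode has mean zero. *)

theory Submission
  imports Defs
begin


section \<open>Calculus of smooth functions\<close>

text \<open>The bounds are asked of every solution with the given data, and such a solution is known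
  only through its membership in \<open>X_space m\<close> and its Fourier coefficients. So the
  coefficient at one frequency is found by a uniqueness argument, and integration by parts is done
  for an abstract element of \<open>X_space m\<close>, whose traces are limits of smooth
  approximants. In the odd orders no trace is known, but there the test function vanishes linearly
  at the boundary, which compensates a cutoff whose derivative has size n in a layer of width 1/n.
  The fluctuation is handled by comparing its weak derivatives with those of the full function; a
  function outside the Sobolev space has norm infinity, which settles that case of a lower bound at
  once. With b = 2(1+alpha) and p of size t^(1/b), the loss p^(-delta) becomes t^(-epsilon) for
  delta = epsilon b. Frequencies start at 4, the least p for which the eigenvalues are real when
  alpha = 0. Data on the slow eigenvector exclude the fast exponential.\<close>

lemma partials_append: "partials (as @ bs) f = partials as (partials bs f)"
  by (induction as) auto

lemma frechet_derivative_eq: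
  "(f has_derivative D) (at x) \<Longrightarrow> frechet_derivative f (at x) b = D b"
  using frechet_derivative_at by metis

text \<open>\<open>smooth\<close> concerns iterated derivatives along arbitrary lists, so induction
  needs an invariant: a family of differentiable functions closed under partial derivatives contains
  every iterate. The basic smoothness proofs below come down to choosing such a family.\<close>

lemma smoothI_family:
  assumes "f \<in> F" "\<And>g x. g \<in> F \<Longrightarrow> g differentiable (at x)"
    and "\<And>g b. g \<in> F \<Longrightarrow> b \<in> Basis \<Longrightarrow> (\<lambda>x. frechet_derivative g (at x) b) \<in> F"
  shows "smooth f"
proof -
  have "partials bs f \<in> F" if "set bs \<subseteq> Basis" for bs
    using that by (induction bs) (use assms in auto)
  then show ?thesis
    unfolding smooth_def using assms(2) by blast
qed

lemma smooth_partials: "smooth f \<Longrightarrow> set bs \<subseteq> Basis \<Longrightarrow> smooth (partials bs f)"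
  unfolding smooth_def partials_append[symmetric] by auto

lemma smooth_frechet:
  assumes "smooth f" "b \<in> Basis"
  shows "smooth (\<lambda>x. frechet_derivative f (at x) b)"
  using smooth_partials[OF assms(1), of "[b]"] assms(2) by simp

lemma smooth_differentiable: "smooth f \<Longrightarrow> f differentiable (at x)"
  unfolding smooth_def by (metis empty_subsetI list.set(1) partials.simps(1))

lemma smooth_has_derivative: "smooth f \<Longrightarrow> (f has_derivative frechet_derivative f (at x)) (at x)"
  by (simp add: frechet_derivative_works[symmetric] smooth_differentiable)

lemma smooth_continuous_on: "smooth f \<Longrightarrow> continuous_on A f"
  by (meson differentiable_at_imp_differentiable_on differentiable_imp_continuous_on smooth_differentiable)

lemma smooth_const: "smooth (\<lambda>x. c)"
  by (rule smoothI_family[where F = "range (\<lambda>c x. c)"]) (auto simp: frechet_derivative_const)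

lemma smooth_bounded_linear:
  fixes f :: "'a::euclidean_space \<Rightarrow> real"
  assumes "bounded_linear f"
  shows "smooth f"
proof (rule smoothI_family[where F = "insert f (range (\<lambda>c x. c))"])
  fix g :: "'a \<Rightarrow> real" and b :: 'a
  assume "g \<in> insert f (range (\<lambda>c x. c))"
  then show "(\<lambda>x. frechet_derivative g (at x) b) \<in> insert f (range (\<lambda>c x. c))"
    using frechet_derivative_eq[OF bounded_linear_imp_has_derivative[OF assms]]
    by (auto simp: frechet_derivative_const)
qed (use assms in \<open>auto simp: bounded_linear_imp_differentiable\<close>)

lemma smooth_add:
  assumes "smooth f" "smooth g"
  shows "smooth (\<lambda>x. f x + g x)"
proof (rule smoothI_family[where F = "{h. \<exists>f g. smooth f \<and> smooth g \<and> h = (\<lambda>x. f x + g x)}"])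
  fix h :: "'a \<Rightarrow> real" and b :: 'a
  assume "h \<in> {h. \<exists>f g. smooth f \<and> smooth g \<and> h = (\<lambda>x. f x + g x)}" and b: "b \<in> Basis"
  then obtain f g where fg: "smooth f" "smooth g" "h = (\<lambda>x. f x + g x)" by blast
  have "frechet_derivative h (at x) b = frechet_derivative f (at x) b + frechet_derivative g (at x) b" for x
    unfolding fg(3)
    by (rule frechet_derivative_eq) (intro has_derivative_add smooth_has_derivative fg)
  then show "(\<lambda>x. frechet_derivative h (at x) b) \<in> {h. \<exists>f g. smooth f \<and> smooth g \<and> h = (\<lambda>x. f x + g x)}"
    using smooth_frechet[OF fg(1) b] smooth_frechet[OF fg(2) b] by auto
qed (use assms in \<open>auto intro: differentiable_add[OF smooth_differentiable smooth_differentiable]\<close>)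

text \<open>Products alone are not closed under differentiation: the Leibniz rule produces a sum of
  two products. The invariant family is therefore the closure of products under addition.\<close>

inductive mult_span :: "('a::euclidean_space \<Rightarrow> real) \<Rightarrow> bool" where
  base: "smooth f \<Longrightarrow> smooth g \<Longrightarrow> mult_span (\<lambda>x. f x * g x)"
| add: "mult_span f \<Longrightarrow> mult_span g \<Longrightarrow> mult_span (\<lambda>x. f x + g x)"

lemma mult_span_step:
  assumes "mult_span h" "b \<in> Basis"
  shows "h differentiable (at x) \<and> mult_span (\<lambda>x. frechet_derivative h (at x) b)"
  using assms
proof (induction arbitrary: x)
  case (base f g)
  have "frechet_derivative (\<lambda>x. f x * g x) (at x) b =
      f x * frechet_derivative g (at x) b + frechet_derivative f (at x) b * g x" for x
    by (rule frechet_derivative_eq) (intro has_derivative_mult smooth_has_derivative base)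
  moreover have "mult_span (\<lambda>x. f x * frechet_derivative g (at x) b + frechet_derivative f (at x) b * g x)"
    by (intro mult_span.intros base smooth_frechet)
  ultimately show ?case
    using base differentiable_mult[OF smooth_differentiable smooth_differentiable] by auto
next
  case (add f g)
  have "frechet_derivative (\<lambda>x. f x + g x) (at x) b =
      frechet_derivative f (at x) b + frechet_derivative g (at x) b" for x
    by (rule frechet_derivative_eq)
      (intro has_derivative_add, use add in \<open>auto simp: frechet_derivative_works\<close>)
  then show ?case
    using add by (auto intro: mult_span.add)
qed

lemma smooth_mult: "smooth f \<Longrightarrow> smooth g \<Longrightarrow> smooth (\<lambda>x. f x * g x)"
  by (rule smoothI_family[where F = "Collect mult_span"])
    (use mult_span_step SOME_Basis in \<open>auto intro: mult_span.base\<close>)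

lemma smooth_cmult: "smooth f \<Longrightarrow> smooth (\<lambda>x. c * f x)"
  by (intro smooth_mult smooth_const)

lemma smooth_diff: "smooth f \<Longrightarrow> smooth g \<Longrightarrow> smooth (\<lambda>x. f x - g x)"
  using smooth_add[of f "\<lambda>x. (-1) * g x"] smooth_cmult[of g "-1"] by simp

lemma smooth_sum: "(\<And>i. i \<in> I \<Longrightarrow> smooth (f i)) \<Longrightarrow> smooth (\<lambda>x. \<Sum>i\<in>I. f i x)"
  by (induction I rule: infinite_finite_induct) (auto intro: smooth_const smooth_add)

lemma smooth_prod: "(\<And>i. i \<in> I \<Longrightarrow> smooth (f i)) \<Longrightarrow> smooth (\<lambda>x. \<Prod>i\<in>I. f i x)"
  by (induction I rule: infinite_finite_induct) (auto intro: smooth_const smooth_mult)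

text \<open>\<open>hs\<close> is the tower of successive derivatives of the outer function. The
  smooth factor \<open>g\<close> absorbs the derivatives of \<open>u\<close> that the chain rule
  brings out, which keeps the family closed.\<close>

inductive comp_span :: "(nat \<Rightarrow> real \<Rightarrow> real) \<Rightarrow> ('a::euclidean_space \<Rightarrow> real) \<Rightarrow> ('a \<Rightarrow> real) \<Rightarrow> bool"
  for hs u where
  base: "smooth g \<Longrightarrow> comp_span hs u (\<lambda>x. hs k (u x) * g x)"
| add: "comp_span hs u f \<Longrightarrow> comp_span hs u g \<Longrightarrow> comp_span hs u (\<lambda>x. f x + g x)"

lemma comp_span_step:
  assumes "comp_span hs u h" "b \<in> Basis" "smooth u"
    and hs: "\<And>k x. (hs k has_real_derivative hs (Suc k) x) (at x)"
  shows "h differentiable (at x) \<and> comp_span hs u (\<lambda>x. frechet_derivative h (at x) b)"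
  using assms(1,2)
proof (induction arbitrary: x)
  case (base g k)
  have D: "((\<lambda>x. hs k (u x)) has_derivative (\<lambda>v. hs (Suc k) (u x) * frechet_derivative u (at x) v)) (at x)" for x
    using has_derivative_compose[OF smooth_has_derivative[OF assms(3), of x]
        hs[of k "u x", unfolded has_field_derivative_def]] by simp
  have D2: "((\<lambda>x. hs k (u x) * g x) has_derivative
     (\<lambda>v. hs k (u x) * frechet_derivative g (at x) v +
       hs (Suc k) (u x) * frechet_derivative u (at x) v * g x)) (at x)" for x
    by (intro has_derivative_mult smooth_has_derivative base D)
  have "comp_span hs u (\<lambda>x. hs k (u x) * frechet_derivative g (at x) b +
       hs (Suc k) (u x) * (frechet_derivative u (at x) b * g x))"
    by (intro comp_span.intros base smooth_frechet smooth_mult assms)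
  then show ?case
    using frechet_derivative_eq[OF D2] D2 by (auto simp: mult.assoc differentiable_def)
next
  case (add f g)
  have "frechet_derivative (\<lambda>x. f x + g x) (at x) b =
      frechet_derivative f (at x) b + frechet_derivative g (at x) b" for x
    by (rule frechet_derivative_eq)
      (intro has_derivative_add, use add in \<open>auto simp: frechet_derivative_works\<close>)
  then show ?case
    using add by (auto intro: comp_span.add)
qed

text \<open>The assumption is a tower of derivatives instead of smoothness of the outer function:
  for the flat function the tower is explicit, and its smoothness is obtained from this lemma with
  the identity as \<open>u\<close>.\<close>

lemma smooth_compose:
  assumes "smooth u" and "\<And>k x. (hs k has_real_derivative hs (Suc k) x) (at x)"
  shows "smooth (\<lambda>x. hs k (u x))"
proof (rule smoothI_family[where F = "Collect (comp_span hs u)"])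
  show "(\<lambda>x. hs k (u x)) \<in> Collect (comp_span hs u)"
    using comp_span.base[OF smooth_const[of 1]] by auto
next
  fix g :: "'a \<Rightarrow> real" and x
  assume "g \<in> Collect (comp_span hs u)"
  then show "g differentiable (at x)"
    using comp_span_step[where hs = hs and u = u, OF _ SOME_Basis assms(1) assms(2)] by blast
next
  fix g :: "'a \<Rightarrow> real" and b :: 'a
  assume "g \<in> Collect (comp_span hs u)" "b \<in> Basis"
  then show "(\<lambda>x. frechet_derivative g (at x) b) \<in> Collect (comp_span hs u)"
    using comp_span_step[where hs = hs and u = u, OF _ _ assms(1) assms(2)] by blast
qed

lemma smooth_real_iterate:
  fixes W :: "real \<Rightarrow> real"
  assumes "smooth W"
  shows "(partials (replicate k 1) W has_real_derivative partials (replicate (Suc k) 1) W x) (at x)"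
proof -
  have s: "smooth (partials (replicate k 1) W)"
    by (rule smooth_partials[OF assms]) auto
  obtain D where D: "(partials (replicate k 1) W has_real_derivative D) (at x)"
    using smooth_differentiable[OF s, of x] real_differentiable_def by blast
  then show ?thesis
    using frechet_derivative_eq[OF D[unfolded has_field_derivative_def], of 1] by simp
qed

lemma smooth_compose_smooth:
  fixes W :: "real \<Rightarrow> real"
  assumes "smooth W" "smooth u"
  shows "smooth (\<lambda>x. W (u x))"
  using smooth_compose[where hs = "\<lambda>k. partials (replicate k 1) W" and k = 0, OF assms(2)]
    smooth_real_iterate[OF assms(1)] by simp

section \<open>Trigonometric functions and the flat function\<close>

lemma smooth_id: "smooth (\<lambda>x::real. x)"
  by (intro smooth_bounded_linear bounded_linear_ident)

lemma smooth_sin_cos_real: "smooth (sin :: real \<Rightarrow> real)" "smooth (cos :: real \<Rightarrow> real)"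
proof -
  define F where "F = (\<Union>c::real. {(\<lambda>x. c * sin x), (\<lambda>x. c * cos x)})"
  have 1: "frechet_derivative (\<lambda>x. c * sin x) (at x) b = b * c * cos x" for c x b :: real
    by (rule frechet_derivative_eq) (auto intro!: derivative_eq_intros)
  have 2: "frechet_derivative (\<lambda>x. c * cos x) (at x) b = - (b * c) * sin x" for c x b :: real
    by (rule frechet_derivative_eq) (auto intro!: derivative_eq_intros)
  have D: "g differentiable (at x)" if "g \<in> F" for g x
  proof -
    have "(\<lambda>x. c * sin x) differentiable (at x)" "(\<lambda>x. c * cos x) differentiable (at x)" for c :: real
      unfolding differentiable_def
      by (rule exI, (rule derivative_intros)+)+
    then show ?thesis using that by (auto simp: F_def)
  qed
  have E: "(\<lambda>x. frechet_derivative g (at x) b) \<in> F" if "g \<in> F" for g b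
    using that unfolding F_def by (elim UN_E insertE emptyE; hypsubst; unfold 1 2; blast)
  show "smooth (sin :: real \<Rightarrow> real)"
    by (rule smoothI_family[OF _ D E]) (auto simp: F_def intro: exI[of _ 1])
  show "smooth (cos :: real \<Rightarrow> real)"
    by (rule smoothI_family[OF _ D E]) (auto simp: F_def intro: exI[of _ 1])
qed

lemma smooth_sin: "smooth u \<Longrightarrow> smooth (\<lambda>x. sin (u x))"
  and smooth_cos: "smooth u \<Longrightarrow> smooth (\<lambda>x. cos (u x))"
  using smooth_sin_cos_real smooth_compose_smooth by blast+

text \<open>The derivatives of the flat function \<open>exp (-1/x)\<close> are polynomials in \<open>1/x\<close> times it.\<close>

definition flat_aux :: "real poly \<Rightarrow> real \<Rightarrow> real" where
  "flat_aux P x = (if x > 0 then poly P (1 / x) * exp (- 1 / x) else 0)"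

definition flat :: "real \<Rightarrow> real" where
  "flat x = (if x > 0 then exp (- 1 / x) else 0)"

lemma flat_aux_tendsto_0: "((\<lambda>x. poly P (1 / x) * exp (- 1 / x)) \<longlongrightarrow> 0) (at_right (0::real))"
proof -
  have "((\<lambda>x::real. \<Sum>i\<le>degree P. coeff P i * (x ^ i / exp x)) \<longlongrightarrow> (\<Sum>i\<le>degree P. coeff P i * 0)) at_top"
    by (intro tendsto_intros tendsto_power_div_exp_0)
  then have "((\<lambda>x::real. poly P x * exp (- x)) \<longlongrightarrow> 0) at_top"
    by (simp add: poly_altdef sum_distrib_right exp_minus divide_inverse mult.assoc)
  then have "((\<lambda>x::real. poly P (inverse x) * exp (- inverse x)) \<longlongrightarrow> 0) (at_right 0)"
    by (rule filterlim_compose) (rule filterlim_inverse_at_top_right)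
  then show ?thesis by (simp add: divide_inverse)
qed

text \<open>For x > 0 the product rule gives (1/x^2) (P - P')(1/x) exp (-1/x), and
  \<open>[:0,0,1:]\<close> is the square of the variable. At 0 the difference quotient has again the
  form treated in \<open>flat_aux_tendsto_0\<close>, with P multiplied by the variable.\<close>

lemma flat_aux_deriv:
  "(flat_aux P has_real_derivative flat_aux ([:0,0,1:] * (P - pderiv P)) x) (at x)"
proof -
  consider "x > 0" | "x < 0" | "x = 0" by linarith
  then show ?thesis
  proof cases
    case 1
    have "((\<lambda>x. poly P (1 / x) * exp (- 1 / x)) has_real_derivative
        flat_aux ([:0,0,1:] * (P - pderiv P)) x) (at x)"
      using 1 unfolding flat_aux_def
      by (auto intro!: derivative_eq_intros DERIV_chain2[OF poly_DERIV]
          simp: field_simps power2_eq_square)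
    then show ?thesis
      by (rule has_field_derivative_transform_within_open[where S = "{0<..}"])
        (use 1 in \<open>auto simp: flat_aux_def\<close>)
  next
    case 2
    have "((\<lambda>x. 0) has_real_derivative flat_aux ([:0,0,1:] * (P - pderiv P)) x) (at x)"
      using 2 by (auto simp: flat_aux_def)
    then show ?thesis
      by (rule has_field_derivative_transform_within_open[where S = "{..<0}"])
        (use 2 in \<open>auto simp: flat_aux_def\<close>)
  next
    case 3
    have "((\<lambda>y. flat_aux P y / y) \<longlongrightarrow> 0) (at 0)"
    proof (subst filterlim_at_split, intro conjI)
      have "\<forall>\<^sub>F y in at_left 0. flat_aux P y / y = 0"
        by (auto simp: eventually_at_filter flat_aux_def)
      then show "((\<lambda>y. flat_aux P y / y) \<longlongrightarrow> 0) (at_left 0)"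
        by (simp add: tendsto_eventually)
      have "\<forall>\<^sub>F y in at_right 0. poly ([:0,1:] * P) (1 / y) * exp (- 1 / y) = flat_aux P y / y"
        by (auto simp: eventually_at_filter flat_aux_def)
      then show "((\<lambda>y. flat_aux P y / y) \<longlongrightarrow> 0) (at_right 0)"
        using flat_aux_tendsto_0[of "[:0,1:] * P"] by (rule tendsto_cong[THEN iffD1])
    qed
    then show ?thesis
      using 3 by (simp add: has_field_derivative_iff flat_aux_def)
  qed
qed

lemma smooth_flat: "smooth flat"
proof -
  define Ps where "Ps = rec_nat [:1::real:] (\<lambda>_ P. [:0,0,1:] * (P - pderiv P))"
  have "Ps (Suc k) = [:0,0,1:] * (Ps k - pderiv (Ps k))" for k
    by (simp add: Ps_def)
  then have "(flat_aux (Ps k) has_real_derivative flat_aux (Ps (Suc k)) x) (at x)" for k x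
    using flat_aux_deriv by metis
  from smooth_compose[where hs = "\<lambda>k. flat_aux (Ps k)" and k = 0, OF smooth_id this]
  have "smooth (flat_aux (Ps 0))" by simp
  moreover have "flat_aux (Ps 0) = flat"
    by (auto simp: Ps_def flat_aux_def flat_def)
  ultimately show ?thesis by simp
qed

lemma flat_bounds: "0 \<le> flat x" "flat x \<le> 1"
  by (auto simp: flat_def)

lemma flat_deriv: "x > 0 \<Longrightarrow> (flat has_real_derivative flat x / x\<^sup>2) (at x)"
proof -
  assume x: "x > 0"
  have "((\<lambda>x. exp (- 1 / x)) has_real_derivative flat x / x\<^sup>2) (at x)"
    using x by (auto intro!: derivative_eq_intros simp: flat_def field_simps power2_eq_square)
  then show ?thesis
    by (rule has_field_derivative_transform_within_open[where S = "{0<..}"])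
      (use x in \<open>auto simp: flat_def\<close>)
qed

lemma flat_deriv_nonpos: "x \<le> 0 \<Longrightarrow> (flat has_real_derivative 0) (at x)"
proof -
  assume "x \<le> 0"
  moreover have "flat_aux [:1:] = flat"
    by (auto simp: flat_aux_def flat_def)
  ultimately show ?thesis
    using flat_aux_deriv[of "[:1:]" x] by (simp add: flat_aux_def)
qed

lemma flat_tendsto_1: "filterlim u at_top F \<Longrightarrow> ((\<lambda>n. flat (u n)) \<longlongrightarrow> 1) F"
proof -
  assume u: "filterlim u at_top F"
  have "((\<lambda>n. exp (- inverse (u n))) \<longlongrightarrow> exp (- 0)) F"
    by (intro tendsto_intros tendsto_inverse_0_at_top u)
  moreover have "\<forall>\<^sub>F n in F. exp (- inverse (u n)) = flat (u n)"
    using filterlim_at_top_dense[THEN iffD1, OF u, rule_format, of 0]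
    by eventually_elim (auto simp: flat_def divide_inverse)
  ultimately show ?thesis
    using tendsto_cong by force
qed


section \<open>Integration over the strip\<close>

lemma AE_box_iff_cbox: "AE x in lborel. x \<in> cbox a b \<longrightarrow> x \<in> box a (b::'a::euclidean_space)"
proof -
  have "cbox a b - box a b \<in> null_sets lborel"
    using negligible_frontier_interval[of a b]
    by (simp add: negligible_iff_null_sets null_sets_completion_iff)
  from AE_not_in[OF this] show ?thesis
    by eventually_elim auto
qed

text \<open>The cell is half open so that each torus point has one representative, whereas the
  fundamental theorem of calculus and iterated integration are used for gauge integrals over closed
  boxes. The two domains differ by a null set.\<close>

lemma restrict_lborel_continuous:
  fixes f :: "'a::euclidean_space \<Rightarrow> 'b::euclidean_space"
  assumes S: "S \<in> sets borel" "box a b \<subseteq> S" "S \<subseteq> cbox a b" and f: "continuous_on (cbox a b) f"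
  shows "integrable (restrict_space lborel S) f"
    and "(LINT x|restrict_space lborel S. f x) = integral (cbox a b) f"
proof -
  have i: "integrable lborel (\<lambda>x. indicator (cbox a b) x *\<^sub>R f x)"
    by (rule borel_integrable_compact[OF compact_cbox f])
  have "(\<lambda>x. indicator (cbox a b) x *\<^sub>R f x) \<in> borel_measurable borel"
    using borel_measurable_integrable[OF i] by simp
  from borel_measurable_scaleR[OF borel_measurable_indicator[OF S(1)] this]
  have m: "(\<lambda>x. indicator S x *\<^sub>R f x) \<in> borel_measurable lborel"
    using S(3) by (auto simp: indicator_def of_bool_def subset_iff if_distrib cong: if_cong
        elim!: measurable_cong[THEN iffD1, rotated])
  have ae: "AE x in lborel. indicator (cbox a b) x *\<^sub>R f x = indicator S x *\<^sub>R f x"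
    using AE_box_iff_cbox[of a b] by eventually_elim (use S in \<open>auto simp: indicator_def\<close>)
  have i2: "integrable lborel (\<lambda>x. indicator S x *\<^sub>R f x)"
    using integrable_cong_AE[THEN iffD1, OF borel_measurable_integrable[OF i] m ae i] .
  show "integrable (restrict_space lborel S) f"
    using i2 S(1) by (subst integrable_restrict_space) auto
  have "(LINT x|restrict_space lborel S. f x) = (LINT x|lborel. indicator S x *\<^sub>R f x)"
    using S(1) by (subst integral_restrict_space) auto
  also have "\<dots> = (LINT x|lborel. indicator (cbox a b) x *\<^sub>R f x)"
    using integral_cong_AE[OF borel_measurable_integrable[OF i] m ae] by simp
  also have "\<dots> = integral (cbox a b) f"
    using set_borel_integral_eq_integral(2)[of "cbox a b" f] i
    by (simp add: set_lebesgue_integral_def set_integrable_def)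
  finally show "(LINT x|restrict_space lborel S. f x) = integral (cbox a b) f" .
qed

lemma mem_cbox_01: "y \<in> cbox 0 (1 :: real^'n) \<longleftrightarrow> (\<forall>i. 0 \<le> y $ i \<and> y $ i \<le> 1)"
  and mem_box_01: "y \<in> box 0 (1 :: real^'n) \<longleftrightarrow> (\<forall>i. 0 < y $ i \<and> y $ i < 1)"
  by (auto simp: mem_box_cart)

lemma cell_borel: "cell \<in> sets borel"
  unfolding cell_def by measurable

lemma cell_between: "box 0 1 \<subseteq> (cell :: (real^'n) set)" "(cell :: (real^'n) set) \<subseteq> cbox 0 1"
  by (auto simp: cell_def mem_cbox_01 mem_box_01 less_imp_le)

lemma box_Pair_eq: "box (a, c) (b, d) = box a b \<times> box c (d :: 'b::euclidean_space)"
  for a b :: "'a::euclidean_space"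
  by (force simp: box_def Basis_prod_def)

lemma strip_borel: "cell \<times> {-1..1::real} \<in> sets borel"
  using cell_borel by (intro borel_Times) auto

lemma strip_between:
  "box (0, -1) (1, 1) \<subseteq> (cell :: (real^'n) set) \<times> {-1..1::real}"
  "(cell :: (real^'n) set) \<times> {-1..1::real} \<subseteq> cbox (0, -1) (1, 1)"
  using cell_between by (auto simp: box_Pair_eq cbox_Pair_eq)

lemma LINT_OmegaM:
  fixes f :: "('n::finite) pt \<Rightarrow> 'b::euclidean_space"
  assumes "continuous_on (cbox (0, -1) (1, 1)) f"
  shows "integrable OmegaM f" "(LINT x|OmegaM. f x) = integral (cbox (0, -1) (1, 1)) f"
  unfolding OmegaM_def
  using restrict_lborel_continuous[OF strip_borel strip_between assms] by auto

lemma LINT_cellM: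
  fixes f :: "real^'n::finite \<Rightarrow> 'b::euclidean_space"
  assumes "continuous_on (cbox 0 1) f"
  shows "integrable cellM f" "(LINT x|cellM. f x) = integral (cbox 0 1) f"
  unfolding cellM_def
  using restrict_lborel_continuous[OF cell_borel cell_between assms] by auto

lemma space_OmegaM: "space OmegaM = cell \<times> {-1..1}"
  by (simp add: OmegaM_def space_restrict_space)

lemma continuous_measurable_OmegaM:
  "continuous_on UNIV f \<Longrightarrow> f \<in> borel_measurable (OmegaM :: ('n::finite) pt measure)"
  unfolding OmegaM_def
  by (intro measurable_restrict_space1) (simp add: borel_measurable_continuous_onI)

lemma smooth_measurable_OmegaM: "smooth f \<Longrightarrow> f \<in> borel_measurable OmegaM"
  by (intro continuous_measurable_OmegaM smooth_continuous_on)

lemma AE_OmegaM_box: "AE x in (OmegaM :: ('n::finite) pt measure). x \<in> box (0, -1) (1, 1)"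
  unfolding OmegaM_def
proof (subst AE_restrict_space_iff)
  show "AE x in lborel. x \<in> (cell :: (real^'n) set) \<times> {- 1..1} \<longrightarrow> x \<in> box (0, - 1) (1, 1 :: real)"
    using AE_box_iff_cbox[of "(0, -1)" "(1 :: real^'n, 1::real)"]
    by (rule eventually_mono) (use strip_between(2) in blast)
qed (use strip_borel in auto)

lemma measure_cbox_01: "measure lborel (cbox 0 (1 :: real^'n::finite)) = 1"
  using mem_cbox_01[of "0 :: real^'n"] by (auto simp: content_cbox_if_cart)

interpretation OmegaM: finite_measure "OmegaM :: ('n::finite) pt measure"
proof
  have "integrable OmegaM (\<lambda>x :: 'n pt. 1::real)"
    by (rule LINT_OmegaM) auto
  then show "emeasure OmegaM (space (OmegaM :: 'n pt measure)) \<noteq> \<infinity>"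
    using integrableD(2) by (fastforce simp: less_top)
qed

interpretation cellM: finite_measure "cellM :: (real^'n::finite) measure"
proof
  have "integrable cellM (\<lambda>x :: real^'n. 1::real)"
    by (rule LINT_cellM) auto
  then show "emeasure cellM (space (cellM :: (real^'n) measure)) \<noteq> \<infinity>"
    using integrableD(2) by (fastforce simp: less_top)
qed

lemma measure_OmegaM: "measure OmegaM (space (OmegaM :: ('n::finite) pt measure)) = 2"
proof -
  have "measure OmegaM (space (OmegaM :: 'n pt measure)) = (LINT x|(OmegaM :: 'n pt measure). 1)"
    by simp
  also have "\<dots> = integral (cbox (0, -1) (1 :: real^'n, 1::real)) (\<lambda>x. 1::real)"
    by (rule LINT_OmegaM) auto
  also have "\<dots> = integral (cbox 0 (1 :: real^'n)) (\<lambda>x. 2::real)"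
    by (subst integral_prod_continuous) auto
  also have "\<dots> = 2"
    by (simp add: measure_cbox_01)
  finally show ?thesis .
qed

subsection \<open>Periodic functions\<close>

text \<open>After translation by s, the slab beyond the upper face is moved back by one period and
  fills exactly the slab vacated at the lower face. The set identities below express this
  regrouping.\<close>

lemma integral_periodic_shift:
  fixes f :: "'a::euclidean_space \<Rightarrow> 'b::banach"
  assumes f: "continuous_on UNIV f" and k: "k \<in> Basis"
    and per: "\<And>x. f (x + (b \<bullet> k - a \<bullet> k) *\<^sub>R k) = f x"
    and s: "0 \<le> s" "s \<le> b \<bullet> k - a \<bullet> k"
  shows "integral (cbox a b) (\<lambda>x. f (x + s *\<^sub>R k)) = integral (cbox a b) f"
proof -
  let ?L = "b \<bullet> k - a \<bullet> k"
  have int: "f integrable_on cbox u v" for u v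
    by (rule integrable_continuous) (rule continuous_on_subset[OF f], simp)
  have comp: "(u + r *\<^sub>R k) \<bullet> i = (if i = k then u \<bullet> k + r else u \<bullet> i)" if "i \<in> Basis" for u r i
    using that k by (auto simp: inner_add_left inner_Basis)
  have "integral (cbox a b) (\<lambda>x. f (x + s *\<^sub>R k)) = integral (cbox (a + s *\<^sub>R k) (b + s *\<^sub>R k)) f"
    using integral_shift_cbox_plus[of a b f "s *\<^sub>R k"] by (simp add: o_def add.commute)
  also have "\<dots> = integral (cbox (a + s *\<^sub>R k) (b + s *\<^sub>R k) \<inter> {x. x\<bullet>k \<le> b \<bullet> k}) f +
           integral (cbox (a + s *\<^sub>R k) (b + s *\<^sub>R k) \<inter> {x. x\<bullet>k \<ge> b \<bullet> k}) f"
    by (rule integral_split[OF int k])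
  also have "cbox (a + s *\<^sub>R k) (b + s *\<^sub>R k) \<inter> {x. x\<bullet>k \<le> b \<bullet> k} = cbox a b \<inter> {x. x\<bullet>k \<ge> a \<bullet> k + s}"
  proof (intro set_eqI iffI)
    fix x assume x: "x \<in> cbox (a + s *\<^sub>R k) (b + s *\<^sub>R k) \<inter> {x. x\<bullet>k \<le> b \<bullet> k}"
    then have "x \<bullet> k \<ge> a \<bullet> k + s" using k comp[OF k] by (auto simp: mem_box)
    moreover have "a \<bullet> i \<le> x \<bullet> i \<and> x \<bullet> i \<le> b \<bullet> i" if "i \<in> Basis" for i
      using x that comp[OF that] s by (cases "i = k") (auto simp: mem_box)
    ultimately show "x \<in> cbox a b \<inter> {x. x\<bullet>k \<ge> a \<bullet> k + s}" by (auto simp: mem_box)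
  next
    fix x assume x: "x \<in> cbox a b \<inter> {x. x\<bullet>k \<ge> a \<bullet> k + s}"
    have "(a + s *\<^sub>R k) \<bullet> i \<le> x \<bullet> i \<and> x \<bullet> i \<le> (b + s *\<^sub>R k) \<bullet> i" if "i \<in> Basis" for i
      using x that comp[OF that] s k by (cases "i = k") (auto simp: mem_box intro: add_increasing2)
    then show "x \<in> cbox (a + s *\<^sub>R k) (b + s *\<^sub>R k) \<inter> {x. x\<bullet>k \<le> b \<bullet> k}"
      using x k by (auto simp: mem_box)
  qed
  also have "cbox (a + s *\<^sub>R k) (b + s *\<^sub>R k) \<inter> {x. x\<bullet>k \<ge> b \<bullet> k} =
      cbox (a + ?L *\<^sub>R k) (b + (s - ?L) *\<^sub>R k + ?L *\<^sub>R k)"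
  proof (intro set_eqI iffI)
    fix x assume x: "x \<in> cbox (a + s *\<^sub>R k) (b + s *\<^sub>R k) \<inter> {x. x\<bullet>k \<ge> b \<bullet> k}"
    have "(a + ?L *\<^sub>R k) \<bullet> i \<le> x \<bullet> i \<and> x \<bullet> i \<le> (b + (s - ?L) *\<^sub>R k + ?L *\<^sub>R k) \<bullet> i" if "i \<in> Basis" for i
      using x that comp[OF that] comp[OF k] s k by (cases "i = k") (auto simp: mem_box)
    then show "x \<in> cbox (a + ?L *\<^sub>R k) (b + (s - ?L) *\<^sub>R k + ?L *\<^sub>R k)"
      by (auto simp: mem_box)
  next
    fix x assume x: "x \<in> cbox (a + ?L *\<^sub>R k) (b + (s - ?L) *\<^sub>R k + ?L *\<^sub>R k)"
    have *: "(a + ?L *\<^sub>R k) \<bullet> i \<le> x \<bullet> i" "x \<bullet> i \<le> (b + (s - ?L) *\<^sub>R k + ?L *\<^sub>R k) \<bullet> i" if "i \<in> Basis" for i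
      using x that by (auto simp: mem_box)
    have "(a + s *\<^sub>R k) \<bullet> i \<le> x \<bullet> i \<and> x \<bullet> i \<le> (b + s *\<^sub>R k) \<bullet> i" if "i \<in> Basis" for i
      using *[OF that] that comp[OF that] comp[OF k] s k by (cases "i = k") auto
    moreover have "b \<bullet> k \<le> x \<bullet> k"
      using *(1)[OF k] comp[OF k] by simp
    ultimately show "x \<in> cbox (a + s *\<^sub>R k) (b + s *\<^sub>R k) \<inter> {x. x\<bullet>k \<ge> b \<bullet> k}"
      by (auto simp: mem_box)
  qed
  also have "integral \<dots> f = integral (cbox a (b + (s - ?L) *\<^sub>R k)) (f \<circ> (+) (?L *\<^sub>R k))"
    using integral_shift_cbox_plus[of a "b + (s - ?L) *\<^sub>R k" f "?L *\<^sub>R k"] by simp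
  also have "f \<circ> (+) (?L *\<^sub>R k) = f"
    using per by (auto simp: fun_eq_iff add.commute)
  also have "cbox a (b + (s - ?L) *\<^sub>R k) = cbox a b \<inter> {x. x\<bullet>k \<le> a \<bullet> k + s}"
  proof (intro set_eqI iffI)
    fix x assume x: "x \<in> cbox a (b + (s - ?L) *\<^sub>R k)"
    have *: "a \<bullet> i \<le> x \<bullet> i" "x \<bullet> i \<le> (b + (s - ?L) *\<^sub>R k) \<bullet> i" if "i \<in> Basis" for i
      using x that by (auto simp: mem_box)
    have "a \<bullet> i \<le> x \<bullet> i \<and> x \<bullet> i \<le> b \<bullet> i" if "i \<in> Basis" for i
      using *[OF that] that comp[OF that] s k by (cases "i = k") auto
    then show "x \<in> cbox a b \<inter> {x. x\<bullet>k \<le> a \<bullet> k + s}"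
      using *(2)[OF k] comp[OF k] by (auto simp: mem_box)
  next
    fix x assume x: "x \<in> cbox a b \<inter> {x. x\<bullet>k \<le> a \<bullet> k + s}"
    have "a \<bullet> i \<le> x \<bullet> i \<and> x \<bullet> i \<le> (b + (s - ?L) *\<^sub>R k) \<bullet> i" if "i \<in> Basis" for i
      using x that comp[OF that] s k by (cases "i = k") (auto simp: mem_box)
    then show "x \<in> cbox a (b + (s - ?L) *\<^sub>R k)"
      by (auto simp: mem_box)
  qed
  also have "integral (cbox a b \<inter> {x. x\<bullet>k \<ge> a \<bullet> k + s}) f + integral (cbox a b \<inter> {x. x\<bullet>k \<le> a \<bullet> k + s}) f
      = integral (cbox a b) f"
    using integral_split[OF int k, of a b "a \<bullet> k + s"] by simp
  finally show ?thesis .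
qed

lemma smooth_line_derivative:
  assumes "smooth f"
  shows "((\<lambda>s. f (x + s *\<^sub>R k)) has_vector_derivative frechet_derivative f (at (x + s *\<^sub>R k)) k) (at s within S)"
proof -
  have "((\<lambda>s. x + s *\<^sub>R k) has_derivative (\<lambda>h. h *\<^sub>R k)) (at s within S)"
    by (auto intro!: derivative_eq_intros)
  from has_derivative_compose[OF this smooth_has_derivative[OF assms]]
  show ?thesis
    unfolding has_vector_derivative_def
    using linear_scale[OF linear_frechet_derivative[OF smooth_differentiable[OF assms]]]
    by (simp add: o_def)
qed

text \<open>The integral over a period of the translate of f by s along k does not depend on s. Its
  derivative at s = 0, taken under the integral sign, is the integral in question.\<close>

lemma integral_periodic_derivative:
  fixes f :: "'a::euclidean_space \<Rightarrow> real"
  assumes f: "smooth f" and k: "k \<in> Basis"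
    and per: "\<And>x. f (x + (b \<bullet> k - a \<bullet> k) *\<^sub>R k) = f x" and L: "a \<bullet> k < b \<bullet> k"
  shows "integral (cbox a b) (\<lambda>x. frechet_derivative f (at x) k) = 0"
proof -
  let ?L = "b \<bullet> k - a \<bullet> k"
  have cont: "continuous_on UNIV (\<lambda>x. frechet_derivative f (at x) k)"
    by (rule smooth_continuous_on[OF smooth_frechet[OF f k]])
  have "((\<lambda>s. integral (cbox a b) (\<lambda>x. f (x + s *\<^sub>R k))) has_vector_derivative
      integral (cbox a b) (\<lambda>x. frechet_derivative f (at (x + 0 *\<^sub>R k)) k)) (at 0 within {0..?L})"
  proof (rule leibniz_rule_vector_derivative)
    show "((\<lambda>s. f (t + s *\<^sub>R k)) has_vector_derivative frechet_derivative f (at (t + x *\<^sub>R k)) k)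
         (at x within {0..?L})" for x t
      by (rule smooth_line_derivative[OF f])
    show "(\<lambda>y. f (y + x *\<^sub>R k)) integrable_on cbox a b" for x
      by (intro integrable_continuous continuous_on_compose2[OF smooth_continuous_on[OF f, of UNIV]]
          continuous_intros) auto
    show "continuous_on ({0..?L} \<times> cbox a b) (\<lambda>(x, t). frechet_derivative f (at (t + x *\<^sub>R k)) k)"
      unfolding split_beta
      by (intro continuous_on_compose2[OF cont] continuous_intros) auto
  qed (use L in auto)
  moreover have "((\<lambda>s. integral (cbox a b) (\<lambda>x. f (x + s *\<^sub>R k))) has_vector_derivative 0) (at 0 within {0..?L})"
  proof (rule has_vector_derivative_transform[where f = "\<lambda>_. integral (cbox a b) f"])
    show "((\<lambda>s. integral (cbox a b) f) has_vector_derivative 0) (at 0 within {0..?L})"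
      by simp
    show "integral (cbox a b) (\<lambda>x. f (x + s *\<^sub>R k)) = integral (cbox a b) f" if "s \<in> {0..?L}" for s
      using that by (intro integral_periodic_shift[where f = f and k = k, OF smooth_continuous_on[OF f] k per]) auto
  qed (use L in auto)
  ultimately have "integral (cbox a b) (\<lambda>x. frechet_derivative f (at (x + 0 *\<^sub>R k)) k) = 0"
    using L by (intro vector_derivative_unique_within_closed_interval[of 0 ?L 0]) auto
  then show ?thesis by simp
qed

lemma integral_exp_periodic:
  fixes k :: "int ^ 'n::finite"
  assumes "k \<noteq> 0"
  shows "integral (cbox 0 1) (\<lambda>y::real^'n. exp (2 * of_real pi * \<i> * of_real (\<Sum>i\<in>UNIV. real_of_int (k $ i) * y $ i))) = 0"
    (is "integral _ ?f = 0")
proof -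
  obtain i where i: "k $ i \<noteq> 0" using assms by (auto simp: vec_eq_iff)
  \<comment> \<open>Half a period in coordinate i: the exponential changes sign under this shift, so
    the integral equals its own negative.\<close>
  define s where "s = 1 / (2 * \<bar>real_of_int (k $ i)\<bar>)"
  have s: "0 \<le> s" "s \<le> 1" using i by (auto simp: s_def divide_simps)
  have sum: "(\<Sum>j\<in>UNIV. real_of_int (k $ j) * (y + r *\<^sub>R axis i 1) $ j) =
     (\<Sum>j\<in>UNIV. real_of_int (k $ j) * y $ j) + real_of_int (k $ i) * r" for y r
  proof -
    have "(y + r *\<^sub>R axis i 1) $ j = y $ j + (if j = i then r else 0)" for j
      by (simp add: axis_def)
    then show ?thesis
      by (simp only: distrib_left sum.distrib) (simp add: if_distrib[of "(*) _"] cong: if_cong)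
  qed
  have shift: "?f (y + r *\<^sub>R axis i 1) = ?f y * exp (2 * of_real pi * \<i> * of_real (real_of_int (k $ i) * r))" for y r
    unfolding sum by (simp add: exp_add[symmetric] algebra_simps)
  have "exp (2 * of_real pi * \<i> * of_int (k $ i)) = 1"
    using exp_integer_2pi[of "of_int (k $ i)"] by (simp add: mult_ac)
  then have per: "?f (y + axis i 1) = ?f y" for y
    using shift[of y 1] by simp
  have "exp (2 * of_real pi * \<i> * of_real (real_of_int (k $ i) * s)) = -1"
  proof -
    have "2 * pi * (real_of_int (k $ i) * s) = pi \<or> 2 * pi * (real_of_int (k $ i) * s) = - pi"
      using i by (auto simp: s_def abs_if)
    then have "exp (\<i> * of_real (2 * pi * (real_of_int (k $ i) * s))) = -1"
    proof (elim disjE)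
      assume *: "2 * pi * (real_of_int (k $ i) * s) = - pi"
      show ?thesis unfolding * by (simp add: exp_minus)
    next
      assume *: "2 * pi * (real_of_int (k $ i) * s) = pi"
      show ?thesis unfolding * by simp
    qed
    then show ?thesis by (simp add: mult_ac)
  qed
  then have "integral (cbox 0 1) (\<lambda>y. ?f (y + s *\<^sub>R axis i 1)) = integral (cbox 0 1) (\<lambda>y. - ?f y)"
    unfolding shift by simp
  moreover have "integral (cbox 0 1) (\<lambda>y. ?f (y + s *\<^sub>R axis i 1)) = integral (cbox 0 1) ?f"
    using s per by (intro integral_periodic_shift) (auto intro!: continuous_intros simp: inner_axis)
  ultimately have "integral (cbox 0 1) ?f = - integral (cbox 0 1) ?f"
    by (simp only: Henstock_Kurzweil_Integration.integral_neg)
  then show ?thesis by (simp add: equation_minus_iff)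
qed


section \<open>Square integrable functions\<close>

lemma L2D: "f \<in> L2 \<Longrightarrow> f \<in> borel_measurable OmegaM" "f \<in> L2 \<Longrightarrow> integrable OmegaM (\<lambda>x. (f x)\<^sup>2)"
  by (auto simp: L2_def)

lemma L2_mult_integrable:
  assumes "f \<in> L2" "g \<in> L2"
  shows "integrable OmegaM (\<lambda>x. f x * g x)"
proof (rule Bochner_Integration.integrable_bound)
  show "integrable OmegaM (\<lambda>x. (f x)\<^sup>2 + (g x)\<^sup>2)"
    using L2D(2)[OF assms(1)] L2D(2)[OF assms(2)] by (rule Bochner_Integration.integrable_add)
  show "(\<lambda>x. f x * g x) \<in> borel_measurable OmegaM"
    using L2D(1)[OF assms(1)] L2D(1)[OF assms(2)] by measurable
  have "\<bar>a * b\<bar> \<le> a\<^sup>2 + b\<^sup>2" for a b :: real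
  proof -
    have "0 \<le> (\<bar>a\<bar> - \<bar>b\<bar>)\<^sup>2" by simp
    then have "2 * \<bar>a * b\<bar> \<le> a\<^sup>2 + b\<^sup>2" by (simp add: power2_diff abs_mult)
    then show ?thesis by (smt (verit) abs_ge_zero)
  qed
  then show "AE x in OmegaM. norm (f x * g x) \<le> norm ((f x)\<^sup>2 + (g x)\<^sup>2)"
    by auto
qed

lemma L2_add:
  assumes "f \<in> L2" "g \<in> L2"
  shows "(\<lambda>x. f x + g x) \<in> L2"
proof -
  have "integrable OmegaM (\<lambda>x. (f x)\<^sup>2 + (g x)\<^sup>2 + 2 * (f x * g x))"
    by (intro Bochner_Integration.integrable_add integrable_mult_right L2_mult_integrable L2D assms)
  moreover have "(\<lambda>x. f x + g x) \<in> borel_measurable OmegaM"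
    using L2D(1)[OF assms(1)] L2D(1)[OF assms(2)] by measurable
  ultimately show ?thesis
    by (simp add: L2_def power2_sum mult.assoc)
qed

lemma L2_cmult:
  assumes "f \<in> L2"
  shows "(\<lambda>x. c * f x) \<in> L2"
proof -
  have "(\<lambda>x. c * f x) \<in> borel_measurable OmegaM"
    using L2D(1)[OF assms(1)] by measurable
  then show ?thesis
    using L2D(2)[OF assms] by (simp add: L2_def power_mult_distrib)
qed

lemma L2_diff: "f \<in> L2 \<Longrightarrow> g \<in> L2 \<Longrightarrow> (\<lambda>x. f x - g x) \<in> L2"
  using L2_add[of f "\<lambda>x. -1 * g x"] L2_cmult[of g "-1"] by simp

lemma L2_bounded:
  assumes "f \<in> borel_measurable OmegaM" "\<And>x. x \<in> space OmegaM \<Longrightarrow> \<bar>f x\<bar> \<le> K"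
  shows "f \<in> L2"
proof -
  have "integrable OmegaM (\<lambda>x. (f x)\<^sup>2)"
  proof (rule OmegaM.integrable_const_bound)
    show "AE x in OmegaM. norm ((f x)\<^sup>2) \<le> K\<^sup>2"
      using assms(2) by (intro AE_I2) (metis abs_le_square_iff abs_norm_cancel norm_power order_trans
          abs_ge_self real_norm_def power2_abs abs_ge_zero power_mono)
  qed (use assms(1) in measurable)
  then show ?thesis using assms(1) by (simp add: L2_def)
qed

lemma L2_const: "(\<lambda>x. c) \<in> L2"
  by (rule L2_bounded[where K = "\<bar>c\<bar>"]) auto

lemma L2_integrable: "f \<in> L2 \<Longrightarrow> integrable OmegaM f"
  using L2_mult_integrable[OF _ L2_const[of 1]] by simp

lemma continuous_L2:
  assumes "continuous_on UNIV (f :: ('n::finite) pt \<Rightarrow> real)"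
  shows "f \<in> L2"
proof -
  have "compact (f ` cbox (0, -1) (1, 1))"
    by (intro compact_continuous_image continuous_on_subset[OF assms] compact_cbox) auto
  then obtain K where "\<And>x. x \<in> cbox (0, -1) (1, 1) \<Longrightarrow> \<bar>f x\<bar> \<le> K"
    using compact_imp_bounded bounded_iff by (metis imageI real_norm_def)
  then show ?thesis
    using strip_between(2) by (intro L2_bounded[of f K] continuous_measurable_OmegaM assms)
      (auto simp: space_OmegaM)
qed

lemma smooth_L2: "smooth f \<Longrightarrow> f \<in> L2"
  by (intro continuous_L2 smooth_continuous_on)

lemma L2_Cauchy_Schwarz:
  assumes "f \<in> L2" "g \<in> L2"
  shows "(LINT x|OmegaM. f x * g x)\<^sup>2 \<le> (LINT x|OmegaM. (f x)\<^sup>2) * (LINT x|OmegaM. (g x)\<^sup>2)"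
proof -
  define F I G where "F = (LINT x|OmegaM. (f x)\<^sup>2)" "I = (LINT x|OmegaM. f x * g x)"
    "G = (LINT x|OmegaM. (g x)\<^sup>2)"
  have q: "0 \<le> F - 2 * c * I + c\<^sup>2 * G" for c
  proof -
    have "0 \<le> (LINT x|OmegaM. (f x - c * g x)\<^sup>2)" by simp
    also have "\<dots> = (LINT x|OmegaM. (f x)\<^sup>2 - (2 * c) * (f x * g x) + c\<^sup>2 * (g x)\<^sup>2)"
      by (simp add: power2_diff power_mult_distrib algebra_simps)
    also have "\<dots> = F - 2 * c * I + c\<^sup>2 * G"
      using L2D(2)[OF assms(1)] L2D(2)[OF assms(2)] L2_mult_integrable[OF assms]
      by (simp add: F_I_G_def)
    finally show ?thesis .
  qed
  have "G \<ge> 0" "F \<ge> 0" by (auto simp: F_I_G_def)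
  have "I\<^sup>2 \<le> F * G"
  proof (cases "G = 0")
    case True
    have "I = 0"
    proof (rule ccontr)
      assume "I \<noteq> 0"
      \<comment> \<open>With G = 0 the quadratic in c is the affine function F - 2 c I; at this
        value of c it equals -1.\<close>
      then show False using q[of "(F + 1) / (2 * I)"] True by (simp add: field_simps)
    qed
    then show ?thesis using True by simp
  next
    case False
    then show ?thesis using q[of "I / G"] \<open>G \<ge> 0\<close> by (simp add: field_simps power2_eq_square)
  qed
  then show ?thesis by (simp add: F_I_G_def)
qed

section \<open>Integration by parts\<close>

lemma Basis_pt: "b \<in> Basis \<Longrightarrow> (\<exists>i. b = (axis i 1, 0)) \<or> b = (0 :: real^'n::finite, 1::real)"
  by (auto simp: Basis_prod_def Basis_vec_def)

lemma vertical_in_Basis: "(0 :: real^'n::finite, 1::real) \<in> Basis"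
  by (auto simp: Basis_prod_def)

lemma frechet_derivative_shift:
  fixes f :: "'a::euclidean_space \<Rightarrow> real"
  assumes "smooth f" "\<And>x. f (x + a) = f x"
  shows "frechet_derivative f (at (x + a)) b = frechet_derivative f (at x) b"
proof -
  have "((\<lambda>y. f (y + a)) has_derivative frechet_derivative f (at (x + a))) (at x)"
    by (rule has_derivative_compose[of "\<lambda>y. y + a" "\<lambda>y. y" x UNIV f "frechet_derivative f (at (x + a))"])
      (auto intro!: derivative_eq_intros smooth_has_derivative[OF assms(1)])
  then show ?thesis
    using frechet_derivative_eq[of f "frechet_derivative f (at (x + a))" x b] assms(2) by simp
qed

lemma smooth_strip_frechet:
  assumes "f \<in> smooth_strip" "b \<in> Basis"
  shows "(\<lambda>x. frechet_derivative f (at x) b) \<in> smooth_strip"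
proof -
  have "frechet_derivative f (at (y + axis i 1, z)) b = frechet_derivative f (at (y, z)) b" for y z i
    using frechet_derivative_shift[of f "(axis i 1, 0)" "(y, z)" b] assms(1)
    by (simp add: smooth_strip_def horizontally_periodic_def split_paired_all)
  then show ?thesis
    using assms smooth_frechet by (auto simp: smooth_strip_def horizontally_periodic_def)
qed

lemma smooth_strip_partials:
  "f \<in> smooth_strip \<Longrightarrow> set bs \<subseteq> Basis \<Longrightarrow> partials bs f \<in> smooth_strip"
  by (induction bs) (auto intro: smooth_strip_frechet)

lemma test_functions_frechet:
  assumes "f \<in> test_functions" "b \<in> Basis"
  shows "(\<lambda>x. frechet_derivative f (at x) b) \<in> test_functions"
proof -
  obtain r where r: "r < 1" "\<And>y z. r \<le> \<bar>z\<bar> \<Longrightarrow> f (y, z) = 0"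
    using assms(1) by (auto simp: test_functions_def)
  \<comment> \<open>Only on the open set |z| > r is f locally zero; the midpoint between r and 1
    turns this into a closed condition with a bound still below 1.\<close>
  define r' where "r' = (r + 1) / 2"
  have "frechet_derivative f (at (y, z)) b = 0" if "r' \<le> \<bar>z\<bar>" for y z
  proof -
    have "(f has_derivative (\<lambda>_. 0)) (at (y, z))"
    proof (rule has_derivative_transform_within_open)
      show "((\<lambda>_. 0) has_derivative (\<lambda>_. 0)) (at (y, z))" by simp
      show "open {x :: 'a pt. r < \<bar>snd x\<bar>}"
        by (intro open_Collect_less continuous_intros)
    qed (use that r in \<open>auto simp: r'_def\<close>)
    then show ?thesis using frechet_derivative_eq by metis
  qed
  moreover have "r' < 1" using r by (simp add: r'_def)
  ultimately show ?thesis
    using smooth_strip_frechet[OF _ assms(2)] assms(1) unfolding test_functions_def by blast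
qed

lemma test_functions_partials:
  "f \<in> test_functions \<Longrightarrow> set bs \<subseteq> Basis \<Longrightarrow> partials bs f \<in> test_functions"
  by (induction bs) (auto intro: test_functions_frechet)

lemma test_functions_smooth: "f \<in> test_functions \<Longrightarrow> smooth f"
  by (simp add: test_functions_def smooth_strip_def)

lemma LINT_vertical_derivative:
  fixes P :: "('n::finite) pt \<Rightarrow> real"
  assumes "smooth P"
  shows "(LINT x|OmegaM. frechet_derivative P (at x) (0, 1)) = (LINT y|cellM. P (y, 1) - P (y, -1))"
proof -
  have c: "continuous_on A (\<lambda>x. frechet_derivative P (at x) (0, 1))" for A
    by (intro smooth_continuous_on smooth_frechet[OF assms vertical_in_Basis])
  have inner: "integral (cbox (-1) 1) (\<lambda>z. frechet_derivative P (at (y, z)) (0, 1)) = P (y, 1) - P (y, -1)" for y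
  proof -
    have "((\<lambda>z. frechet_derivative P (at (y, z)) (0, 1)) has_integral P (y, 1) - P (y, -1)) {-1..1}"
      using smooth_line_derivative[OF assms, of "(y, 0)" "(0, 1)"]
      by (intro fundamental_theorem_of_calculus) auto
    then show ?thesis by (simp add: integral_unique)
  qed
  have "(LINT x|OmegaM. frechet_derivative P (at x) (0, 1)) =
      integral (cbox 0 1) (\<lambda>y. integral (cbox (-1) 1) (\<lambda>z. frechet_derivative P (at (y, z)) (0, 1)))"
    by (subst LINT_OmegaM(2)[OF c], subst integral_prod_continuous[OF c]) simp
  also have "\<dots> = (LINT y|cellM. P (y, 1) - P (y, -1))"
    unfolding inner
    by (intro LINT_cellM(2)[symmetric] continuous_intros continuous_on_compose2[OF smooth_continuous_on[OF assms, of UNIV]]) auto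
  finally show ?thesis .
qed

lemma LINT_derivative_zero:
  fixes P :: "('n::finite) pt \<Rightarrow> real"
  assumes "P \<in> smooth_strip" "b \<in> Basis" "\<And>y. P (y, 1) = 0" "\<And>y. P (y, -1) = 0"
  shows "(LINT x|OmegaM. frechet_derivative P (at x) b) = 0"
proof -
  have s: "smooth P" using assms(1) by (simp add: smooth_strip_def)
  consider i where "b = (axis i 1, 0)" | "b = (0, 1)" using Basis_pt[OF assms(2)] by auto
  then show ?thesis
  proof cases
    case 1
    have "integral (cbox (0, -1) (1, 1)) (\<lambda>x. frechet_derivative P (at x) b) = 0"
      using assms(1)
      by (intro integral_periodic_derivative[OF s assms(2)])
        (auto simp: 1 inner_axis smooth_strip_def horizontally_periodic_def split_paired_all)
    then show ?thesis
      by (subst LINT_OmegaM(2)) (auto intro: smooth_continuous_on smooth_frechet s assms)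
  next
    case 2
    then show ?thesis using LINT_vertical_derivative[OF s] assms(3,4) by simp
  qed
qed

lemma frechet_derivative_mult:
  assumes "smooth u" "smooth v"
  shows "frechet_derivative (\<lambda>x. u x * v x) (at x) b =
    u x * frechet_derivative v (at x) b + frechet_derivative u (at x) b * v x"
  by (rule frechet_derivative_eq) (intro has_derivative_mult smooth_has_derivative assms)

lemma smooth_strip_mult: "u \<in> smooth_strip \<Longrightarrow> v \<in> smooth_strip \<Longrightarrow> (\<lambda>x. u x * v x) \<in> smooth_strip"
  by (auto simp: smooth_strip_def horizontally_periodic_def intro: smooth_mult)

lemma smooth_stripD: "u \<in> smooth_strip \<Longrightarrow> smooth u"
  by (simp add: smooth_strip_def)

lemma LINT_by_parts:
  assumes "u \<in> smooth_strip" "\<phi> \<in> test_functions" "b \<in> Basis"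
  shows "(LINT x|OmegaM. u x * frechet_derivative \<phi> (at x) b) =
    - (LINT x|OmegaM. frechet_derivative u (at x) b * \<phi> x)"
proof -
  have \<phi>: "\<phi> \<in> smooth_strip" using assms by (simp add: test_functions_def)
  note s = smooth_stripD[OF assms(1)] smooth_stripD[OF \<phi>]
  have "0 = (LINT x|OmegaM. frechet_derivative (\<lambda>x. u x * \<phi> x) (at x) b)"
    using assms(2) unfolding test_functions_def
    by (intro LINT_derivative_zero[symmetric] smooth_strip_mult assms \<phi>) force+
  also have "\<dots> = (LINT x|OmegaM. u x * frechet_derivative \<phi> (at x) b) +
      (LINT x|OmegaM. frechet_derivative u (at x) b * \<phi> x)"
    unfolding frechet_derivative_mult[OF s]
    by (intro Bochner_Integration.integral_add L2_integrable smooth_L2 smooth_mult smooth_frechet s assms)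
  finally show ?thesis by simp
qed

text \<open>Integration by parts removes the outermost direction of the list from the test function
  first, and this direction becomes the innermost one on \<open>u\<close>. Hence the reversed
  list.\<close>

lemma has_weak_deriv_smooth:
  assumes "u \<in> smooth_strip" "set bs \<subseteq> Basis"
  shows "has_weak_deriv bs u (partials (rev bs) u)"
proof -
  have "(LINT x|OmegaM. u x * partials bs \<phi> x) = (-1) ^ length bs * (LINT x|OmegaM. partials (rev bs) u x * \<phi> x)"
    if "\<phi> \<in> test_functions" for \<phi>
    using assms that
  proof (induction bs arbitrary: u)
    case (Cons b bs)
    have "(LINT x|OmegaM. u x * partials (b # bs) \<phi> x) =
        - (LINT x|OmegaM. frechet_derivative u (at x) b * partials bs \<phi> x)"
      using LINT_by_parts[OF Cons.prems(1) test_functions_partials[OF Cons.prems(3), of bs], of b]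
        Cons.prems by simp
    also have "(LINT x|OmegaM. frechet_derivative u (at x) b * partials bs \<phi> x) =
       (-1) ^ length bs * (LINT x|OmegaM. partials (rev bs) (\<lambda>x. frechet_derivative u (at x) b) x * \<phi> x)"
      using Cons.prems by (intro Cons.IH smooth_strip_frechet) auto
    finally show ?case by (simp add: partials_append)
  qed simp
  then show ?thesis
    using assms by (auto simp: has_weak_deriv_def intro!: smooth_L2 smooth_partials dest: smooth_stripD)
qed

section \<open>The fundamental lemma of the calculus of variations\<close>

text \<open>Sets over which g integrates to zero are closed under complements and countable disjoint
  unions, and open boxes are an intersection-stable generator of the Borel sets. The support
  condition makes the integral over the whole space an integral over a box, as the complement step
  requires.\<close>

lemma AE_zero_if_box_integrals_zero:
  fixes g :: "'a::euclidean_space \<Rightarrow> real"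
  assumes g: "integrable lborel g" and supp: "\<And>x. x \<notin> box u v \<Longrightarrow> g x = 0"
    and box: "\<And>a b. (LINT x:box a b|lborel. g x) = 0"
  shows "AE x in lborel. g x = 0"
proof (rule density_unique_real)
  show "(LINT x:A|lborel. g x) = (LINT x:A|lborel. 0)" if "A \<in> sets lborel" for A
  proof -
    have si: "set_integrable lborel A g" if "A \<in> sets borel" for A
      using integrable_mult_indicator[OF _ g, of A] that by (simp add: set_integrable_def)
    have sets: "sigma_sets UNIV (range (\<lambda>(a, b). box a b :: 'a set)) = sets borel"
      by (subst borel_eq_box) simp
    have A: "A \<in> sigma_sets UNIV (range (\<lambda>(a, b). box a b :: 'a set))"
      using that sets by simp
    have sub: "range (\<lambda>(a, b). box a b :: 'a set) \<subseteq> Pow UNIV" by simp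
    have stable: "Int_stable (range (\<lambda>(a, b). box a b :: 'a set))"
      unfolding Int_stable_def by (auto simp: box_Int_box)
    have univ: "(LINT x|lborel. g x) = 0"
    proof -
      have "(LINT x|lborel. g x) = (LINT x:box u v|lborel. g x)"
        unfolding set_lebesgue_integral_def
        by (rule Bochner_Integration.integral_cong) (use supp in \<open>auto simp: indicator_def\<close>)
      then show ?thesis using box by simp
    qed
    have "(LINT x:A|lborel. g x) = 0"
      using stable sub A
    proof (induction rule: sigma_sets_induct_disjoint)
      case (basic A)
      then show ?case using box by auto
    next
      case empty
      show ?case by (simp add: set_lebesgue_integral_def)
    next
      case (compl A)
      then have A: "A \<in> sets borel" using sets by simp
      have "(LINT x:UNIV|lborel. g x) = (LINT x:A|lborel. g x) + (LINT x:UNIV - A|lborel. g x)"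
        using A by (subst set_integral_Un[symmetric]) (auto intro!: si simp: Un_Diff_cancel)
      then show ?case using compl univ by (simp add: set_lebesgue_integral_def)
    next
      case (union A)
      then have A: "A i \<in> sets borel" for i using sets by auto
      have "(LINT x:(\<Union>i. A i)|lborel. g x) = (\<Sum>i. (LINT x:(A i)|lborel. g x))"
        using union A by (intro lebesgue_integral_countable_add si) (auto simp: disjoint_family_on_def)
      then show ?case using union by simp
    qed
    then show ?thesis by simp
  qed
qed (use g in auto)

text \<open>The product \<open>sin (pi (y - a)) sin (pi (b - y))\<close> has period 1 in \<open>y\<close> and is positive in
  the open unit interval exactly between \<open>a\<close> and \<open>b\<close>, if \<open>0 \<le> a < b \<le> 1\<close>.\<close>

definition box_bump :: "('n::finite) pt \<Rightarrow> 'n pt \<Rightarrow> nat \<Rightarrow> 'n pt \<Rightarrow> real" where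
  "box_bump a b n x =
     (\<Prod>i\<in>UNIV. flat (real n * (sin (pi * (fst x $ i - fst a $ i)) * sin (pi * (fst b $ i - fst x $ i)))))
       * flat (real n * ((snd x - snd a) * (snd b - snd x)) - 1)"

lemma smooth_fst_nth: "smooth (\<lambda>x :: ('n::finite) pt. fst x $ i)"
  by (intro smooth_bounded_linear bounded_linear_compose[OF bounded_linear_vec_nth bounded_linear_fst])

lemma smooth_snd: "smooth (\<lambda>x :: ('n::finite) pt. snd x)"
  by (intro smooth_bounded_linear bounded_linear_snd)

lemma smooth_box_bump: "smooth (box_bump a b n)"
  unfolding box_bump_def[abs_def]
  by (intro smooth_mult smooth_prod smooth_compose_smooth[OF smooth_flat] smooth_diff smooth_sin
      smooth_const smooth_fst_nth smooth_snd)

lemma box_bump_bounds: "\<bar>box_bump a b n x\<bar> \<le> 1"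
proof -
  have "0 \<le> box_bump a b n x"
    unfolding box_bump_def by (intro mult_nonneg_nonneg prod_nonneg flat_bounds)
  moreover have "box_bump a b n x \<le> 1"
    unfolding box_bump_def by (intro mult_le_one prod_nonneg prod_le_1 conjI flat_bounds)
  ultimately show ?thesis by simp
qed

text \<open>The -1 in the vertical factor creates a margin at the boundary: if |z| is at least 1 -
  1/(2(n+1)), the vertical product is at most 1/(n+1), so the argument of \<open>flat\<close> is not
  positive. Horizontally, a unit shift changes the sign of both sines.\<close>

lemma box_bump_test:
  assumes "-1 \<le> snd a" "snd b \<le> 1" "snd a < snd b"
  shows "box_bump a b n \<in> test_functions"
proof -
  have per: "box_bump a b n (y + axis j 1, z) = box_bump a b n (y, z)" for y z j
  proof -
    have "sin (pi * ((y + axis j 1) $ i - fst a $ i)) * sin (pi * (fst b $ i - (y + axis j 1) $ i)) =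
        sin (pi * (y $ i - fst a $ i)) * sin (pi * (fst b $ i - y $ i))" for i
    proof (cases "i = j")
      case True
      have "sin (pi * (y $ i + 1 - fst a $ i)) = sin (pi * (y $ i - fst a $ i) + pi)"
        "sin (pi * (fst b $ i - (y $ i + 1))) = sin (pi * (fst b $ i - y $ i) - pi)"
        by (simp_all add: algebra_simps)
      then show ?thesis using True by (simp add: axis_def)
    qed (simp add: axis_def)
    then show ?thesis by (simp add: box_bump_def)
  qed
  define \<rho> where "\<rho> = 1 - 1 / (2 * (real n + 1))"
  have zero: "box_bump a b n (y, z) = 0" if z: "\<rho> \<le> \<bar>z\<bar>" for y z
  proof -
    have "(z - snd a) * (snd b - z) \<le> 1 / (real n + 1)"
    proof (cases "z \<le> snd a \<or> snd b \<le> z")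
      case True
      then have "(z - snd a) * (snd b - z) \<le> 0"
        using assms(3) by (auto simp: mult_le_0_iff)
      then show ?thesis by (rule order_trans) simp
    next
      case False
      then have *: "z - snd a \<le> 2" "snd b - z \<le> 2" "z - snd a \<ge> 0" "snd b - z \<ge> 0" using assms by auto
      have "(z - snd a) * (snd b - z) \<le> (1 - \<rho>) * 2"
      proof (cases "z - snd a \<le> 1 - \<rho>")
        case True
        then show ?thesis using * by (intro mult_mono) auto
      next
        case False
        then have "snd b - z \<le> 1 - \<rho>" using z assms by auto
        then have "(snd b - z) * (z - snd a) \<le> (1 - \<rho>) * 2" using * by (intro mult_mono) auto
        then show ?thesis by (simp add: mult.commute)
      qed
      then show ?thesis unfolding \<rho>_def by (simp add: field_simps)
    qed
    then have "real n * ((z - snd a) * (snd b - z)) \<le> real n * (1 / (real n + 1))"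
      by (intro mult_left_mono) auto
    also have "\<dots> \<le> 1" by simp
    finally have "flat (real n * ((z - snd a) * (snd b - z)) - 1) = 0"
      by (simp add: flat_def)
    then show ?thesis by (simp add: box_bump_def)
  qed
  have "\<rho> < 1" by (simp add: \<rho>_def)
  then show ?thesis
    using smooth_box_bump per zero
    unfolding test_functions_def smooth_strip_def horizontally_periodic_def by blast
qed

lemma flat_nonpos: "u \<le> 0 \<Longrightarrow> flat u = 0"
  by (simp add: flat_def)

lemma flat_scaled_tendsto:
  assumes "u > 0"
  shows "(\<lambda>n. flat (real n * u - c)) \<longlonglongrightarrow> 1"
proof (rule flat_tendsto_1)
  have "filterlim (\<lambda>n. - c + u * real n) at_top sequentially"
    by (intro filterlim_tendsto_add_at_top[OF tendsto_const]
        filterlim_tendsto_pos_mult_at_top[OF tendsto_const assms] filterlim_real_sequentially)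
  then show "filterlim (\<lambda>n. real n * u - c) at_top sequentially"
    by (simp add: algebra_simps)
qed

text \<open>Inside the box every argument of \<open>flat\<close> tends to infinity. Outside, some
  argument is at most 0 for all n, because in the open unit cube each sine has the sign of the
  difference it contains; that factor is then 0.\<close>

lemma box_bump_tendsto:
  fixes a b x :: "('n::finite) pt"
  assumes ab: "\<And>i. fst a $ i < fst b $ i" "\<And>i. 0 \<le> fst a $ i" "\<And>i. fst b $ i \<le> 1" "snd a < snd b"
    and x: "x \<in> box (0, -1) (1, 1)"
  shows "(\<lambda>n. box_bump a b n x) \<longlonglongrightarrow> indicator (box a b) x"
proof -
  have x': "0 < fst x $ i" "fst x $ i < 1" for i
    using x by (cases x, auto simp: box_Pair_eq mem_box_01)+
  have mem: "x \<in> box a b \<longleftrightarrow> (\<forall>i. fst a $ i < fst x $ i \<and> fst x $ i < fst b $ i) \<and> snd a < snd x \<and> snd x < snd b"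
    by (cases a; cases b; cases x) (auto simp: box_Pair_eq mem_box_cart)
  show ?thesis
  proof (cases "x \<in> box a b")
    case True
    have "0 < sin (pi * (fst x $ i - fst a $ i)) * sin (pi * (fst b $ i - fst x $ i))" for i
      using True[unfolded mem] ab(1-3)[of i] x'[of i]
      by (intro mult_pos_pos sin_gt_zero) (auto simp: mult_less_cancel_left2 not_le)
    moreover have "0 < (snd x - snd a) * (snd b - snd x)"
      using True[unfolded mem] by auto
    ultimately have "(\<lambda>n. box_bump a b n x) \<longlonglongrightarrow> (\<Prod>i\<in>(UNIV::'n set). 1) * 1"
      unfolding box_bump_def
      by (intro tendsto_mult tendsto_prod flat_scaled_tendsto flat_scaled_tendsto[where c = 0, simplified])
    then show ?thesis using True by simp
  next
    case False
    have "box_bump a b n x = 0" for n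
    proof (cases "snd a < snd x \<and> snd x < snd b")
      case True
      then obtain i where i: "fst x $ i \<le> fst a $ i \<or> fst b $ i \<le> fst x $ i"
        using False mem by (auto simp: not_less)
      have "sin (pi * (fst x $ i - fst a $ i)) * sin (pi * (fst b $ i - fst x $ i)) \<le> 0"
      proof (cases "fst x $ i \<le> fst a $ i")
        case True
        have "0 \<le> sin (pi * (fst a $ i - fst x $ i))" "0 \<le> sin (pi * (fst b $ i - fst x $ i))"
          using True ab(1-3)[of i] x'[of i] less_imp_le[OF ab(1)[of i]]
          by (auto intro!: sin_ge_zero simp: mult_le_cancel_left2)
        moreover have "sin (pi * (fst x $ i - fst a $ i)) = - sin (pi * (fst a $ i - fst x $ i))"
          by (simp add: sin_minus[symmetric] algebra_simps)
        ultimately show ?thesis by simp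
      next
        case False
        then have "fst b $ i \<le> fst x $ i" using i by simp
        then have "0 \<le> sin (pi * (fst x $ i - fst a $ i))" "0 \<le> sin (pi * (fst x $ i - fst b $ i))"
          using ab(1-3)[of i] x'[of i]
          by (auto intro!: sin_ge_zero simp: mult_le_cancel_left2)
        moreover have "sin (pi * (fst b $ i - fst x $ i)) = - sin (pi * (fst x $ i - fst b $ i))"
          by (simp add: sin_minus[symmetric] algebra_simps)
        ultimately show ?thesis by simp
      qed
      then have "flat (real n * (sin (pi * (fst x $ i - fst a $ i)) * sin (pi * (fst b $ i - fst x $ i)))) = 0"
        by (intro flat_nonpos mult_nonneg_nonpos[OF of_nat_0_le_iff])
      then have "(\<Prod>i\<in>UNIV. flat (real n * (sin (pi * (fst x $ i - fst a $ i)) * sin (pi * (fst b $ i - fst x $ i))))) = 0"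
        by (intro prod_zero) auto
      then show ?thesis by (simp add: box_bump_def)
    next
      case False
      then have "(snd x - snd a) * (snd b - snd x) \<le> 0"
        using ab(4) by (auto simp: mult_le_0_iff not_less)
      then have "real n * ((snd x - snd a) * (snd b - snd x)) \<le> 0"
        by (intro mult_nonneg_nonpos[OF of_nat_0_le_iff])
      then show ?thesis by (simp add: box_bump_def flat_def)
    qed
    then show ?thesis using False by simp
  qed
qed

text \<open>The bumps converge boundedly to indicators of boxes, so dominated convergence gives zero
  integrals of h over all boxes inside the open cell. An arbitrary box is first intersected with the
  cell, which gives a box again.\<close>

lemma weak_zero:
  fixes h :: "('n::finite) pt \<Rightarrow> real"
  assumes h: "integrable OmegaM h" and 0: "\<And>\<phi>. \<phi> \<in> test_functions \<Longrightarrow> (LINT x|OmegaM. h x * \<phi> x) = 0"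
  shows "AE x in OmegaM. h x = 0"
proof -
  let ?B = "box (0, -1) (1, 1) :: 'n pt set" and ?S = "cell \<times> {-1..1} :: 'n pt set"
  have S: "?S \<in> sets borel" by (rule strip_borel)
  define g where "g x = indicator ?B x *\<^sub>R (indicator ?S x *\<^sub>R h x)" for x
  have hm: "h \<in> borel_measurable OmegaM" using h by auto
  have "integrable lborel (\<lambda>x. indicator ?S x *\<^sub>R h x)"
    using h S unfolding OmegaM_def using integrable_restrict_space[of ?S lborel h] by simp
  then have g: "integrable lborel g"
    unfolding g_def[abs_def] by (rule integrable_mult_indicator[rotated]) auto
  have *: "(LINT x|OmegaM. h x * indicator (box a b) x) = 0" if sub: "box a b \<subseteq> ?B" for a b :: "'n pt"
  proof (cases "box a b = {}")
    case False
    then have ne: "a \<bullet> i < b \<bullet> i" if "i \<in> Basis" for i using that by (simp add: box_ne_empty)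
    have in01: "(0, -1) \<bullet> i \<le> a \<bullet> i \<and> b \<bullet> i \<le> (1, 1) \<bullet> i" if "i \<in> Basis" for i
      using sub ne that subset_box(4)[of a b "(0, -1)" "(1, 1)"] by blast
    have h1: "fst a $ i < fst b $ i" "0 \<le> fst a $ i" "fst b $ i \<le> 1" for i
      using ne[of "(axis i 1, 0)"] in01[of "(axis i 1, 0)"]
      by (cases a; cases b; auto simp: Basis_prod_def inner_axis)+
    have h2: "snd a < snd b" "-1 \<le> snd a" "snd b \<le> 1"
      using ne[OF vertical_in_Basis] in01[OF vertical_in_Basis] by (cases a; cases b; auto)+
    have "(\<lambda>n. LINT x|OmegaM. h x * box_bump a b n x) \<longlonglongrightarrow> (LINT x|OmegaM. h x * indicator (box a b) x)"
    proof (rule integral_dominated_convergence[where w = "\<lambda>x. \<bar>h x\<bar>"])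
      show "AE x in OmegaM. (\<lambda>n. h x * box_bump a b n x) \<longlonglongrightarrow> h x * indicator (box a b) x"
        using AE_OmegaM_box by eventually_elim (intro tendsto_intros box_bump_tendsto h1 h2)
      show "AE x in OmegaM. norm (h x * box_bump a b n x) \<le> \<bar>h x\<bar>" for n
        by (auto simp: abs_mult intro!: mult_left_le AE_I2 box_bump_bounds)
      show "(\<lambda>x. h x * indicator (box a b) x) \<in> borel_measurable OmegaM"
      proof (rule borel_measurable_times[OF hm])
        show "indicator (box a b) \<in> borel_measurable (OmegaM :: 'n pt measure)"
          unfolding OmegaM_def by (rule measurable_restrict_space1) auto
      qed
      show "(\<lambda>x. h x * box_bump a b n x) \<in> borel_measurable OmegaM" for n
        by (rule borel_measurable_times[OF hm smooth_measurable_OmegaM[OF smooth_box_bump]])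
    qed (use h in auto)
    then show ?thesis
      using 0[OF box_bump_test[OF h2(2,3,1)]] LIMSEQ_unique[OF _ tendsto_const] by fastforce
  qed simp
  have "AE x in lborel. g x = 0"
  proof (rule AE_zero_if_box_integrals_zero[OF g])
    show "g x = 0" if "x \<notin> ?B" for x using that by (simp add: g_def)
    fix a b :: "'n pt"
    obtain a' b' where ab: "box a b \<inter> ?B = box a' b'"
      using box_Int_box by blast
    have "(LINT x:box a b|lborel. g x) = (LINT x|lborel. indicator ?S x *\<^sub>R (h x * indicator (box a' b') x))"
      unfolding set_lebesgue_integral_def ab[symmetric]
      by (rule Bochner_Integration.integral_cong) (auto simp: g_def indicator_def)
    also have "\<dots> = (LINT x|OmegaM. h x * indicator (box a' b') x)"
      unfolding OmegaM_def using S by (subst integral_restrict_space) auto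
    also have "\<dots> = 0" using ab by (intro *) auto
    finally show "(LINT x:box a b|lborel. g x) = 0" .
  qed
  then have "AE x in OmegaM. g x = 0"
    unfolding OmegaM_def using S by (subst AE_restrict_space_iff) auto
  with AE_OmegaM_box AE_space show ?thesis
    by eventually_elim (auto simp: g_def space_OmegaM)
qed

section \<open>Uniqueness and calculus of weak derivatives\<close>

lemma has_weak_deriv_unique:
  assumes "has_weak_deriv bs f g" "has_weak_deriv bs f h"
  shows "AE x in OmegaM. g x = h x"
proof -
  have L: "g \<in> L2" "h \<in> L2" using assms by (auto simp: has_weak_deriv_def)
  have "AE x in OmegaM. g x - h x = 0"
  proof (rule weak_zero)
    show "integrable OmegaM (\<lambda>x. g x - h x)"
      by (intro L2_integrable L2_diff L)
    fix \<phi> :: "'a pt \<Rightarrow> real" assume \<phi>: "\<phi> \<in> test_functions"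
    then have "\<phi> \<in> L2" by (intro smooth_L2 test_functions_smooth)
    then have "(LINT x|OmegaM. (g x - h x) * \<phi> x) = (LINT x|OmegaM. g x * \<phi> x) - (LINT x|OmegaM. h x * \<phi> x)"
      by (simp add: left_diff_distrib L2_mult_integrable L)
    also have "\<dots> = 0" using assms \<phi> by (auto simp: has_weak_deriv_def)
    finally show "(LINT x|OmegaM. (g x - h x) * \<phi> x) = 0" .
  qed
  then show ?thesis by simp
qed

lemma has_weak_deriv_weak_deriv: "has_weak_deriv bs f g \<Longrightarrow> has_weak_deriv bs f (weak_deriv bs f)"
  unfolding weak_deriv_def by (rule someI[of "has_weak_deriv bs f"])

text \<open>The arbitrary choice in \<open>weak_deriv\<close> thus matters only on a null set, and
  computations may use any representative.\<close>

lemma weak_deriv_AE: "has_weak_deriv bs f g \<Longrightarrow> AE x in OmegaM. weak_deriv bs f x = g x"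
  using has_weak_deriv_unique has_weak_deriv_weak_deriv by blast

lemma has_weak_deriv_AE_cong:
  assumes "has_weak_deriv bs f g" "AE x in OmegaM. f x = f' x" "f \<in> L2" "f' \<in> L2" "set bs \<subseteq> Basis"
  shows "has_weak_deriv bs f' g"
proof -
  have "(LINT x|OmegaM. f' x * partials bs \<phi> x) = (LINT x|OmegaM. f x * partials bs \<phi> x)"
    if "\<phi> \<in> test_functions" for \<phi>
  proof -
    have "partials bs \<phi> \<in> L2"
      using that assms(5) by (intro smooth_L2 smooth_partials test_functions_smooth)
    from L2D(1)[OF this] show ?thesis
      using assms(2) L2D(1)[OF assms(3)] L2D(1)[OF assms(4)]
      by (intro integral_cong_AE) (auto intro!: borel_measurable_times)
  qed
  then show ?thesis
    using assms(1) by (auto simp: has_weak_deriv_def)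
qed

lemma has_weak_deriv_diff:
  assumes "has_weak_deriv bs f g" "has_weak_deriv bs f' g'" "f \<in> L2" "f' \<in> L2" "set bs \<subseteq> Basis"
  shows "has_weak_deriv bs (\<lambda>x. f x - f' x) (\<lambda>x. g x - g' x)"
proof -
  have L: "g \<in> L2" "g' \<in> L2" using assms by (auto simp: has_weak_deriv_def)
  have "(LINT x|OmegaM. (f x - f' x) * partials bs \<phi> x) =
      (-1) ^ length bs * (LINT x|OmegaM. (g x - g' x) * \<phi> x)"
    if \<phi>: "\<phi> \<in> test_functions" for \<phi>
  proof -
    have p: "partials bs \<phi> \<in> L2" "\<phi> \<in> L2"
      using \<phi> assms(5) by (auto intro: smooth_L2 smooth_partials dest: test_functions_smooth)
    have "(LINT x|OmegaM. (f x - f' x) * partials bs \<phi> x) =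
        (LINT x|OmegaM. f x * partials bs \<phi> x) - (LINT x|OmegaM. f' x * partials bs \<phi> x)"
      by (simp add: left_diff_distrib L2_mult_integrable p assms)
    also have "\<dots> = (-1) ^ length bs * (LINT x|OmegaM. g x * \<phi> x) - (-1) ^ length bs * (LINT x|OmegaM. g' x * \<phi> x)"
      using assms(1,2) \<phi> by (simp add: has_weak_deriv_def)
    also have "\<dots> = (-1) ^ length bs * (LINT x|OmegaM. (g x - g' x) * \<phi> x)"
      by (simp add: left_diff_distrib right_diff_distrib L2_mult_integrable p L)
    finally show ?thesis .
  qed
  then show ?thesis using L by (auto simp: has_weak_deriv_def L2_diff)
qed

lemma has_weak_deriv_Nil: "f \<in> L2 \<Longrightarrow> has_weak_deriv [] f f"
  by (simp add: has_weak_deriv_def)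

text \<open>Since test functions are closed under differentiation, a higher weak derivative can be
  regarded as a weak derivative of a lower one. This permits integrating by parts one order at a
  time.\<close>

lemma has_weak_deriv_append:
  assumes "has_weak_deriv as f g" "has_weak_deriv (as @ bs) f h" "set bs \<subseteq> Basis"
  shows "has_weak_deriv bs g h"
proof -
  have "(LINT x|OmegaM. g x * partials bs \<phi> x) = (-1) ^ length bs * (LINT x|OmegaM. h x * \<phi> x)"
    if \<phi>: "\<phi> \<in> test_functions" for \<phi>
  proof -
    have "(-1) ^ length as * (LINT x|OmegaM. g x * partials bs \<phi> x) = (LINT x|OmegaM. f x * partials as (partials bs \<phi>) x)"
      using assms(1) test_functions_partials[OF \<phi> assms(3)] by (simp add: has_weak_deriv_def)
    also have "\<dots> = (-1) ^ length as * ((-1) ^ length bs * (LINT x|OmegaM. h x * \<phi> x))"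
      using assms(2) \<phi> by (simp add: has_weak_deriv_def partials_append power_add)
    finally show ?thesis by simp
  qed
  then show ?thesis using assms(2) by (simp add: has_weak_deriv_def)
qed


section \<open>Series of smooth functions\<close>

lemma esqrt_le: "a \<le> ennreal b \<Longrightarrow> 0 \<le> b \<Longrightarrow> esqrt a \<le> ennreal (sqrt b)"
  unfolding esqrt_def
  by (auto intro!: ennreal_leI real_sqrt_le_mono simp: enn2real_leI top_unique)

lemma Hnorm_1_eq:
  "f \<in> sobolev 1 \<Longrightarrow> Hnorm 1 f = esqrt (\<Sum>bs | set bs \<subseteq> Basis \<and> length bs \<le> 1.
     \<integral>\<^sup>+ x. ennreal ((weak_deriv bs f x)\<^sup>2) \<partial>OmegaM)"
  by (simp only: Hnorm_def Let_def) simp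

lemma finite_direction_lists: "finite {bs :: 'a::euclidean_space list. set bs \<subseteq> Basis \<and> length bs \<le> k}"
  by (rule finite_lists_length_le) auto

lemma nn_integral_OmegaM_const:
  assumes "0 \<le> c"
  shows "(\<integral>\<^sup>+ x. ennreal c \<partial>(OmegaM :: ('n::finite) pt measure)) = ennreal (2 * c)"
proof -
  have "(\<integral>\<^sup>+ x. ennreal c \<partial>(OmegaM :: 'n pt measure)) = ennreal c * ennreal 2"
    using OmegaM.emeasure_eq_measure[of "space (OmegaM :: 'n pt measure)"] measure_OmegaM[where 'n = 'n]
    by simp
  then show ?thesis using assms by (simp add: ennreal_mult mult.commute)
qed

text \<open>\<open>K j\<close> bounds all derivatives of the j-th term up to order m at once, so one
  summable majorant gives uniform convergence of every differentiated series.\<close>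

locale smooth_series =
  fixes U :: "nat \<Rightarrow> ('n::finite) pt \<Rightarrow> real" and m :: nat and K :: "nat \<Rightarrow> real"
  assumes strip: "U j \<in> smooth_strip"
    and bound: "set bs \<subseteq> Basis \<Longrightarrow> length bs \<le> m \<Longrightarrow> \<bar>partials bs (U j) x\<bar> \<le> K j"
    and summable_K: "summable K"
begin

definition D :: "'n pt list \<Rightarrow> 'n pt \<Rightarrow> real" where
  "D bs x = (\<Sum>j. partials bs (U j) x)"

lemma summable_D:
  assumes "set bs \<subseteq> Basis" "length bs \<le> m"
  shows "summable (\<lambda>j. \<bar>partials bs (U j) x\<bar>)"
  by (rule summable_comparison_test'[OF summable_K]) (use bound[OF assms] in auto)

lemma K_nonneg: "0 \<le> K j"
  using bound[of "[]" j 0] by simp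

text \<open>Serves twice: J = 0 gives a uniform bound for the sum, and J tending to infinity gives
  the smooth approximation behind the traces.\<close>

lemma D_tail:
  assumes "set bs \<subseteq> Basis" "length bs \<le> m"
  shows "\<bar>(\<Sum>j<J. partials bs (U j) x) - D bs x\<bar> \<le> (\<Sum>j. K (j + J))"
proof -
  have "D bs x - (\<Sum>j<J. partials bs (U j) x) = (\<Sum>j. partials bs (U (j + J)) x)"
    unfolding D_def
    using suminf_split_initial_segment[OF summable_rabs_cancel[OF summable_D[OF assms, of x]], of J] by simp
  moreover have "\<bar>\<Sum>j. partials bs (U (j + J)) x\<bar> \<le> (\<Sum>j. K (j + J))"
  proof (rule order_trans[OF summable_rabs])
    show s: "summable (\<lambda>j. \<bar>partials bs (U (j + J)) x\<bar>)"
      by (rule summable_ignore_initial_segment[OF summable_D[OF assms]])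
    show "(\<Sum>j. \<bar>partials bs (U (j + J)) x\<bar>) \<le> (\<Sum>j. K (j + J))"
      by (intro suminf_le s summable_ignore_initial_segment summable_K bound assms)
  qed
  ultimately show ?thesis by simp
qed

lemma D_L2:
  assumes "set bs \<subseteq> Basis" "length bs \<le> m"
  shows "D bs \<in> L2"
proof (rule L2_bounded)
  show "D bs \<in> borel_measurable OmegaM"
    unfolding D_def[abs_def]
    by (intro borel_measurable_suminf smooth_measurable_OmegaM smooth_partials smooth_stripD strip assms)
  show "\<bar>D bs x\<bar> \<le> (\<Sum>j. K j)" for x
    using D_tail[OF assms, where J = 0] by simp
qed

text \<open>The weight has values in a Banach space so that one statement covers real test functions
  and complex basis functions. Partial sums are dominated by twice the sum of \<open>K\<close>: once
  for the full series, once for the remainder.\<close>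

lemma LINT_D:
  fixes \<psi> :: "'n pt \<Rightarrow> 'b::{banach, second_countable_topology}"
  assumes "set bs \<subseteq> Basis" "length bs \<le> m" and \<psi>: "integrable OmegaM \<psi>"
  shows "(\<lambda>j. LINT x|OmegaM. partials bs (U j) x *\<^sub>R \<psi> x) sums (LINT x|OmegaM. D bs x *\<^sub>R \<psi> x)"
proof -
  have "(\<lambda>J. LINT x|OmegaM. (\<Sum>j<J. partials bs (U j) x) *\<^sub>R \<psi> x) \<longlonglongrightarrow> (LINT x|OmegaM. D bs x *\<^sub>R \<psi> x)"
  proof (rule integral_dominated_convergence[where w = "\<lambda>x. 2 * (\<Sum>j. K j) * norm (\<psi> x)"])
    have m: "\<psi> \<in> borel_measurable OmegaM" using \<psi> by auto
    show "(\<lambda>x. D bs x *\<^sub>R \<psi> x) \<in> borel_measurable OmegaM"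
      using D_L2[OF assms(1,2)] m by (auto simp: L2_def)
    show "(\<lambda>x. (\<Sum>j<J. partials bs (U j) x) *\<^sub>R \<psi> x) \<in> borel_measurable OmegaM" for J
      by (intro borel_measurable_scaleR m borel_measurable_sum smooth_measurable_OmegaM
          smooth_partials smooth_stripD strip assms)
    show "AE x in OmegaM. (\<lambda>J. (\<Sum>j<J. partials bs (U j) x) *\<^sub>R \<psi> x) \<longlonglongrightarrow> D bs x *\<^sub>R \<psi> x"
      unfolding D_def
      by (intro AE_I2 tendsto_scaleR tendsto_const summable_LIMSEQ
          summable_rabs_cancel[OF summable_D[OF assms(1,2)]])
    show "AE x in OmegaM. norm ((\<Sum>j<J. partials bs (U j) x) *\<^sub>R \<psi> x) \<le> 2 * (\<Sum>j. K j) * norm (\<psi> x)" for J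
    proof (intro AE_I2)
      fix x
      have "(\<Sum>j. K (j + J)) \<le> (\<Sum>j. K j)"
        using suminf_split_initial_segment[OF summable_K, of J] sum_nonneg[of "{..<J}" K] K_nonneg
        by simp
      then have "\<bar>\<Sum>j<J. partials bs (U j) x\<bar> \<le> 2 * (\<Sum>j. K j)"
        using D_tail[OF assms(1,2), where J = J and x = x] D_tail[OF assms(1,2), where J = 0 and x = x] by simp
      then show "norm ((\<Sum>j<J. partials bs (U j) x) *\<^sub>R \<psi> x) \<le> 2 * (\<Sum>j. K j) * norm (\<psi> x)"
        by (simp add: mult_right_mono)
    qed
  qed (use \<psi> in auto)
  moreover have "(LINT x|OmegaM. (\<Sum>j<J. partials bs (U j) x) *\<^sub>R \<psi> x) =
      (\<Sum>j<J. LINT x|OmegaM. partials bs (U j) x *\<^sub>R \<psi> x)" for J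
  proof -
    have "integrable OmegaM (\<lambda>x. partials bs (U j) x *\<^sub>R \<psi> x)" for j
    proof (rule Bochner_Integration.integrable_bound)
      show "integrable OmegaM (\<lambda>x. K j *\<^sub>R \<psi> x)" using \<psi> by simp
      show "(\<lambda>x. partials bs (U j) x *\<^sub>R \<psi> x) \<in> borel_measurable OmegaM"
        using \<psi> by (intro borel_measurable_scaleR smooth_measurable_OmegaM
          smooth_partials smooth_stripD strip assms) auto
      show "AE x in OmegaM. norm (partials bs (U j) x *\<^sub>R \<psi> x) \<le> norm (K j *\<^sub>R \<psi> x)"
        using bound[OF assms(1,2)] K_nonneg by (auto intro!: mult_right_mono)
    qed
    then show ?thesis by (simp add: scaleR_sum_left)
  qed
  ultimately show ?thesis by (simp add: sums_def)
qed

lemma has_weak_deriv_D: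
  assumes "set as \<subseteq> Basis" "set bs \<subseteq> Basis" "length as + length bs \<le> m"
  shows "has_weak_deriv bs (D as) (D (rev bs @ as))"
  unfolding has_weak_deriv_def
proof (intro conjI ballI)
  show "D (rev bs @ as) \<in> L2" using assms by (intro D_L2) auto
  fix \<phi> :: "'n pt \<Rightarrow> real" assume \<phi>: "\<phi> \<in> test_functions"
  have i: "integrable OmegaM \<phi>" "integrable OmegaM (partials bs \<phi>)"
    using \<phi> assms(2) by (auto intro!: L2_integrable smooth_L2 smooth_partials dest: test_functions_smooth)
  have "(\<lambda>j. LINT x|OmegaM. partials as (U j) x * partials bs \<phi> x) sums
      (LINT x|OmegaM. D as x * partials bs \<phi> x)"
    using LINT_D[OF _ _ i(2), of as] assms by simp
  moreover have "(LINT x|OmegaM. partials as (U j) x * partials bs \<phi> x) =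
      (-1) ^ length bs * (LINT x|OmegaM. partials (rev bs @ as) (U j) x * \<phi> x)" for j
    using has_weak_deriv_smooth[OF smooth_strip_partials[OF strip assms(1)] assms(2), of j] \<phi>
    by (simp add: has_weak_deriv_def partials_append)
  ultimately have "(\<lambda>j. (-1) ^ length bs * (LINT x|OmegaM. partials (rev bs @ as) (U j) x * \<phi> x)) sums
      (LINT x|OmegaM. D as x * partials bs \<phi> x)" by simp
  moreover have "(\<lambda>j. (-1) ^ length bs * (LINT x|OmegaM. partials (rev bs @ as) (U j) x * \<phi> x)) sums
      ((-1) ^ length bs * (LINT x|OmegaM. D (rev bs @ as) x * \<phi> x))"
    using LINT_D[OF _ _ i(1), of "rev bs @ as"] assms by (intro sums_mult) simp
  ultimately show "(LINT x|OmegaM. D as x * partials bs \<phi> x) =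
      (-1) ^ length bs * (LINT x|OmegaM. D (rev bs @ as) x * \<phi> x)"
    by (rule sums_unique2)
qed

lemma D_sobolev: "D [] \<in> sobolev m"
  unfolding sobolev_def using has_weak_deriv_D[of "[]"] D_L2[of "[]"] by fastforce

text \<open>The partial sums of the differentiated series are smooth, vanish exactly on the boundary
  and converge in H^1. That convergence costs one more derivative, whence
  \<open>length as < m\<close>. Equality with the series holds only almost everywhere, because
  \<open>vert_deriv\<close> is a chosen representative.\<close>

lemma has_trace_D:
  assumes as: "set as \<subseteq> Basis" "length as < m"
    and zero: "\<And>j y. partials as (U j) (y, 1) = 0" "\<And>j y. partials as (U j) (y, -1) = 0"
    and g: "AE x in OmegaM. g x = D as x" "g \<in> L2"
  shows "has_trace g (\<lambda>_. 0)"
proof -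
  define \<phi> where "\<phi> J x = (\<Sum>j<J. partials as (U j) x)" for J x
  define T where "T J = (\<Sum>j. K (j + J))" for J
  have T: "T \<longlonglongrightarrow> 0"
    unfolding T_def[abs_def] by (rule suminf_exist_split2[OF summable_K])
  have T0: "0 \<le> T J" for J
    unfolding T_def by (intro suminf_nonneg summable_ignore_initial_segment summable_K K_nonneg)
  have ps: "partials bs (\<lambda>x. \<Sum>j<J. u j x) x = (\<Sum>j<J. partials bs (u j) x)"
    if "\<And>j. smooth (u j)" "set bs \<subseteq> Basis" for bs J x and u :: "nat \<Rightarrow> 'n pt \<Rightarrow> real"
    using that(2)
  proof (induction bs arbitrary: x)
    case (Cons b bs)
    have "partials bs (\<lambda>x. \<Sum>j<J. u j x) = (\<lambda>x. \<Sum>j<J. partials bs (u j) x)"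
      using Cons by (intro ext) auto
    then have "partials (b # bs) (\<lambda>x. \<Sum>j<J. u j x) x = frechet_derivative (\<lambda>x. \<Sum>j<J. partials bs (u j) x) (at x) b"
      by simp
    also have "\<dots> = (\<Sum>j<J. partials (b # bs) (u j) x)"
      unfolding partials.simps
      using Cons.prems that(1) by (intro frechet_derivative_eq has_derivative_sum smooth_has_derivative smooth_partials) auto
    finally show ?case .
  qed simp
  have \<phi>s: "\<phi> J \<in> smooth_strip" for J
    unfolding \<phi>_def[abs_def] using smooth_strip_partials[OF strip as(1)]
    by (auto simp: smooth_strip_def horizontally_periodic_def intro: smooth_sum)
  have \<phi>L2: "\<phi> J \<in> L2" for J by (intro smooth_L2 smooth_stripD \<phi>s)
  define A where "A = {bs :: 'n pt list. set bs \<subseteq> Basis \<and> length bs \<le> 1}"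
  have A: "finite A" unfolding A_def by (rule finite_direction_lists)
  have wd: "has_weak_deriv bs (\<lambda>x. \<phi> J x - g x) (\<lambda>x. partials (rev bs) (\<phi> J) x - D (rev bs @ as) x)"
    if "bs \<in> A" for bs J
  proof (intro has_weak_deriv_diff has_weak_deriv_smooth \<phi>s \<phi>L2 g)
    show "has_weak_deriv bs g (D (rev bs @ as))"
      using that as g
      by (intro has_weak_deriv_AE_cong[OF has_weak_deriv_D[of as bs]] D_L2) (auto simp: A_def)
  qed (use that in \<open>auto simp: A_def\<close>)
  have nn: "(\<integral>\<^sup>+ x. ennreal ((weak_deriv bs (\<lambda>x. \<phi> J x - g x) x)\<^sup>2) \<partial>OmegaM) \<le> ennreal (2 * (T J)\<^sup>2)"
    if "bs \<in> A" for bs J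
  proof -
    have ae: "AE x in OmegaM. ennreal ((weak_deriv bs (\<lambda>x. \<phi> J x - g x) x)\<^sup>2) \<le> ennreal ((T J)\<^sup>2)"
      using weak_deriv_AE[OF wd[OF that, of J]]
    proof eventually_elim
        case (elim x)
        have "partials (rev bs) (\<phi> J) x = (\<Sum>j<J. partials (rev bs @ as) (U j) x)"
          unfolding \<phi>_def[abs_def] partials_append
          using that by (intro ps smooth_partials smooth_stripD strip as) (auto simp: A_def)
        then have "\<bar>weak_deriv bs (\<lambda>x. \<phi> J x - g x) x\<bar> \<le> \<bar>T J\<bar>"
          unfolding elim T_def using D_tail[of "rev bs @ as", where J = J and x = x] that as by (auto simp: A_def)
        then show ?case by (intro ennreal_leI) (simp add: abs_le_square_iff)
    qed
    show ?thesis
      using nn_integral_mono_AE[OF ae] nn_integral_OmegaM_const[of "(T J)\<^sup>2", where 'n = 'n] by simp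
  qed
  have sob: "(\<lambda>x. \<phi> J x - g x) \<in> sobolev 1" for J
    unfolding sobolev_def mem_Collect_eq
  proof (intro conjI allI impI)
    show "(\<lambda>x. \<phi> J x - g x) \<in> L2" by (rule L2_diff[OF \<phi>L2 g(2)])
    fix bs :: "'n pt list" assume "set bs \<subseteq> Basis \<and> length bs \<le> 1"
    then have "bs \<in> A" by (simp only: A_def mem_Collect_eq)
    then show "\<exists>h. has_weak_deriv bs (\<lambda>x. \<phi> J x - g x) h" using wd by blast
  qed
  have le: "Hnorm 1 (\<lambda>x. \<phi> J x - g x) \<le> ennreal (sqrt (real (card A) * (2 * (T J)\<^sup>2)))" for J
  proof -
    have "(\<Sum>bs\<in>A. \<integral>\<^sup>+ x. ennreal ((weak_deriv bs (\<lambda>x. \<phi> J x - g x) x)\<^sup>2) \<partial>OmegaM) \<le>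
        (\<Sum>bs\<in>A. ennreal (2 * (T J)\<^sup>2))"
      by (intro sum_mono nn)
    also have "\<dots> = ennreal (real (card A) * (2 * (T J)\<^sup>2))"
      by (simp add: ennreal_mult ennreal_of_nat_eq_real_of_nat)
    finally have "esqrt (\<Sum>bs\<in>A. \<integral>\<^sup>+ x. ennreal ((weak_deriv bs (\<lambda>x. \<phi> J x - g x) x)\<^sup>2) \<partial>OmegaM)
        \<le> ennreal (sqrt (real (card A) * (2 * (T J)\<^sup>2)))"
      by (rule esqrt_le) auto
    then show ?thesis unfolding Hnorm_1_eq[OF sob] A_def .
  qed
  have "(\<lambda>J. Hnorm 1 (\<lambda>x. \<phi> J x - g x)) \<longlonglongrightarrow> 0"
  proof (rule tendsto_sandwich[where f = "\<lambda>_. 0", OF always_eventually always_eventually])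
    have "(\<lambda>J. ennreal (sqrt (real (card A) * (2 * (T J)\<^sup>2)))) \<longlonglongrightarrow> ennreal (sqrt (real (card A) * (2 * 0\<^sup>2)))"
      by (intro tendsto_intros T)
    then show "(\<lambda>J. ennreal (sqrt (real (card A) * (2 * (T J)\<^sup>2)))) \<longlonglongrightarrow> 0"
      by simp
  qed (use le in auto)
  moreover have "\<phi> J (y, b) = 0" if "b \<in> {-1, 1}" for J y b
    using that zero by (auto simp: \<phi>_def)
  ultimately show ?thesis
    unfolding has_trace_def using \<phi>s by (intro exI[of _ \<phi>]) auto
qed

end


section \<open>Fourier modes\<close>

text \<open>Each partial derivative multiplies the amplitude by a constant and advances one phase by
  pi/2, so the family is closed under differentiation. The vertical sine is encoded by the phase
  -pi/2.\<close>

definition wave :: "'n \<Rightarrow> nat \<Rightarrow> real \<Rightarrow> real \<Rightarrow> real \<Rightarrow> ('n::finite) pt \<Rightarrow> real" where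
  "wave i p c \<alpha> \<beta> x = c * cos (2 * pi * fst x $ i + \<alpha>) * cos (pi * real p * snd x + \<beta>)"

abbreviation mode :: "'n \<Rightarrow> nat \<Rightarrow> ('n::finite) pt \<Rightarrow> real" where
  "mode i p \<equiv> wave i p 1 0 (- (pi / 2))"

lemma mode_eq: "mode i p x = cos (2 * pi * fst x $ i) * sin (pi * real p * snd x)"
  by (simp add: wave_def cos_diff)

lemma smooth_wave: "smooth (wave i p c \<alpha> \<beta>)"
  unfolding wave_def[abs_def]
  by (intro smooth_mult smooth_cos smooth_add smooth_const smooth_fst_nth smooth_snd)

lemma wave_smooth_strip: "wave i p c \<alpha> \<beta> \<in> smooth_strip"
proof -
  have "cos (2 * pi * (y + axis j 1) $ i + \<alpha>) = cos (2 * pi * y $ i + \<alpha>)" for y :: "real^'a" and j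
  proof (cases "i = j")
    case True
    then have "2 * pi * (y + axis j 1) $ i + \<alpha> = (2 * pi * y $ i + \<alpha>) + 2 * pi"
      by (simp add: distrib_left)
    then show ?thesis by (simp only: cos_periodic)
  qed (simp add: axis_def)
  then show ?thesis
    using smooth_wave by (auto simp: smooth_strip_def horizontally_periodic_def wave_def)
qed

lemma cos_plus_half_pi: "cos (t + pi / 2) = - sin (t::real)"
  by (simp add: cos_add)

lemma has_derivative_wave:
  "(wave i p c \<alpha> \<beta> has_derivative (\<lambda>h. c * cos (2 * pi * fst x $ i + \<alpha>) *
    - (sin (pi * real p * snd x + \<beta>) * (pi * real p * snd h)) +
    c * - (sin (2 * pi * fst x $ i + \<alpha>) * (2 * pi * fst h $ i)) * cos (pi * real p * snd x + \<beta>))) (at x)"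
  unfolding wave_def[abs_def]
  by (auto intro!: derivative_eq_intros bounded_linear.has_derivative[OF bounded_linear_vec_nth] simp: algebra_simps)

lemma frechet_wave_vertical:
  "frechet_derivative (wave i p c \<alpha> \<beta>) (at x) (0, 1) = wave i p (pi * real p * c) \<alpha> (\<beta> + pi / 2) x"
  unfolding frechet_derivative_eq[OF has_derivative_wave]
  by (simp add: wave_def add.assoc[symmetric] cos_plus_half_pi)

lemma frechet_wave_horizontal:
  "frechet_derivative (wave i p c \<alpha> \<beta>) (at x) (axis j 1, 0) =
    wave i p (if i = j then 2 * pi * c else 0) (\<alpha> + pi / 2) \<beta> x"
  unfolding frechet_derivative_eq[OF has_derivative_wave]
  by (simp add: wave_def add.assoc[symmetric] cos_plus_half_pi axis_def)

lemma partials_wave: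
  assumes "set bs \<subseteq> Basis" "2 \<le> p"
  shows "\<exists>c' \<alpha>' \<beta>'. partials bs (wave i p c \<alpha> \<beta>) = wave i p c' \<alpha>' \<beta>' \<and> \<bar>c'\<bar> \<le> \<bar>c\<bar> * (pi * real p) ^ length bs"
  using assms(1)
proof (induction bs)
  case Nil
  then show ?case by (intro exI[of _ c] exI[of _ \<alpha>] exI[of _ \<beta>]) simp
next
  case (Cons b bs)
  then obtain c' \<alpha>' \<beta>' where IH: "partials bs (wave i p c \<alpha> \<beta>) = wave i p c' \<alpha>' \<beta>'"
    "\<bar>c'\<bar> \<le> \<bar>c\<bar> * (pi * real p) ^ length bs" by auto
  \<comment> \<open>For p at least 2 the vertical frequency dominates the horizontal one, so a power
    of pi p alone bounds all derivatives of a given order.\<close>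
  have p: "2 * pi \<le> pi * real p" using assms(2) by simp
  have le: "r * \<bar>c'\<bar> \<le> \<bar>c\<bar> * (pi * real p) ^ length (b # bs)" if "r \<le> pi * real p" "0 \<le> r" for r
    using mult_mono[OF that(1) IH(2)] that by (simp add: mult_ac)
  consider j where "b = (axis j 1, 0)" | "b = (0, 1)" using Basis_pt[of b] Cons.prems by auto
  then show ?case
  proof cases
    case 1
    have "\<bar>if i = j then 2 * pi * c' else 0\<bar> \<le> \<bar>c\<bar> * (pi * real p) ^ length (b # bs)"
      using le[of "2 * pi"] le[of 0] p by (auto simp: abs_mult)
    then show ?thesis
      unfolding partials.simps IH(1) 1 frechet_wave_horizontal by blast
  next
    case 2
    have "\<bar>pi * real p * c'\<bar> \<le> \<bar>c\<bar> * (pi * real p) ^ length (b # bs)"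
      using le[of "pi * real p"] by (simp add: abs_mult)
    then show ?thesis
      unfolding partials.simps IH(1) 2 frechet_wave_vertical by blast
  qed
qed

lemma partials_wave_bound:
  assumes "set bs \<subseteq> Basis" "2 \<le> p"
  shows "\<bar>partials bs (wave i p c \<alpha> \<beta>) x\<bar> \<le> \<bar>c\<bar> * (pi * real p) ^ length bs"
proof -
  obtain c' \<alpha>' \<beta>' where *: "partials bs (wave i p c \<alpha> \<beta>) = wave i p c' \<alpha>' \<beta>'"
    "\<bar>c'\<bar> \<le> \<bar>c\<bar> * (pi * real p) ^ length bs"
    using partials_wave[OF assms] by blast
  have "\<bar>wave i p c' \<alpha>' \<beta>' x\<bar> \<le> \<bar>c'\<bar> * 1 * 1"
    unfolding wave_def abs_mult by (intro mult_mono) auto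
  then show ?thesis using * by simp
qed

lemma partials_wave_vertical:
  "partials (replicate k (0, 1)) (wave i p c \<alpha> \<beta>) =
    wave i p ((pi * real p) ^ k * c) \<alpha> (\<beta> + real k * (pi / 2))"
proof (induction k)
  case (Suc k)
  have "partials (replicate (Suc k) (0, 1)) (wave i p c \<alpha> \<beta>) =
      wave i p (pi * real p * ((pi * real p) ^ k * c)) \<alpha> (\<beta> + real k * (pi / 2) + pi / 2)"
    by (intro ext) (simp only: replicate_Suc partials.simps Suc.IH frechet_wave_vertical)
  also have "\<dots> = wave i p ((pi * real p) ^ Suc k * c) \<alpha> (\<beta> + real (Suc k) * (pi / 2))"
    by (rule arg_cong2[where f = "\<lambda>c \<beta>. wave i p c \<alpha> \<beta>"]) (simp_all add: algebra_simps)
  finally show ?case .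
qed simp

text \<open>An even number of vertical derivatives turns the sine into plus or minus itself up to a
  factor, and it vanishes at z = 1 and z = -1 because p is an integer.\<close>

lemma partials_mode_boundary:
  assumes "even k" "\<bar>z\<bar> = 1"
  shows "partials (replicate k (0, 1)) (wave i p c 0 (- (pi / 2))) (y, z) = 0"
proof -
  obtain l where l: "k = 2 * l" using assms(1) by blast
  have s: "sin (pi * real p * z) = 0"
    using assms(2) by (auto simp: abs_if split: if_splits)
  have "pi * real p * z + (- (pi / 2) + real k * (pi / 2)) = (pi * real p * z + real l * pi) - pi / 2"
    by (simp add: l)
  then have "cos (pi * real p * z + (- (pi / 2) + real k * (pi / 2))) = sin (pi * real p * z + real l * pi)"
    by (simp only: cos_diff) simp
  also have "\<dots> = 0" by (simp add: sin_add s)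
  finally show ?thesis unfolding partials_wave_vertical wave_def by simp
qed

subsection \<open>Fourier coefficients of modes\<close>

lemma continuous_B_fun: "continuous_on A (\<lambda>x. B_fun n q x)"
  unfolding B_fun_def b_fun_def by (cases "even q") (auto intro!: continuous_intros)

lemma B_fun_integrable: "integrable OmegaM (\<lambda>x. cnj (B_fun n q x))"
  by (rule LINT_OmegaM) (intro continuous_on_cnj continuous_B_fun)

lemma integral_complex_of_real_HK:
  assumes "h integrable_on S"
  shows "((\<lambda>z. complex_of_real (h z)) has_integral of_real (integral S h)) S"
  using has_integral_linear[OF integrable_integral[OF assms] bounded_linear_of_real] by (simp add: o_def)

lemma LINT_strip_product:
  fixes g :: "real^'n::finite \<Rightarrow> complex" and h :: "real \<Rightarrow> real"
  assumes "continuous_on UNIV g" "continuous_on UNIV h"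
  shows "(LINT x|OmegaM. g (fst x) * of_real (h (snd x))) = integral (cbox 0 1) g * of_real (integral {-1..1} h)"
proof -
  have c: "continuous_on A (\<lambda>x. g (fst x) * of_real (h (snd x)))" for A
    by (intro continuous_intros continuous_on_compose2[OF assms(1)] continuous_on_compose2[OF assms(2)]) auto
  have inner: "integral (cbox (-1) 1) (\<lambda>z. g y * of_real (h z)) = g y * of_real (integral {-1..1} h)" for y
  proof -
    have "h integrable_on {-1..1}"
      by (intro integrable_continuous_real continuous_on_subset[OF assms(2)]) auto
    from has_integral_mult_right[OF integral_complex_of_real_HK[OF this], of "g y"] show ?thesis
      unfolding cbox_interval by (rule integral_unique)
  qed
  have "(LINT x|OmegaM. g (fst x) * of_real (h (snd x))) =
      integral (cbox 0 1) (\<lambda>y. integral (cbox (-1) 1) (\<lambda>z. g y * of_real (h z)))"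
    by (subst LINT_OmegaM(2)[OF c], subst integral_prod_continuous[OF c]) simp
  then show ?thesis unfolding inner by simp
qed

text \<open>Both factors are Dirichlet eigenfunctions of the second derivative on [-1,1], with
  frequencies pi p and pi q / 2. The function F in the proof is their Wronskian: its derivative is
  the product times the difference of the squared frequencies, and it vanishes at both ends.\<close>

lemma integral_sin_b_fun_zero:
  assumes "q \<noteq> 2 * p" "q \<ge> 1" "p \<ge> 1"
  shows "integral {-1..1} (\<lambda>z. sin (pi * real p * z) * b_fun q z) = 0"
proof -
  let ?u = "\<lambda>z. sin (pi * real p * z)" and ?u' = "\<lambda>z. pi * real p * cos (pi * real p * z)"
  define w' where "w' z = (if even q then pi / 2 * q * cos (pi / 2 * real q * z) else - (pi / 2 * q * sin (pi / 2 * real q * z)))" for z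
  have w': "(b_fun q has_real_derivative w' z) (at z)" for z
    unfolding b_fun_def[abs_def] w'_def by (auto intro!: derivative_eq_intros)
  have w'': "(w' has_real_derivative - (pi / 2 * q)\<^sup>2 * b_fun q z) (at z)" for z
    unfolding b_fun_def w'_def[abs_def] by (auto intro!: derivative_eq_intros simp: power2_eq_square)
  have bz: "b_fun q z = 0" if "\<bar>z\<bar> = 1" for z
  proof (cases "even q")
    case True
    then obtain r where "q = 2 * r" by blast
    then show ?thesis using that True by (auto simp: b_fun_def abs_if split: if_splits)
  next
    case False
    then obtain r where r: "q = 2 * r + 1" by (rule oddE)
    have "cos (pi / 2 * real q) = cos (real r * pi + pi / 2)" by (simp add: r algebra_simps add_divide_distrib)
    also have "\<dots> = 0" by (simp add: cos_add)
    finally show ?thesis using that False by (auto simp: b_fun_def abs_if split: if_splits)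
  qed
  have uz: "?u z = 0" if "\<bar>z\<bar> = 1" for z
    using that by (auto simp: abs_if split: if_splits)
  define F where "F z = ?u' z * b_fun q z - ?u z * w' z" for z
  have "((\<lambda>z. ((pi / 2 * q)\<^sup>2 - (pi * real p)\<^sup>2) * (?u z * b_fun q z)) has_integral F 1 - F (-1)) {-1..1}"
  proof (rule fundamental_theorem_of_calculus)
    show "(F has_vector_derivative ((pi / 2 * q)\<^sup>2 - (pi * real p)\<^sup>2) * (?u z * b_fun q z)) (at z within {-1..1})" for z
      unfolding has_real_derivative_iff_has_vector_derivative[symmetric] F_def[abs_def]
      by (rule has_field_derivative_at_within)
        (auto intro!: derivative_eq_intros w' w'' simp: power2_eq_square algebra_simps)
  qed simp
  then have "((\<lambda>z. ((pi / 2 * q)\<^sup>2 - (pi * real p)\<^sup>2) * (?u z * b_fun q z)) has_integral 0) {-1..1}"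
    using bz[of 1] bz[of "-1"] uz[of 1] uz[of "-1"] by (simp add: F_def)
  from integral_unique[OF this]
  have "((pi / 2 * q)\<^sup>2 - (pi * real p)\<^sup>2) * integral {-1..1} (\<lambda>z. ?u z * b_fun q z) = 0"
    by (simp only: Henstock_Kurzweil_Integration.integral_mult_right)
  moreover have "(pi / 2 * q)\<^sup>2 \<noteq> (pi * real p)\<^sup>2"
  proof
    assume "(pi / 2 * q)\<^sup>2 = (pi * real p)\<^sup>2"
    then have "pi / 2 * q = pi * real p" by (simp add: power2_eq_iff_nonneg)
    then have "real q = real (2 * p)" by simp
    then show False using assms(1) by (simp only: of_nat_eq_iff)
  qed
  ultimately show ?thesis by (simp only: mult_eq_0_iff right_minus_eq) blast
qed

lemma mode_B_fun_split:
  "of_real (mode i p x) * cnj (B_fun n q x) =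
    (of_real (cos (2 * pi * fst x $ i)) * exp (- 2 * of_real pi * \<i> * of_real (\<Sum>k\<in>UNIV. real_of_int (n $ k) * fst x $ k)))
      * of_real (sin (pi * real p * snd x) * b_fun q (snd x))"
  by (simp add: mode_eq B_fun_def exp_cnj mult_ac)

lemma Fb_mode_split:
  "Fb (mode i p) n q =
    integral (cbox 0 1) (\<lambda>y. of_real (cos (2 * pi * y $ i)) * exp (- 2 * of_real pi * \<i> * of_real (\<Sum>k\<in>UNIV. real_of_int (n $ k) * y $ k)))
      * of_real (integral {-1..1} (\<lambda>z. sin (pi * real p * z) * b_fun q z))"
  unfolding Fb_def mode_B_fun_split
  by (rule LINT_strip_product[where g = "\<lambda>y. of_real (cos (2 * pi * y $ i)) * exp (- 2 * of_real pi * \<i> * of_real (\<Sum>k\<in>UNIV. real_of_int (n $ k) * y $ k))"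
        and h = "\<lambda>z. sin (pi * real p * z) * b_fun q z"]) (cases "even q"; auto simp: b_fun_def intro!: continuous_intros)+

text \<open>The cosine is half the sum of the exponentials with frequencies e_i and -e_i. After
  multiplication by the conjugate exponential the frequencies e_i - n and -e_i - n remain, and both
  are nonzero.\<close>

lemma integral_cos_exp_zero:
  fixes n :: "int^'n::finite"
  assumes "n \<noteq> axis i 1" "n \<noteq> - axis i 1"
  shows "integral (cbox 0 1) (\<lambda>y. of_real (cos (2 * pi * y $ i)) *
    exp (- 2 * of_real pi * \<i> * of_real (\<Sum>k\<in>UNIV. real_of_int (n $ k) * y $ k))) = (0::complex)"
proof -
  let ?E = "\<lambda>(k::int^'n) (y::real^'n). exp (2 * of_real pi * \<i> * of_real (\<Sum>j\<in>UNIV. real_of_int (k $ j) * y $ j)) :: complex"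
  have c: "?E k integrable_on cbox 0 1" for k
    by (intro integrable_continuous continuous_intros)
  have eq: "of_real (cos (2 * pi * y $ i)) *
      exp (- 2 * of_real pi * \<i> * of_real (\<Sum>k\<in>UNIV. real_of_int (n $ k) * y $ k)) =
      (?E (axis i 1 - n) y + ?E (- axis i 1 - n) y) / 2" for y
  proof -
    have s: "(\<Sum>j\<in>UNIV. real_of_int ((axis i 1 :: int^'n) $ j) * y $ j) = y $ i"
      by (simp add: axis_def if_distrib[of real_of_int] if_distrib[of "\<lambda>c. c * _"] cong: if_cong)
    have m: "(\<Sum>j\<in>UNIV. real_of_int ((axis i 1 - n) $ j) * y $ j) = y $ i - (\<Sum>j\<in>UNIV. real_of_int (n $ j) * y $ j)"
      "(\<Sum>j\<in>UNIV. real_of_int ((- axis i 1 - n) $ j) * y $ j) = - (y $ i) - (\<Sum>j\<in>UNIV. real_of_int (n $ j) * y $ j)"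
      by (simp_all only: vector_minus_component vector_uminus_component of_int_diff of_int_minus
          left_diff_distrib mult_minus_left sum_subtractf sum_negf s)
    have c: "complex_of_real (cos (2 * pi * y $ i)) = (exp (2 * of_real pi * \<i> * of_real (y $ i)) + exp (2 * of_real pi * \<i> * of_real (- (y $ i)))) / 2"
      by (simp add: cos_of_real[symmetric] cos_exp_eq mult_ac)
    have e: "exp (- 2 * of_real pi * \<i> * z) = inverse (exp (2 * of_real pi * \<i> * z))" for z
      using exp_minus[of "2 * of_real pi * \<i> * z"] by simp
    have a: "(u + v) / 2 * inverse w = (u / w + v / w) / 2" for u v w :: complex
      by (simp only: divide_inverse distrib_right) (simp only: mult_ac)
    show ?thesis
      unfolding m of_real_diff right_diff_distrib exp_diff c e by (rule a)
  qed
  have "integral (cbox 0 1) (\<lambda>y. (?E (axis i 1 - n) y + ?E (- axis i 1 - n) y) / 2) =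
     (integral (cbox 0 1) (?E (axis i 1 - n)) + integral (cbox 0 1) (?E (- axis i 1 - n))) / 2"
    by (simp only: Henstock_Kurzweil_Integration.integral_divide Henstock_Kurzweil_Integration.integral_add[OF c c])
  also have "\<dots> = 0"
  proof -
    have k: "axis i 1 - n \<noteq> 0" "- axis i 1 - n \<noteq> 0" using assms by auto
    show ?thesis unfolding integral_exp_periodic[OF k(1)] integral_exp_periodic[OF k(2)] by simp
  qed
  finally show ?thesis unfolding eq .
qed

lemma Fb_mode_zero:
  assumes "p \<ge> 1" "q \<ge> 1" "q \<noteq> 2 * p \<or> (n \<noteq> axis i 1 \<and> n \<noteq> - axis i 1)"
  shows "Fb (mode i p) n q = 0"
  using assms integral_sin_b_fun_zero[of q p] integral_cos_exp_zero[of n i]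
  unfolding Fb_mode_split by auto

lemma Fb_integrand_measurable:
  assumes "f \<in> L2"
  shows "(\<lambda>x. complex_of_real (f x) * cnj (B_fun n q x)) \<in> borel_measurable OmegaM"
proof (rule borel_measurable_times)
  show "(\<lambda>x. complex_of_real (f x)) \<in> borel_measurable OmegaM"
    using L2D(1)[OF assms] by measurable
  show "(\<lambda>x. cnj (B_fun n q x)) \<in> borel_measurable OmegaM"
    by (rule borel_measurable_integrable[OF B_fun_integrable])
qed

text \<open>Translates between the complex coefficients, which obey the differential equation, and
  the real pairings with a mode, to which integration by parts applies.\<close>

lemma Re_Fb:
  assumes "f \<in> L2"
  shows "Re (Fb f (axis i 1) (2 * p)) = (LINT x|OmegaM. f x * mode i p x)"
proof -
  have s: "(\<Sum>j\<in>UNIV. real_of_int ((axis i 1 :: int^'a) $ j) * y $ j) = y $ i" for y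
    by (simp add: axis_def if_distrib[of real_of_int] if_distrib[of "\<lambda>c. c * _"] cong: if_cong)
  have B: "B_fun (axis i 1) (2 * p) x = of_real (mode i p x) + \<i> * of_real (sin (2 * pi * fst x $ i) * sin (pi * real p * snd x))" for x
  proof -
    have "exp (2 * of_real pi * \<i> * of_real (fst x $ i)) = cis (2 * pi * fst x $ i)"
      by (simp add: cis_conv_exp mult_ac)
    then show ?thesis
      by (simp add: B_fun_def s mode_eq b_fun_def complex_eq_iff)
  qed
  have "integrable OmegaM (\<lambda>x. complex_of_real (f x) * cnj (B_fun (axis i 1) (2 * p) x))"
  proof (rule Bochner_Integration.integrable_bound[OF L2_integrable[OF assms] Fb_integrand_measurable[OF assms]])
    have "norm (B_fun (axis i 1) (2 * p) x) \<le> 1" for x :: "'a pt"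
      by (simp add: B_fun_def norm_mult b_fun_def)
    then show "AE x in OmegaM. norm (complex_of_real (f x) * cnj (B_fun (axis i 1) (2 * p) x)) \<le> norm (f x)"
      by (auto simp: norm_mult intro!: mult_left_le)
  qed
  then have "Re (Fb f (axis i 1) (2 * p)) = (LINT x|OmegaM. Re (complex_of_real (f x) * cnj (B_fun (axis i 1) (2 * p) x)))"
    unfolding Fb_def by (rule integral_Re[symmetric])
  then show ?thesis by (simp add: B)
qed

lemma LINT_mode_square:
  assumes "p \<ge> 1"
  shows "(LINT x|OmegaM. mode i p x * mode i p x) = 1 / 2"
proof -
  have y: "integral (cbox 0 1) (\<lambda>y :: real^'a. (cos (2 * pi * y $ i))\<^sup>2) = 1 / 2"
  proof -
    let ?c = "\<lambda>y :: real^'a. (cos (2 * pi * y $ i))\<^sup>2" and ?s = "\<lambda>y :: real^'a. (sin (2 * pi * y $ i))\<^sup>2"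
    have i: "?c integrable_on cbox 0 1" "?s integrable_on cbox 0 1"
      by (auto intro!: integrable_continuous continuous_intros)
    \<comment> \<open>A quarter-period shift turns the squared cosine into the squared sine. The two
      add up to 1 on a cell of measure 1, so each has integral 1/2.\<close>
    have "integral (cbox 0 1) (\<lambda>y. ?c (y + (1/4) *\<^sub>R axis i 1)) = integral (cbox 0 1) ?c"
    proof (rule integral_periodic_shift)
      show "?c (y + ((1 :: real^'a) \<bullet> axis i 1 - (0 :: real^'a) \<bullet> axis i 1) *\<^sub>R axis i 1) = ?c y" for y
        by (simp add: inner_axis inner_real_def distrib_left)
    qed (auto intro!: continuous_intros simp: inner_axis)
    moreover have "?c (y + (1/4) *\<^sub>R axis i 1) = ?s y" for y
      by (simp add: distrib_left cos_add)
    ultimately have "integral (cbox 0 1) ?c = integral (cbox 0 1) ?s" by simp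
    moreover have "integral (cbox 0 1) ?c + integral (cbox 0 1) ?s = integral (cbox 0 (1::real^'a)) (\<lambda>y. 1)"
      by (subst Henstock_Kurzweil_Integration.integral_add[OF i, symmetric]) simp
    moreover have "\<dots> = 1"
      by (simp add: measure_cbox_01)
    ultimately show ?thesis by simp
  qed
  have z: "integral {-1..1} (\<lambda>z. (sin (pi * real p * z))\<^sup>2) = 1"
  proof -
    define w where "w = 2 * (pi * real p)"
    have w: "w \<noteq> 0" "sin w = 0"
      using assms sin_npi[of "2 * p"] by (simp_all add: w_def mult_ac)
    define F where "F z = z / 2 - 1 / (2 * w) * sin (w * z)" for z
    have "((\<lambda>z. (sin (pi * real p * z))\<^sup>2) has_integral F 1 - F (-1)) {-1..1}"
    proof (rule fundamental_theorem_of_calculus)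
      fix z :: real
      have "(F has_real_derivative 1 / 2 - 1 / (2 * w) * (cos (w * z) * w)) (at z within {-1..1})"
        unfolding F_def[abs_def] by (auto intro!: derivative_eq_intros)
      moreover have "1 / 2 - 1 / (2 * w) * (cos (w * z) * w) = (sin (pi * real p * z))\<^sup>2"
      proof -
        have "w * z = 2 * (pi * real p * z)" by (simp add: w_def)
        then have "cos (w * z) = 1 - 2 * (sin (pi * real p * z))\<^sup>2"
          by (simp only: cos_double_sin)
        then show ?thesis using w by (simp add: field_simps)
      qed
      ultimately show "(F has_vector_derivative (sin (pi * real p * z))\<^sup>2) (at z within {-1..1})"
        by (simp only: has_real_derivative_iff_has_vector_derivative)
    qed simp
    then show ?thesis using w(2) by (simp add: integral_unique F_def)
  qed
  have yc: "integral (cbox 0 1) (\<lambda>y :: real^'a. complex_of_real ((cos (2 * pi * y $ i))\<^sup>2)) = of_real (integral (cbox 0 1) (\<lambda>y :: real^'a. (cos (2 * pi * y $ i))\<^sup>2))"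
    by (rule integral_unique[OF integral_complex_of_real_HK]) (intro integrable_continuous continuous_intros)
  have sp: "complex_of_real (mode i p x * mode i p x) =
      complex_of_real ((cos (2 * pi * fst x $ i))\<^sup>2) * of_real ((sin (pi * real p * snd x))\<^sup>2)" for x
    by (simp add: mode_eq power2_eq_square mult_ac)
  have "(LINT x|OmegaM. complex_of_real (mode i p x * mode i p x)) = of_real (1 / 2) * of_real 1"
    unfolding sp
    by (subst LINT_strip_product[where g = "\<lambda>y :: real^'a. complex_of_real ((cos (2 * pi * y $ i))\<^sup>2)"
          and h = "\<lambda>z. (sin (pi * real p * z))\<^sup>2"]) (intro continuous_intros | simp only: yc y z)+
  then show ?thesis
    unfolding integral_complex_of_real of_real_mult[symmetric] of_real_eq_iff by simp
qed


section \<open>Integration by parts for functions with vanishing trace\<close>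

lemma le_esqrt_square: "a \<le> (esqrt a)\<^sup>2"
proof (cases "a = \<infinity>")
  case False
  then have "a = ennreal (enn2real a)" by (simp add: less_top)
  also have "\<dots> = (ennreal (sqrt (enn2real a)))\<^sup>2"
    by (simp add: ennreal_power)
  finally show ?thesis using False by (simp add: esqrt_def)
qed (simp add: esqrt_def power2_eq_square ennreal_mult_eq_top_iff)

lemma esqrt_mono: "a \<le> b \<Longrightarrow> esqrt a \<le> esqrt b"
  unfolding esqrt_def
  by (auto simp: top_unique less_top intro!: ennreal_leI enn2real_mono real_sqrt_le_mono)

text \<open>By uniqueness any representative \<open>w\<close> may stand on the left. Outside the
  Sobolev space the norm is infinite and the bound is trivial.\<close>

lemma Hnorm_ge_weak_deriv:
  assumes "has_weak_deriv bs f w" "set bs \<subseteq> Basis" "length bs \<le> nat \<lfloor>s\<rfloor>"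
  shows "(\<integral>\<^sup>+ x. ennreal ((w x)\<^sup>2) \<partial>OmegaM) \<le> (Hnorm s f)\<^sup>2"
proof (cases "f \<in> sobolev (nat \<lfloor>s\<rfloor>)")
  case True
  let ?A = "{bs :: 'a pt list. set bs \<subseteq> Basis \<and> length bs \<le> nat \<lfloor>s\<rfloor>}"
  let ?S = "\<Sum>bs\<in>?A. \<integral>\<^sup>+ x. ennreal ((weak_deriv bs f x)\<^sup>2) \<partial>OmegaM"
  have "(\<integral>\<^sup>+ x. ennreal ((w x)\<^sup>2) \<partial>OmegaM) = (\<integral>\<^sup>+ x. ennreal ((weak_deriv bs f x)\<^sup>2) \<partial>OmegaM)"
    using weak_deriv_AE[OF assms(1)] by (intro nn_integral_cong_AE) (auto elim!: eventually_mono)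
  also have "\<dots> \<le> ?S"
    using assms(2,3) by (intro member_le_sum finite_direction_lists) auto
  finally have 1: "(\<integral>\<^sup>+ x. ennreal ((w x)\<^sup>2) \<partial>OmegaM) \<le> ?S" .
  have "esqrt ?S \<le> Hnorm s f"
    unfolding Hnorm_def Let_def if_P[OF True] by (intro esqrt_mono) simp
  then have "?S \<le> (Hnorm s f)\<^sup>2"
    using le_esqrt_square[of ?S] by (meson order_trans power_mono zero_le)
  with 1 show ?thesis by (rule order_trans)
next
  case False
  then have "Hnorm s f = \<infinity>" unfolding Hnorm_def Let_def by simp
  then show ?thesis by (simp add: power2_eq_square ennreal_mult_eq_top_iff)
qed

lemma nn_integral_square_L2:
  assumes "f \<in> L2"
  shows "(\<integral>\<^sup>+ x. ennreal ((f x)\<^sup>2) \<partial>OmegaM) = ennreal (LINT x|OmegaM. (f x)\<^sup>2)"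
  by (rule nn_integral_eq_integral[OF L2D(2)[OF assms]]) simp

text \<open>Cauchy-Schwarz, with the squared norm controlled in the extended reals: the bound
  \<open>a\<close> will be the H^1 norm of the error of a smooth approximation.\<close>

lemma LINT_tendsto_0_of_L2:
  fixes w :: "nat \<Rightarrow> ('n::finite) pt \<Rightarrow> real"
  assumes w: "\<And>j. w j \<in> L2" and T: "T \<in> L2" and a: "a \<longlonglongrightarrow> 0"
    and le: "\<And>j. (\<integral>\<^sup>+ x. ennreal ((w j x)\<^sup>2) \<partial>OmegaM) \<le> (a j)\<^sup>2"
  shows "(\<lambda>j. LINT x|OmegaM. w j x * T x) \<longlonglongrightarrow> 0"
proof -
  let ?I = "\<lambda>j. LINT x|OmegaM. (w j x)\<^sup>2" and ?K = "LINT x|OmegaM. (T x)\<^sup>2"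
  have a2: "(\<lambda>j. (a j)\<^sup>2) \<longlonglongrightarrow> 0"
    using tendsto_mult_ennreal[OF a a] by (simp add: power2_eq_square)
  have "(\<lambda>j. ennreal (?I j)) \<longlonglongrightarrow> ennreal 0"
    unfolding nn_integral_square_L2[OF w, symmetric]
    by (rule tendsto_sandwich[where f = "\<lambda>_. 0" and h = "\<lambda>j. (a j)\<^sup>2"]) (use le a2 in auto)
  then have "?I \<longlonglongrightarrow> 0"
    by (subst (asm) tendsto_ennreal_iff) auto
  then have "(\<lambda>j. sqrt (?I j * ?K)) \<longlonglongrightarrow> sqrt (0 * ?K)"
    by (intro tendsto_intros)
  then have lim: "(\<lambda>j. sqrt (?I j * ?K)) \<longlonglongrightarrow> 0" by simp
  show ?thesis
  proof (rule Lim_null_comparison[OF _ lim])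
    have "\<bar>LINT x|OmegaM. w j x * T x\<bar> \<le> sqrt (?I j * ?K)" for j
      using real_sqrt_le_mono[OF L2_Cauchy_Schwarz[OF w T]] by simp
    then show "\<forall>\<^sub>F j in sequentially. norm (LINT x|OmegaM. w j x * T x) \<le> sqrt (?I j * ?K)"
      by simp
  qed
qed

lemma LINT_cellM_tendsto_0:
  fixes u :: "nat \<Rightarrow> real^'n::finite \<Rightarrow> real"
  assumes u: "\<And>j. continuous_on UNIV (u j)" and c: "continuous_on UNIV c" "\<And>y. \<bar>c y\<bar> \<le> K"
    and lim: "(\<lambda>j. \<integral>\<^sup>+ y. ennreal ((u j y)\<^sup>2) \<partial>cellM) \<longlonglongrightarrow> 0"
  shows "(\<lambda>j. LINT y|cellM. u j y * c y) \<longlonglongrightarrow> 0"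
proof -
  have int: "integrable cellM f" if "continuous_on UNIV f" for f :: "real^'n \<Rightarrow> real"
    by (rule LINT_cellM) (rule continuous_on_subset[OF that], simp)
  have K: "0 \<le> K" using c(2)[of 0] by simp
  let ?I = "\<lambda>j. LINT y|cellM. (u j y)\<^sup>2"
  have i2: "integrable cellM (\<lambda>y. (u j y)\<^sup>2)" for j by (intro int continuous_intros u)
  have "(\<lambda>j. ennreal (?I j)) \<longlonglongrightarrow> ennreal 0"
    using lim by (simp add: nn_integral_eq_integral[OF i2])
  then have I: "?I \<longlonglongrightarrow> 0"
    by (subst (asm) tendsto_ennreal_iff) auto
  have m1: "measure cellM (space (cellM :: (real^'n) measure)) \<le> 1"
  proof -
    have "measure cellM (space (cellM :: (real^'n) measure)) = (LINT y|(cellM :: (real^'n) measure). 1)" by simp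
    also have "\<dots> = integral (cbox 0 (1 :: real^'n)) (\<lambda>y. 1::real)"
      by (rule LINT_cellM) auto
    also have "\<dots> = 1"
      by (simp add: measure_cbox_01)
    finally show ?thesis by simp
  qed
  have le: "(LINT y|cellM. u j y * c y)\<^sup>2 \<le> K\<^sup>2 * ?I j" for j
  proof -
    \<comment> \<open>Jensen's inequality, obtained from the nonnegativity of a squared deviation
      and the fact that the cell has measure at most 1.\<close>
    have "(LINT y|cellM. u j y * c y)\<^sup>2 \<le> (LINT y|cellM. (u j y * c y)\<^sup>2)"
    proof -
      let ?b = "LINT y|cellM. u j y * c y"
      have iu: "integrable cellM (\<lambda>y. u j y * c y)" "integrable cellM (\<lambda>y. (u j y * c y)\<^sup>2)"
        by (intro int continuous_intros u c)+
      have "0 \<le> (LINT y|cellM. (u j y * c y - ?b)\<^sup>2)" by simp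
      also have "\<dots> = (LINT y|cellM. (u j y * c y)\<^sup>2 - (2 * ?b) * (u j y * c y) + ?b\<^sup>2)"
        by (simp add: power2_diff algebra_simps)
      also have "\<dots> = (LINT y|cellM. (u j y * c y)\<^sup>2) - 2 * ?b * ?b + measure cellM (space (cellM :: (real^'n) measure)) * ?b\<^sup>2"
        using iu by simp
      also have "\<dots> \<le> (LINT y|cellM. (u j y * c y)\<^sup>2) - 2 * ?b * ?b + 1 * ?b\<^sup>2"
        by (intro add_left_mono mult_right_mono m1) auto
      finally show ?thesis by (simp add: power2_eq_square)
    qed
    also have "\<dots> \<le> (LINT y|cellM. K\<^sup>2 * (u j y)\<^sup>2)"
    proof (intro integral_mono int continuous_intros u c)
      fix y
      have "(c y)\<^sup>2 \<le> K\<^sup>2" using power_mono[OF c(2)[of y], of 2] by simp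
      then show "(u j y * c y)\<^sup>2 \<le> K\<^sup>2 * (u j y)\<^sup>2"
        by (simp add: power_mult_distrib mult.commute mult_right_mono)
    qed
    finally show ?thesis using i2 by simp
  qed
  have "(\<lambda>j. sqrt (K\<^sup>2 * ?I j)) \<longlonglongrightarrow> sqrt (K\<^sup>2 * 0)"
    by (intro tendsto_intros I)
  then have lim: "(\<lambda>j. sqrt (K\<^sup>2 * ?I j)) \<longlonglongrightarrow> 0" by simp
  show ?thesis
  proof (rule Lim_null_comparison[OF _ lim])
    have "\<bar>LINT y|cellM. u j y * c y\<bar> \<le> sqrt (K\<^sup>2 * ?I j)" for j
      using real_sqrt_le_mono[OF le[of j]] by simp
    then show "\<forall>\<^sub>F j in sequentially. norm (LINT y|cellM. u j y * c y) \<le> sqrt (K\<^sup>2 * ?I j)"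
      by simp
  qed
qed

text \<open>For the smooth approximants the formula holds with a boundary term on each face.
  Convergence in H^1 handles the two interior terms and the zero trace removes the boundary terms,
  so \<open>T\<close> itself may be nonzero on the boundary.\<close>

lemma LINT_by_parts_trace:
  assumes tr: "has_trace g (\<lambda>_. 0)" and g: "g \<in> L2" and h: "has_weak_deriv [(0, 1)] g h"
    and T: "T \<in> smooth_strip" "\<And>x. \<bar>T x\<bar> \<le> K"
  shows "(LINT x|OmegaM. g x * frechet_derivative T (at x) (0, 1)) = - (LINT x|OmegaM. h x * T x)"
proof -
  obtain \<phi> :: "nat \<Rightarrow> 'a pt \<Rightarrow> real" where \<phi>: "\<And>j. \<phi> j \<in> smooth_strip"
    and H: "(\<lambda>j. Hnorm 1 (\<lambda>x. \<phi> j x - g x)) \<longlonglongrightarrow> 0"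
    and b: "\<And>b. b \<in> {-1, 1} \<Longrightarrow> (\<lambda>j. \<integral>\<^sup>+ y. ennreal ((\<phi> j (y, b))\<^sup>2) \<partial>cellM) \<longlonglongrightarrow> 0"
    using tr unfolding has_trace_def by auto
  let ?e = "(0, 1) :: 'a pt"
  note e = vertical_in_Basis[where 'n = 'a]
  let ?d = "\<lambda>f x. frechet_derivative f (at x) ?e"
  have sT: "smooth T" "smooth (?d T)" and s\<phi>: "\<And>j. smooth (\<phi> j)" "\<And>j. smooth (?d (\<phi> j))"
    using T(1) \<phi> by (auto intro!: smooth_frechet e dest: smooth_stripD)
  have hL: "h \<in> L2" using h by (simp add: has_weak_deriv_def)
  have "(\<lambda>j. LINT x|OmegaM. (\<phi> j x - g x) * ?d T x) \<longlonglongrightarrow> 0"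
  proof (rule LINT_tendsto_0_of_L2[OF _ smooth_L2[OF sT(2)] H])
    show "(\<lambda>x. \<phi> j x - g x) \<in> L2" for j by (intro L2_diff g smooth_L2 s\<phi>)
    then show "(\<integral>\<^sup>+ x. ennreal ((\<phi> j x - g x)\<^sup>2) \<partial>OmegaM) \<le> (Hnorm 1 (\<lambda>x. \<phi> j x - g x))\<^sup>2" for j
      by (intro Hnorm_ge_weak_deriv[where bs = "[]"] has_weak_deriv_Nil) auto
  qed
  moreover have "(\<lambda>j. LINT x|OmegaM. (?d (\<phi> j) x - h x) * T x) \<longlonglongrightarrow> 0"
  proof (rule LINT_tendsto_0_of_L2[OF _ smooth_L2[OF sT(1)] H])
    show "(\<lambda>x. ?d (\<phi> j) x - h x) \<in> L2" for j by (intro L2_diff hL smooth_L2 s\<phi>)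
    have "has_weak_deriv [?e] (\<lambda>x. \<phi> j x - g x) (\<lambda>x. ?d (\<phi> j) x - h x)" for j
      using has_weak_deriv_smooth[OF \<phi>, of "[?e]"] e
      by (intro has_weak_deriv_diff h g smooth_L2 s\<phi>) auto
    then show "(\<integral>\<^sup>+ x. ennreal ((?d (\<phi> j) x - h x)\<^sup>2) \<partial>OmegaM) \<le> (Hnorm 1 (\<lambda>x. \<phi> j x - g x))\<^sup>2" for j
      by (rule Hnorm_ge_weak_deriv) (use e in auto)
  qed
  ultimately have "(\<lambda>j. (LINT x|OmegaM. (\<phi> j x - g x) * ?d T x) + (LINT x|OmegaM. (?d (\<phi> j) x - h x) * T x)) \<longlonglongrightarrow> 0 + 0"
    by (rule tendsto_add)
  \<comment> \<open>The sum that tends to 0 is rewritten as boundary terms minus a quantity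
    independent of j; comparing limits shows that this quantity is 0.\<close>
  moreover have "(LINT x|OmegaM. (\<phi> j x - g x) * ?d T x) + (LINT x|OmegaM. (?d (\<phi> j) x - h x) * T x) =
      ((LINT y|cellM. \<phi> j (y, 1) * T (y, 1)) - (LINT y|cellM. \<phi> j (y, -1) * T (y, -1)))
      - ((LINT x|OmegaM. g x * ?d T x) + (LINT x|OmegaM. h x * T x))" for j
  proof -
    note L = smooth_L2[OF sT(1)] smooth_L2[OF sT(2)] smooth_L2[OF s\<phi>(1)[of j]] smooth_L2[OF s\<phi>(2)[of j]]
    have c: "integrable cellM (\<lambda>y. \<phi> j (y, b) * T (y, b))" for b
      by (intro LINT_cellM continuous_intros continuous_on_compose2[OF smooth_continuous_on[OF s\<phi>(1), of UNIV]]
          continuous_on_compose2[OF smooth_continuous_on[OF sT(1), of UNIV]]) auto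
    have "(LINT x|OmegaM. \<phi> j x * ?d T x) + (LINT x|OmegaM. ?d (\<phi> j) x * T x) =
        (LINT x|OmegaM. ?d (\<lambda>x. \<phi> j x * T x) x)"
      unfolding frechet_derivative_mult[OF s\<phi>(1) sT(1)]
      by (simp add: L2_mult_integrable L)
    also have "\<dots> = (LINT y|cellM. \<phi> j (y, 1) * T (y, 1)) - (LINT y|cellM. \<phi> j (y, -1) * T (y, -1))"
      using LINT_vertical_derivative[OF smooth_mult[OF s\<phi>(1) sT(1)], of j] c by simp
    finally show ?thesis
      by (simp add: left_diff_distrib L2_mult_integrable L g hL)
  qed
  moreover have "(\<lambda>j. ((LINT y|cellM. \<phi> j (y, 1) * T (y, 1)) - (LINT y|cellM. \<phi> j (y, -1) * T (y, -1)))
      - ((LINT x|OmegaM. g x * ?d T x) + (LINT x|OmegaM. h x * T x))) \<longlonglongrightarrow>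
      (0 - 0) - ((LINT x|OmegaM. g x * ?d T x) + (LINT x|OmegaM. h x * T x))"
    by (intro tendsto_diff tendsto_const LINT_cellM_tendsto_0[where K = K] b T(2)
        continuous_on_compose2[OF smooth_continuous_on[OF s\<phi>(1), of UNIV]]
        continuous_on_compose2[OF smooth_continuous_on[OF sT(1), of UNIV]] continuous_intros) auto
  ultimately have "(0 - 0) - ((LINT x|OmegaM. g x * ?d T x) + (LINT x|OmegaM. h x * T x)) = 0 + 0"
    using LIMSEQ_unique by (simp only:) blast
  then show ?thesis by simp
qed


section \<open>Vertical cutoffs\<close>

text \<open>Subtracting 1 makes the cutoff vanish on a neighbourhood of |z| = 1 and not merely
  there, as test functions require.\<close>

definition vcut :: "nat \<Rightarrow> real \<Rightarrow> real" where
  "vcut n z = flat (real n * (1 - z * z) - 1)"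

lemma smooth_cut: "smooth (vcut n)"
  unfolding vcut_def[abs_def]
  by (intro smooth_compose_smooth[OF smooth_flat] smooth_diff smooth_mult smooth_const smooth_id)

lemma cut_bounds: "\<bar>vcut n z\<bar> \<le> 1"
  using flat_bounds by (simp add: vcut_def)

lemma one_minus_square_pos: "\<bar>z\<bar> < 1 \<Longrightarrow> 0 < 1 - z * z" for z :: real
  by (simp add: abs_square_less_1 flip: power2_eq_square)

lemma one_minus_square_nonneg: "\<bar>z\<bar> \<le> 1 \<Longrightarrow> 0 \<le> 1 - z * z" for z :: real
  by (simp add: abs_square_le_1 flip: power2_eq_square)

lemma cut_tendsto: "\<bar>z\<bar> < 1 \<Longrightarrow> (\<lambda>n. vcut n z) \<longlonglongrightarrow> 1"
  unfolding vcut_def by (rule flat_scaled_tendsto[OF one_minus_square_pos])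

lemma cut_zero:
  assumes z: "1 - 1 / (2 * (real n + 1)) \<le> \<bar>z\<bar>"
  shows "vcut n z = 0"
proof -
  have zz: "z * z = \<bar>z\<bar> * \<bar>z\<bar>" by simp
  have "real n * (1 - z * z) \<le> 1"
  proof (cases "\<bar>z\<bar> \<le> 1")
    case True
    have "1 - z * z = (1 - \<bar>z\<bar>) * (1 + \<bar>z\<bar>)"
      unfolding zz by (simp add: algebra_simps)
    also have "\<dots> \<le> (1 / (2 * (real n + 1))) * 2"
      using z True by (intro mult_mono) auto
    also have "\<dots> = 1 / (real n + 1)" by (simp add: field_simps)
    finally have "real n * (1 - z * z) \<le> real n * (1 / (real n + 1))"
      by (intro mult_left_mono) auto
    also have "\<dots> \<le> 1" by simp
    finally show ?thesis .
  next
    case False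
    then have "1 * 1 \<le> \<bar>z\<bar> * \<bar>z\<bar>" by (intro mult_mono) auto
    then have "1 - z * z \<le> 0" by simp
    then have "real n * (1 - z * z) \<le> 0" by (intro mult_nonneg_nonpos[OF of_nat_0_le_iff])
    then show ?thesis by simp
  qed
  then show ?thesis by (simp add: vcut_def flat_nonpos)
qed

definition dcut :: "nat \<Rightarrow> real \<Rightarrow> real" where
  "dcut n z = (let u = real n * (1 - z * z) - 1 in
    if u > 0 then flat u / u\<^sup>2 * (real n * (- 2 * z)) else 0)"

lemma cut_deriv: "(vcut n has_real_derivative dcut n z) (at z)"
proof -
  let ?u = "\<lambda>z. real n * (1 - z * z) - 1"
  have u: "(?u has_real_derivative real n * (- 2 * z)) (at z)"
    by (auto intro!: derivative_eq_intros)
  show ?thesis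
  proof (cases "?u z > 0")
    case True
    from DERIV_chain2[OF flat_deriv[OF True] u] show ?thesis
      unfolding vcut_def[abs_def] dcut_def Let_def if_P[OF True] .
  next
    case False
    then have "?u z \<le> 0" by simp
    from DERIV_chain2[OF flat_deriv_nonpos[OF this] u] show ?thesis
      unfolding vcut_def[abs_def] dcut_def Let_def if_not_P[OF False] by simp
  qed
qed

text \<open>With u = n (1 - z^2) - 1 > 0 and x = 1/u, the product is at most 2 (x + x^2) exp (-x),
  because n (1 - z^2) = u + 1. The inequality exp x >= 1 + x + x^2/2 bounds this by 4, and for fixed
  |z| < 1 the variable x tends to 0.\<close>

lemma dcut_bound:
  assumes z: "\<bar>z\<bar> \<le> 1"
  shows "\<bar>dcut n z\<bar> * (1 - z * z) \<le> 4"
    and "\<bar>z\<bar> < 1 \<Longrightarrow> (\<lambda>n. \<bar>dcut n z\<bar> * (1 - z * z)) \<longlonglongrightarrow> 0"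
proof -
  define u where "u n = real n * (1 - z * z) - 1" for n
  have main: "\<bar>dcut n z\<bar> * (1 - z * z) \<le> 2 * ((1 / u n + (1 / u n)\<^sup>2) * exp (- (1 / u n)))" if "u n > 0" for n
  proof -
    have d: "dcut n z = flat (u n) / (u n)\<^sup>2 * (real n * (- 2 * z))"
      using that by (simp add: dcut_def u_def Let_def)
    have "\<bar>dcut n z\<bar> * (1 - z * z) = flat (u n) / (u n)\<^sup>2 * (2 * \<bar>z\<bar>) * (real n * (1 - z * z))"
      unfolding d abs_mult using flat_bounds(1)[of "u n"] by (simp add: abs_mult mult_ac)
    also have "real n * (1 - z * z) = u n + 1" by (simp add: u_def)
    also have "flat (u n) / (u n)\<^sup>2 * (2 * \<bar>z\<bar>) * (u n + 1) \<le> flat (u n) / (u n)\<^sup>2 * (2 * 1) * (u n + 1)"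
      using z that flat_bounds(1)[of "u n"] by (intro mult_right_mono mult_left_mono) auto
    also have "\<dots> = 2 * ((1 / u n + (1 / u n)\<^sup>2) * exp (- (1 / u n)))"
      using that by (simp add: flat_def field_simps power2_eq_square)
    finally show ?thesis .
  qed
  have ex: "(x + x\<^sup>2) * exp (- x) \<le> 2" "(x + x\<^sup>2) * exp (- x) \<le> x + x\<^sup>2" if "x > 0" for x :: real
  proof -
    have "x + x\<^sup>2 \<le> 2 * exp x"
      using exp_lower_Taylor_quadratic[of x] that by simp
    then show "(x + x\<^sup>2) * exp (- x) \<le> 2"
      by (simp add: exp_minus field_simps)
    show "(x + x\<^sup>2) * exp (- x) \<le> x + x\<^sup>2"
      using that by (intro mult_left_le) auto
  qed
  show "\<bar>dcut n z\<bar> * (1 - z * z) \<le> 4"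
  proof (cases "u n > 0")
    case True
    then show ?thesis using main[OF True] ex(1)[of "1 / u n"] by simp
  qed (simp add: dcut_def u_def)
  assume z1: "\<bar>z\<bar> < 1"
  have ul: "filterlim u at_top sequentially"
  proof -
    have "filterlim (\<lambda>n. - 1 + (1 - z * z) * real n) at_top sequentially"
      by (intro filterlim_tendsto_add_at_top[OF tendsto_const]
          filterlim_tendsto_pos_mult_at_top[OF tendsto_const one_minus_square_pos[OF z1]] filterlim_real_sequentially)
    then show ?thesis by (simp add: u_def[abs_def] algebra_simps)
  qed
  have inv: "(\<lambda>n. 1 / u n) \<longlonglongrightarrow> 0"
    using tendsto_inverse_0_at_top[OF ul] by (simp add: divide_inverse)
  have "(\<lambda>n. 2 * (1 / u n + (1 / u n)\<^sup>2)) \<longlonglongrightarrow> 2 * (0 + 0\<^sup>2)"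
    by (intro tendsto_intros inv)
  then have lim: "(\<lambda>n. 2 * (1 / u n + (1 / u n)\<^sup>2)) \<longlonglongrightarrow> 0" by simp
  show "(\<lambda>n. \<bar>dcut n z\<bar> * (1 - z * z)) \<longlonglongrightarrow> 0"
  proof (rule Lim_null_comparison[OF _ lim])
    have "\<forall>\<^sub>F n in sequentially. u n > 0"
      using ul by (simp add: filterlim_at_top_dense)
    then show "\<forall>\<^sub>F n in sequentially. norm (\<bar>dcut n z\<bar> * (1 - z * z)) \<le> 2 * (1 / u n + (1 / u n)\<^sup>2)"
    proof eventually_elim
      case (elim n)
      show ?case
        using main[OF elim] ex(2)[of "1 / u n"] elim one_minus_square_nonneg[OF z] by (simp add: abs_mult)
    qed
  qed
qed

section \<open>Integration by parts with cutoffs\<close>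

lemma frechet_compose_snd:
  assumes "(W has_real_derivative D) (at (snd x))"
  shows "frechet_derivative (\<lambda>x :: ('n::finite) pt. W (snd x)) (at x) (0, 1) = D"
proof -
  have "(snd has_derivative snd) (at x)" by (rule bounded_linear_imp_has_derivative[OF bounded_linear_snd])
  from has_derivative_compose[OF this assms[unfolded has_field_derivative_def]]
  have "((\<lambda>x :: 'n pt. W (snd x)) has_derivative (\<lambda>h. D * snd h)) (at x)" .
  from frechet_derivative_eq[OF this, of "(0, 1)"] show ?thesis by simp
qed

lemma smooth_cut_snd: "smooth (\<lambda>x :: ('n::finite) pt. vcut n (snd x))"
  by (rule smooth_compose_smooth[OF smooth_cut smooth_snd])

lemma frechet_cut_snd:
  "frechet_derivative (\<lambda>x :: ('n::finite) pt. vcut n (snd x)) (at x) (0, 1) = dcut n (snd x)"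
  by (rule frechet_compose_snd[OF cut_deriv])

lemma cut_test:
  assumes "T \<in> smooth_strip"
  shows "(\<lambda>x. T x * vcut n (snd x)) \<in> test_functions"
proof -
  have "(\<lambda>x. vcut n (snd x)) \<in> smooth_strip"
    using smooth_cut_snd by (simp add: smooth_strip_def horizontally_periodic_def)
  from smooth_strip_mult[OF assms this]
  have "(\<lambda>x. T x * vcut n (snd x)) \<in> smooth_strip" .
  moreover have "T (y, z) * vcut n (snd (y, z)) = 0" if "1 - 1 / (2 * (real n + 1)) \<le> \<bar>z\<bar>" for y z
    using cut_zero[OF that] by simp
  moreover have "1 - 1 / (2 * (real n + 1)) < 1" by simp
  ultimately show ?thesis unfolding test_functions_def by blast
qed

lemma AE_OmegaM_snd: "AE x in (OmegaM :: ('n::finite) pt measure). \<bar>snd x\<bar> < 1"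
  using AE_OmegaM_box
proof eventually_elim
  case (elim x)
  then show ?case by (cases x) (auto simp: box_Pair_eq)
qed

lemma LINT_cut_tendsto:
  assumes g: "g \<in> L2" and T: "smooth T" "\<And>x. \<bar>T x\<bar> \<le> K"
  shows "(\<lambda>n. LINT x|OmegaM. g x * (T x * vcut n (snd x))) \<longlonglongrightarrow> (LINT x|OmegaM. g x * T x)"
proof (rule integral_dominated_convergence[where w = "\<lambda>x. K * \<bar>g x\<bar>"])
  note gm = L2D(1)[OF g]
  show "(\<lambda>x. g x * T x) \<in> borel_measurable OmegaM"
    by (rule borel_measurable_times[OF gm smooth_measurable_OmegaM[OF T(1)]])
  show "(\<lambda>x. g x * (T x * vcut n (snd x))) \<in> borel_measurable OmegaM" for n
    by (rule borel_measurable_times[OF gm smooth_measurable_OmegaM[OF smooth_mult[OF T(1) smooth_cut_snd]]])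
  show "integrable OmegaM (\<lambda>x. K * \<bar>g x\<bar>)" using L2_integrable[OF g] by simp
  show "AE x in OmegaM. (\<lambda>n. g x * (T x * vcut n (snd x))) \<longlonglongrightarrow> g x * T x"
    using AE_OmegaM_snd
  proof eventually_elim
    case (elim x)
    have "(\<lambda>n. g x * (T x * vcut n (snd x))) \<longlonglongrightarrow> g x * (T x * 1)"
      by (intro tendsto_mult tendsto_const cut_tendsto elim)
    then show ?case by simp
  qed
  show "AE x in OmegaM. norm (g x * (T x * vcut n (snd x))) \<le> K * \<bar>g x\<bar>" for n
  proof (rule AE_I2)
    fix x
    have "\<bar>T x\<bar> * \<bar>vcut n (snd x)\<bar> \<le> K * 1"
      using T(2) cut_bounds by (intro mult_mono) (auto intro: order_trans[OF abs_ge_zero])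
    then show "norm (g x * (T x * vcut n (snd x))) \<le> K * \<bar>g x\<bar>"
      using mult_right_mono[of "\<bar>T x\<bar> * \<bar>vcut n (snd x)\<bar>" K "\<bar>g x\<bar>"] by (simp add: abs_mult mult_ac)
  qed
qed

text \<open>Nothing is known about a trace of \<open>g\<close>; instead \<open>T\<close> vanishes on
  the boundary at least linearly. \<open>T\<close> times the cutoff is a test function, and the
  extra term with the derivative of the cutoff is dominated by 4 L |g| and tends to 0 almost
  everywhere.\<close>

lemma LINT_by_parts_cut:
  assumes g: "g \<in> L2" and h: "has_weak_deriv [(0, 1)] g h"
    and T: "T \<in> smooth_strip" "\<And>x. \<bar>T x\<bar> \<le> K" "\<And>x. \<bar>frechet_derivative T (at x) (0, 1)\<bar> \<le> K"
    and L: "\<And>y z. \<bar>z\<bar> \<le> 1 \<Longrightarrow> \<bar>T (y, z)\<bar> \<le> L * (1 - z * z)"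
  shows "(LINT x|OmegaM. g x * frechet_derivative T (at x) (0, 1)) = - (LINT x|OmegaM. h x * T x)"
proof -
  let ?dT = "\<lambda>x. frechet_derivative T (at x) (0, 1)"
  have sT: "smooth T" "smooth ?dT"
    using T(1) vertical_in_Basis by (auto intro!: smooth_frechet dest: smooth_stripD)
  have hL: "h \<in> L2" using h by (simp add: has_weak_deriv_def)
  have sdc: "smooth (\<lambda>x :: 'a pt. dcut n (snd x))" for n
    using smooth_frechet[OF smooth_cut_snd vertical_in_Basis, of n] by (simp add: frechet_cut_snd)
  have "(\<lambda>n. LINT x|OmegaM. g x * (T x * dcut n (snd x))) \<longlonglongrightarrow> (LINT x|(OmegaM :: 'a pt measure). 0)"
  proof (rule integral_dominated_convergence[where w = "\<lambda>x. (L * 4) * \<bar>g x\<bar>"])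
    have b: "\<bar>g x * (T x * dcut n (snd x))\<bar> \<le> (L * (\<bar>dcut n (snd x)\<bar> * (1 - snd x * snd x))) * \<bar>g x\<bar>"
      if "\<bar>snd x\<bar> \<le> 1" for x n
    proof -
      have "\<bar>T x\<bar> * \<bar>dcut n (snd x)\<bar> \<le> (L * (1 - snd x * snd x)) * \<bar>dcut n (snd x)\<bar>"
        using L[OF that, of "fst x"] by (intro mult_right_mono) auto
      from mult_right_mono[OF this abs_ge_zero[of "g x"]] show ?thesis
        by (simp only: abs_mult mult_ac)
    qed
    have L0: "0 \<le> L" using L[of 0 0] abs_ge_zero[of "T (0, 0)"] by simp
    show "(\<lambda>x. g x * (T x * dcut n (snd x))) \<in> borel_measurable OmegaM" for n
      by (rule borel_measurable_times[OF L2D(1)[OF g] smooth_measurable_OmegaM[OF smooth_mult[OF sT(1) sdc]]])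
    show "integrable OmegaM (\<lambda>x. (L * 4) * \<bar>g x\<bar>)" using L2_integrable[OF g] by simp
    show "AE x in OmegaM. (\<lambda>n. g x * (T x * dcut n (snd x))) \<longlonglongrightarrow> 0"
      using AE_OmegaM_snd
    proof eventually_elim
      case (elim x)
      have "(\<lambda>n. (L * (\<bar>dcut n (snd x)\<bar> * (1 - snd x * snd x))) * \<bar>g x\<bar>) \<longlonglongrightarrow> (L * 0) * \<bar>g x\<bar>"
        using dcut_bound(2)[of "snd x"] elim by (intro tendsto_mult tendsto_const) auto
      then have lim: "(\<lambda>n. (L * (\<bar>dcut n (snd x)\<bar> * (1 - snd x * snd x))) * \<bar>g x\<bar>) \<longlonglongrightarrow> 0" by simp
      show ?case
        by (rule Lim_null_comparison[OF _ lim]) (use b[of x] elim in auto)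
    qed
    show "AE x in OmegaM. norm (g x * (T x * dcut n (snd x))) \<le> (L * 4) * \<bar>g x\<bar>" for n
      using AE_OmegaM_snd
    proof eventually_elim
      case (elim x)
      have "(L * (\<bar>dcut n (snd x)\<bar> * (1 - snd x * snd x))) * \<bar>g x\<bar> \<le> (L * 4) * \<bar>g x\<bar>"
        using dcut_bound(1)[of "snd x" n] elim L0 by (intro mult_right_mono mult_left_mono) auto
      then show ?case using b[of x n] elim by simp
    qed
  qed simp
  then have 1: "(\<lambda>n. LINT x|OmegaM. g x * (T x * dcut n (snd x))) \<longlonglongrightarrow> 0" by simp
  have "(\<lambda>n. (LINT x|OmegaM. g x * (T x * dcut n (snd x))) + (LINT x|OmegaM. g x * (?dT x * vcut n (snd x))))
      \<longlonglongrightarrow> 0 + (LINT x|OmegaM. g x * ?dT x)"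
    by (rule tendsto_add[OF 1 LINT_cut_tendsto[OF g sT(2) T(3)]])
  moreover have "(LINT x|OmegaM. g x * (T x * dcut n (snd x))) + (LINT x|OmegaM. g x * (?dT x * vcut n (snd x)))
      = - (LINT x|OmegaM. h x * (T x * vcut n (snd x)))" for n
  proof -
    have "(LINT x|OmegaM. g x * frechet_derivative (\<lambda>x. T x * vcut n (snd x)) (at x) (0, 1)) =
        - (LINT x|OmegaM. h x * (T x * vcut n (snd x)))"
      using h cut_test[OF T(1), of n] by (simp add: has_weak_deriv_def)
    moreover have "frechet_derivative (\<lambda>x. T x * vcut n (snd x)) (at x) (0, 1) =
        T x * dcut n (snd x) + ?dT x * vcut n (snd x)" for x
      using frechet_derivative_mult[OF sT(1) smooth_cut_snd, of n x "(0, 1)"] by (simp only: frechet_cut_snd)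
    moreover have "integrable OmegaM (\<lambda>x. g x * (T x * dcut n (snd x)))"
        "integrable OmegaM (\<lambda>x. g x * (?dT x * vcut n (snd x)))"
      by (intro L2_mult_integrable g smooth_L2 smooth_mult sT sdc smooth_cut_snd)+
    ultimately show ?thesis by (simp add: distrib_left)
  qed
  moreover have "(\<lambda>n. - (LINT x|OmegaM. h x * (T x * vcut n (snd x)))) \<longlonglongrightarrow> - (LINT x|OmegaM. h x * T x)"
    by (intro tendsto_minus LINT_cut_tendsto[OF hL sT(1) T(2)])
  ultimately show ?thesis
    using LIMSEQ_unique by (simp only: add_0) blast
qed

section \<open>The vertical derivatives tested against a mode\<close>

text \<open>Up to the factor \<open>(pi p)\<^sup>k\<close>, the \<open>k\<close>-th vertical derivative of the mode.\<close>

definition tmode :: "'n \<Rightarrow> nat \<Rightarrow> nat \<Rightarrow> ('n::finite) pt \<Rightarrow> real" where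
  "tmode i p k = wave i p 1 0 (- (pi / 2) + real k * (pi / 2))"

lemma tmode_strip: "tmode i p k \<in> smooth_strip"
  unfolding tmode_def by (rule wave_smooth_strip)

lemma tmode_le_1: "\<bar>tmode i p k x\<bar> \<le> 1"
  unfolding tmode_def wave_def abs_mult by (intro mult_le_one) auto

lemma LINT_tmode_square: "(LINT x|OmegaM. (tmode i p k (x :: ('n::finite) pt))\<^sup>2) \<le> 2"
proof -
  have "(LINT x|OmegaM. (tmode i p k (x :: 'n pt))\<^sup>2) \<le> (LINT x|(OmegaM :: 'n pt measure). 1)"
  proof (rule integral_mono[OF L2D(2)[OF smooth_L2[OF smooth_stripD[OF tmode_strip]]]])
    show "(tmode i p k x)\<^sup>2 \<le> 1" for x :: "'n pt"
      using tmode_le_1[of i p k x] by (simp add: abs_square_le_1)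
  qed simp
  then show ?thesis using measure_OmegaM[where 'n = 'n] by simp
qed

lemma tmode_0: "tmode i p 0 = mode i p"
  by (simp add: tmode_def)

lemma tmode_add_2: "tmode i p (Suc (Suc k)) x = - tmode i p k x"
proof -
  have "pi * real p * snd x + (- (pi / 2) + real (Suc (Suc k)) * (pi / 2)) =
      (pi * real p * snd x + (- (pi / 2) + real k * (pi / 2))) + pi"
    by (simp add: algebra_simps)
  then show ?thesis
    unfolding tmode_def wave_def by (simp only: cos_periodic_pi mult_minus_right)
qed

lemma frechet_tmode: "frechet_derivative (tmode i p k) (at x) (0, 1) = pi * real p * tmode i p (Suc k) x"
proof -
  have "- (pi / 2) + real k * (pi / 2) + pi / 2 = - (pi / 2) + real (Suc k) * (pi / 2)"
    by (simp add: algebra_simps)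
  then show ?thesis
    unfolding tmode_def frechet_wave_vertical by (simp only: wave_def mult_1 mult_1_right mult.assoc)
qed

text \<open>For even k this is the sine mode up to sign, and pi p is a zero of the sine, so the
  distance to the boundary times pi p is a bound. The weaker form with 1 - z^2 matches the weight in
  \<open>dcut_bound\<close>.\<close>

lemma tmode_even_bound:
  assumes "even k" "\<bar>z\<bar> \<le> 1"
  shows "\<bar>tmode i p k (y, z)\<bar> \<le> pi * real p * (1 - z * z)"
proof -
  have "\<bar>tmode i p k (y, z)\<bar> = \<bar>mode i p (y, z)\<bar>"
  proof -
    have "\<bar>tmode i p (2 * l) (y, z)\<bar> = \<bar>mode i p (y, z)\<bar>" for l
      by (induction l) (simp_all only: mult_0_right mult_Suc_right add_2_eq_Suc tmode_0 tmode_add_2 abs_minus_cancel)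
    then show ?thesis using assms(1) by (auto elim!: evenE)
  qed
  also have "\<dots> \<le> 1 * \<bar>sin (pi * real p * z)\<bar>"
    unfolding mode_eq abs_mult by (intro mult_mono) auto
  also have "\<bar>sin (pi * real p * z)\<bar> \<le> pi * real p * (1 - \<bar>z\<bar>)"
  proof -
    have "\<bar>sin (pi * real p * z)\<bar> = \<bar>sin (pi * real p * \<bar>z\<bar>)\<bar>"
      by (cases "z \<ge> 0") auto
    also have "\<dots> = \<bar>sin (pi * real p - pi * real p * \<bar>z\<bar>)\<bar>"
      by (simp add: sin_diff abs_mult)
    also have "\<dots> \<le> \<bar>pi * real p - pi * real p * \<bar>z\<bar>\<bar>"
      by (rule abs_sin_x_le_abs_x)
    also have "\<dots> = pi * real p * (1 - \<bar>z\<bar>)"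
      using assms(2) by (simp add: right_diff_distrib mult_left_le)
    finally show ?thesis .
  qed
  also have "pi * real p * (1 - \<bar>z\<bar>) \<le> pi * real p * (1 - z * z)"
  proof (intro mult_left_mono)
    have "\<bar>z\<bar> * \<bar>z\<bar> \<le> \<bar>z\<bar> * 1" using assms(2) by (intro mult_left_mono) auto
    then show "1 - \<bar>z\<bar> \<le> 1 - z * z" by simp
  qed auto
  finally show ?thesis by simp
qed

lemma X_spaceD:
  assumes "f \<in> X_space m"
  shows "f \<in> L2" "\<And>k. k \<le> m \<Longrightarrow> \<exists>g. has_weak_deriv (replicate k (0, 1)) f g"
    "\<And>k. even k \<Longrightarrow> k < m \<Longrightarrow> has_trace (vert_deriv k f) (\<lambda>_. 0)"
proof -
  have s: "f \<in> sobolev m" and t: "\<And>k. even k \<and> k \<le> mstar m \<Longrightarrow> has_trace (vert_deriv k f) (\<lambda>_. 0)"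
    using assms by (auto simp: X_space_def)
  show "f \<in> L2" using s by (simp add: sobolev_def)
  show "\<exists>g. has_weak_deriv (replicate k (0, 1)) f g" if "k \<le> m" for k
    using s that vertical_in_Basis unfolding sobolev_def
    by (auto dest!: spec[of _ "replicate k (0, 1)"] split: if_splits simp: set_replicate_conv_if)
  show "has_trace (vert_deriv k f) (\<lambda>_. 0)" if "even k" "k < m" for k
  proof (rule t)
    \<comment> \<open>An even k below an even m is not m - 1; hence \<open>mstar\<close> reaches all
      even orders below m.\<close>
    have "k \<le> m - 2" if "even m"
      using \<open>even k\<close> \<open>k < m\<close> that by (auto elim!: evenE)
    then show "even k \<and> k \<le> mstar m"
      using that by (auto simp: mstar_def)
  qed
qed

text \<open>Each induction step moves one vertical derivative onto the test function; its sign
  cancels the one in the derivative of \<open>tmode i p (Suc k)\<close>, which is -pi p times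
  \<open>tmode i p k\<close>. For even k the zero trace of the k-th derivative is used. For odd k,
  \<open>tmode i p (Suc k)\<close> is a vertical sine up to sign and the cutoff version
  applies.\<close>

lemma LINT_tmode:
  assumes f: "f \<in> X_space m" and g: "has_weak_deriv (replicate k (0, 1)) f g" and k: "k \<le> m"
  shows "(LINT x|OmegaM. g x * tmode i p k x) = (pi * real p) ^ k * (LINT x|OmegaM. f x * mode i p x)"
  using k g
proof (induction k arbitrary: g)
  case 0
  have "AE x in OmegaM. g x = f x"
    using has_weak_deriv_unique[OF _ has_weak_deriv_Nil[OF X_spaceD(1)[OF f]]] 0 by simp
  moreover have "g \<in> L2" using 0 by (simp add: has_weak_deriv_def)
  ultimately have "(LINT x|OmegaM. g x * tmode i p 0 x) = (LINT x|OmegaM. f x * tmode i p 0 x)"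
    using L2D(1)[of g] L2D(1)[OF X_spaceD(1)[OF f]] smooth_measurable_OmegaM[OF smooth_stripD[OF tmode_strip]]
    by (intro integral_cong_AE) (auto intro!: borel_measurable_times elim!: eventually_mono)
  then show ?case by (simp add: tmode_0)
next
  case (Suc k)
  let ?gk = "vert_deriv k f" and ?T = "tmode i p (Suc k)"
  have gk: "has_weak_deriv (replicate k (0, 1)) f ?gk"
    using X_spaceD(2)[OF f, of k] Suc.prems(1) has_weak_deriv_weak_deriv
    unfolding vert_deriv_def by fastforce
  then have gkL: "?gk \<in> L2" by (simp add: has_weak_deriv_def)
  have gg: "has_weak_deriv [(0, 1)] ?gk g"
    by (rule has_weak_deriv_append[OF gk])
      (use Suc.prems(2) vertical_in_Basis in \<open>auto simp: replicate_append_same[symmetric]\<close>)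
  have dT: "frechet_derivative ?T (at x) (0, 1) = - (pi * real p) * tmode i p k x" for x
    by (simp add: frechet_tmode tmode_add_2)
  have "(LINT x|OmegaM. ?gk x * frechet_derivative ?T (at x) (0, 1)) = - (LINT x|OmegaM. g x * ?T x)"
  proof (cases "even k")
    case True
    show ?thesis
      by (rule LINT_by_parts_trace[OF X_spaceD(3)[OF f True] gkL gg tmode_strip tmode_le_1])
        (use Suc.prems(1) in auto)
  next
    case False
    show ?thesis
    proof (rule LINT_by_parts_cut[OF gkL gg tmode_strip, where K = "max 1 (pi * real p)" and L = "pi * real p"])
      show "\<bar>?T x\<bar> \<le> max 1 (pi * real p)" for x
        using tmode_le_1[of i p "Suc k" x] by simp
      show "\<bar>frechet_derivative ?T (at x) (0, 1)\<bar> \<le> max 1 (pi * real p)" for x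
      proof -
        have "\<bar>- (pi * real p) * tmode i p k x\<bar> \<le> pi * real p * 1"
          unfolding abs_mult using tmode_le_1[of i p k x] by (intro mult_mono) auto
        then show ?thesis unfolding dT by simp
      qed
      show "\<bar>?T (y, z)\<bar> \<le> pi * real p * (1 - z * z)" if "\<bar>z\<bar> \<le> 1" for y z
        by (rule tmode_even_bound) (use False that in auto)
    qed
  qed
  moreover have "(LINT x|OmegaM. ?gk x * frechet_derivative ?T (at x) (0, 1)) =
      - (pi * real p) * (LINT x|OmegaM. ?gk x * tmode i p k x)"
  proof -
    have "?gk x * frechet_derivative ?T (at x) (0, 1) = - (pi * real p) * (?gk x * tmode i p k x)" for x
      unfolding dT by (simp only: mult.left_commute)
    then show ?thesis by (simp only: integral_mult_right_zero)
  qed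
  ultimately have "(LINT x|OmegaM. g x * ?T x) = pi * real p * (LINT x|OmegaM. ?gk x * tmode i p k x)"
    by simp
  then show ?case using Suc.IH[OF _ gk] Suc.prems(1) by simp
qed


section \<open>Fluctuations\<close>

lemma integral_cos_cell: "integral (cbox 0 1) (\<lambda>y :: real^'n::finite. cos (2 * pi * y $ i)) = 0"
proof -
  have "(0 :: int^'n) \<noteq> axis i 1" "(0 :: int^'n) \<noteq> - axis i 1"
    by (auto simp: vec_eq_iff axis_def intro!: exI[of _ i])
  from integral_cos_exp_zero[OF this]
  have "integral (cbox 0 1) (\<lambda>y :: real^'n. complex_of_real (cos (2 * pi * y $ i))) = 0" by simp
  moreover have "(\<lambda>y :: real^'n. cos (2 * pi * y $ i)) integrable_on cbox 0 1"
    by (intro integrable_continuous continuous_intros)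
  from integral_unique[OF integral_complex_of_real_HK[OF this]]
  have "integral (cbox 0 1) (\<lambda>y :: real^'n. complex_of_real (cos (2 * pi * y $ i))) =
    of_real (integral (cbox 0 1) (\<lambda>y :: real^'n. cos (2 * pi * y $ i)))" .
  ultimately show ?thesis by simp
qed

text \<open>The subtracted mean depends on the vertical variable only, so Fubini and the zero mean
  of the cosine over the cell remove it. The profile \<open>W\<close> is arbitrary because
  derivatives of cut-off profiles will be inserted.\<close>

lemma LINT_fluctuation:
  fixes f :: "('n::finite) pt \<Rightarrow> real"
  assumes f: "f \<in> L2" "fluctuation f \<in> L2" and W: "continuous_on UNIV W"
  shows "(LINT x|OmegaM. fluctuation f x * (cos (2 * pi * fst x $ i) * W (snd x))) =
    (LINT x|OmegaM. f x * (cos (2 * pi * fst x $ i) * W (snd x)))"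
proof -
  let ?c = "\<lambda>x :: 'n pt. cos (2 * pi * fst x $ i) * W (snd x)"
  define \<mu> where "\<mu> z = (LINT y|cellM. f (y, z))" for z
  have M: "f x - fluctuation f x = \<mu> (snd x)" for x
    by (simp add: fluctuation_def \<mu>_def)
  have \<mu>L: "(\<lambda>x :: 'n pt. \<mu> (snd x)) \<in> L2"
    using L2_diff[OF f] by (simp add: M)
  have "continuous_on UNIV ?c"
    by (intro continuous_intros continuous_on_compose2[OF W]) auto
  then have cL: "?c \<in> L2" by (rule continuous_L2)
  define F where "F y z = indicator cell y * (indicator {-1..1} z * (\<mu> z * (cos (2 * pi * y $ i) * W z)))"
    for y :: "real^'n" and z :: real
  have F: "indicator (cell \<times> {-1..1}) x *\<^sub>R (\<mu> (snd x) * ?c x) = case_prod F x" for x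
    by (cases x) (simp add: F_def indicator_times)
  have S: "cell \<times> {-1..1} \<inter> space (lborel :: 'n pt measure) \<in> sets lborel"
    using strip_borel by simp
  have "integrable OmegaM (\<lambda>x. \<mu> (snd x) * ?c x)"
    by (rule L2_mult_integrable[OF \<mu>L cL])
  then have "integrable lborel (case_prod F)"
    unfolding OmegaM_def integrable_restrict_space[OF S] F .
  then have int: "integrable (lborel \<Otimes>\<^sub>M lborel) (case_prod F)"
    by (simp only: lborel_prod)
  have inner: "(LINT y|lborel. F y z) = 0" for z
  proof -
    have "(LINT y|lborel. indicator cell y *\<^sub>R cos (2 * pi * (y :: real^'n) $ i)) = (LINT y|cellM. cos (2 * pi * y $ i))"
      unfolding cellM_def using cell_borel by (subst integral_restrict_space) auto
    also have "\<dots> = 0"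
      by (subst LINT_cellM(2)) (auto intro!: continuous_intros simp: integral_cos_cell)
    finally have 0: "(LINT y|lborel. indicator cell y * cos (2 * pi * (y :: real^'n) $ i)) = 0" by simp
    have "F y z = (indicator {-1..1} z * \<mu> z * W z) * (indicator cell y * cos (2 * pi * y $ i))" for y
      by (simp add: F_def)
    then show ?thesis by (simp only: integral_mult_right_zero 0 mult_zero_right)
  qed
  have "(LINT x|OmegaM. \<mu> (snd x) * ?c x) = (LINT x|lborel. case_prod F x)"
    unfolding OmegaM_def integral_restrict_space[OF S] F ..
  also have "\<dots> = (LINT z|lborel. LINT y|lborel. F y z)"
    by (subst lborel_pair.integral_snd[OF int]) (simp only: lborel_prod)
  also have "\<dots> = 0" by (simp add: inner)
  finally have "(LINT x|OmegaM. (f x - fluctuation f x) * ?c x) = 0"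
    by (simp only: M)
  then show ?thesis
    by (simp add: left_diff_distrib L2_mult_integrable f cL)
qed

lemma partials_vertical_product:
  fixes W :: "real \<Rightarrow> real"
  assumes W: "smooth W"
  shows "partials (replicate k (0, 1)) (\<lambda>x :: ('n::finite) pt. cos (2 * pi * fst x $ i) * W (snd x)) =
    (\<lambda>x. cos (2 * pi * fst x $ i) * partials (replicate k 1) W (snd x))"
proof (induction k)
  case (Suc k)
  have s1: "smooth (\<lambda>x :: 'n pt. cos (2 * pi * fst x $ i))"
    by (intro smooth_cos smooth_mult smooth_const smooth_fst_nth)
  have Wk: "smooth (partials (replicate k 1) W)" by (rule smooth_partials[OF W]) auto
  have s2: "smooth (\<lambda>x :: 'n pt. partials (replicate k 1) W (snd x))"
    by (rule smooth_compose_smooth[OF Wk smooth_snd])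
  have d1: "frechet_derivative (\<lambda>x :: 'n pt. cos (2 * pi * fst x $ i)) (at x) (0, 1) = 0" for x
  proof -
    have "((\<lambda>x :: 'n pt. cos (2 * pi * fst x $ i)) has_derivative (\<lambda>h. - (sin (2 * pi * fst x $ i) * (2 * pi * fst h $ i)))) (at x)"
      by (auto intro!: derivative_eq_intros bounded_linear.has_derivative[OF bounded_linear_vec_nth])
    from frechet_derivative_eq[OF this, of "(0, 1)"] show ?thesis by simp
  qed
  have d2: "frechet_derivative (\<lambda>x :: 'n pt. partials (replicate k 1) W (snd x)) (at x) (0, 1) = partials (replicate (Suc k) 1) W (snd x)" for x
    by (rule frechet_compose_snd[OF smooth_real_iterate[OF W]])
  show ?case
    unfolding replicate_Suc[of k "(0, 1)"] partials.simps Suc.IH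
  proof (intro ext)
    fix x :: "'n pt"
    show "frechet_derivative (\<lambda>x. cos (2 * pi * fst x $ i) * partials (replicate k 1) W (snd x)) (at x) (0, 1) =
        cos (2 * pi * fst x $ i) * partials (replicate (Suc k) 1) W (snd x)"
      using frechet_derivative_mult[OF s1 s2, of x "(0, 1)"] d1[of x] d2[of x] by simp
  qed
qed simp

text \<open>No trace condition for the fluctuation is at hand, so its weak derivative is compared
  with that of f. With a cutoff, the test function is a cosine times a vertical profile, and so are
  its vertical derivatives; on such functions f and its fluctuation have equal pairings. The cutoff
  is removed at the end.\<close>

lemma LINT_tmode_fluctuation:
  fixes f :: "('n::finite) pt \<Rightarrow> real"
  assumes f: "f \<in> X_space m" "fluctuation f \<in> L2" and k: "k \<le> m"
    and G: "has_weak_deriv (replicate k (0, 1)) (fluctuation f) G"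
  shows "(LINT x|OmegaM. G x * tmode i p k x) = (pi * real p) ^ k * (LINT x|OmegaM. f x * mode i p x)"
proof -
  obtain g where g: "has_weak_deriv (replicate k (0, 1)) f g" using X_spaceD(2)[OF f(1) k] by blast
  have L: "G \<in> L2" "g \<in> L2" using G g by (auto simp: has_weak_deriv_def)
  have sT: "smooth (tmode i p k)" by (rule smooth_stripD[OF tmode_strip])
  have "(LINT x|OmegaM. G x * (tmode i p k x * vcut n (snd x))) = (LINT x|OmegaM. g x * (tmode i p k x * vcut n (snd x)))" for n
  proof -
    define W where "W z = cos (pi * real p * z + (- (pi / 2) + real k * (pi / 2))) * vcut n z" for z
    have W: "smooth W"
      unfolding W_def[abs_def] by (intro smooth_mult smooth_cos smooth_add smooth_const smooth_id smooth_cut)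
    have eq: "(\<lambda>x. tmode i p k x * vcut n (snd x)) = (\<lambda>x. cos (2 * pi * fst x $ i) * W (snd x))"
      by (simp add: fun_eq_iff tmode_def wave_def W_def)
    have \<psi>: "(\<lambda>x. cos (2 * pi * fst x $ i) * W (snd x)) \<in> test_functions"
      using cut_test[OF tmode_strip[of i p k], of n] unfolding eq .
    have "smooth (partials (replicate k 1) W)" by (rule smooth_partials[OF W]) auto
    then have c: "continuous_on UNIV (partials (replicate k 1) W)" by (rule smooth_continuous_on)
    have "(-1) ^ k * (LINT x|OmegaM. G x * (cos (2 * pi * fst x $ i) * W (snd x))) =
        (LINT x|OmegaM. fluctuation f x * partials (replicate k (0, 1)) (\<lambda>x. cos (2 * pi * fst x $ i) * W (snd x)) x)"
      using G \<psi> by (simp add: has_weak_deriv_def)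
    moreover have "(-1) ^ k * (LINT x|OmegaM. g x * (cos (2 * pi * fst x $ i) * W (snd x))) =
        (LINT x|OmegaM. f x * partials (replicate k (0, 1)) (\<lambda>x. cos (2 * pi * fst x $ i) * W (snd x)) x)"
      using g \<psi> by (simp add: has_weak_deriv_def)
    moreover have "(LINT x|OmegaM. fluctuation f x * partials (replicate k (0, 1)) (\<lambda>x. cos (2 * pi * fst x $ i) * W (snd x)) x) =
        (LINT x|OmegaM. f x * partials (replicate k (0, 1)) (\<lambda>x. cos (2 * pi * fst x $ i) * W (snd x)) x)"
      unfolding partials_vertical_product[OF W] by (rule LINT_fluctuation[OF X_spaceD(1)[OF f(1)] f(2) c])
    ultimately have "(-1 :: real) ^ k * (LINT x|OmegaM. G x * (cos (2 * pi * fst x $ i) * W (snd x))) =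
        (-1) ^ k * (LINT x|OmegaM. g x * (cos (2 * pi * fst x $ i) * W (snd x)))" by simp
    then have "(LINT x|OmegaM. G x * (cos (2 * pi * fst x $ i) * W (snd x))) =
        (LINT x|OmegaM. g x * (cos (2 * pi * fst x $ i) * W (snd x)))" by simp
    moreover have "tmode i p k x * vcut n (snd x) = cos (2 * pi * fst x $ i) * W (snd x)" for x
      using eq by (rule fun_cong)
    ultimately show ?thesis by simp
  qed
  then have "(\<lambda>n. LINT x|OmegaM. g x * (tmode i p k x * vcut n (snd x))) \<longlonglongrightarrow> (LINT x|OmegaM. G x * tmode i p k x)"
    using LINT_cut_tendsto[OF L(1) sT tmode_le_1] by simp
  from LIMSEQ_unique[OF this LINT_cut_tendsto[OF L(2) sT tmode_le_1]]
  show ?thesis using LINT_tmode[OF f(1) g k] by simp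
qed


section \<open>A lower bound for the Gagliardo seminorm\<close>

text \<open>The vertical side 2/p is a full period of the vertical factor, so every
  \<open>tmode i p k\<close> has mean zero on each cell. The map (z + 1)/2 carries [-1,1] to [0,1],
  so that every coordinate is cut into p pieces.\<close>

definition same_cell :: "nat \<Rightarrow> ('n::finite) pt \<Rightarrow> 'n pt \<Rightarrow> bool" where
  "same_cell p x y \<longleftrightarrow> (\<forall>j. \<lfloor>real p * fst x $ j\<rfloor> = \<lfloor>real p * fst y $ j\<rfloor>) \<and>
     \<lfloor>real p * (snd x + 1) / 2\<rfloor> = \<lfloor>real p * (snd y + 1) / 2\<rfloor>"

definition ker :: "nat \<Rightarrow> ('n::finite) pt \<Rightarrow> 'n pt \<Rightarrow> real" where
  "ker p x y = (if same_cell p x y then 1 else 0)"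

lemma ker_commute: "ker p x y = ker p y x"
  by (simp add: ker_def same_cell_def eq_commute)

lemma ker_bounds: "0 \<le> ker p x y" "ker p x y \<le> 1" "ker p x y * ker p x y = ker p x y"
  by (auto simp: ker_def)

section \<open>Measurability and integrals of the cell kernel\<close>

lemma measurable_OmegaM_fst_nth [measurable]: "(\<lambda>x. fst x $ j) \<in> borel_measurable (OmegaM :: ('n::finite) pt measure)"
  by (intro smooth_measurable_OmegaM smooth_fst_nth)

lemma measurable_OmegaM_snd [measurable]: "(\<lambda>x. snd x) \<in> borel_measurable (OmegaM :: ('n::finite) pt measure)"
  by (intro smooth_measurable_OmegaM smooth_snd)

lemma measurable_ker:
  "(\<lambda>(x, y). ker p x y) \<in> borel_measurable ((OmegaM :: ('n::finite) pt measure) \<Otimes>\<^sub>M OmegaM)"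
proof -
  have [measurable]: "(\<lambda>z. fst (fst z) $ j) \<in> borel_measurable ((OmegaM :: 'n pt measure) \<Otimes>\<^sub>M (OmegaM :: 'n pt measure))"
    "(\<lambda>z. fst (snd z) $ j) \<in> borel_measurable ((OmegaM :: 'n pt measure) \<Otimes>\<^sub>M (OmegaM :: 'n pt measure))"
    "(\<lambda>z. snd (fst z)) \<in> borel_measurable ((OmegaM :: 'n pt measure) \<Otimes>\<^sub>M (OmegaM :: 'n pt measure))"
    "(\<lambda>z. snd (snd z)) \<in> borel_measurable ((OmegaM :: 'n pt measure) \<Otimes>\<^sub>M (OmegaM :: 'n pt measure))" for j
    by (rule measurable_compose[OF measurable_fst measurable_OmegaM_fst_nth]
        measurable_compose[OF measurable_snd measurable_OmegaM_fst_nth]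
        measurable_compose[OF measurable_fst measurable_OmegaM_snd]
        measurable_compose[OF measurable_snd measurable_OmegaM_snd])+
  show ?thesis
    unfolding ker_def same_cell_def split_beta by measurable
qed

lemma measurable_ker_snd: "(\<lambda>y. ker p x y) \<in> borel_measurable (OmegaM :: ('n::finite) pt measure)"
  unfolding ker_def same_cell_def by measurable

lemma ker_L2: "(\<lambda>y. ker p x y) \<in> L2"
  by (rule L2_bounded[OF measurable_ker_snd, where K = 1]) (auto simp: ker_def)

lemma floor_eq_iff_interval:
  fixes u :: real and a :: int
  assumes "p \<ge> 1"
  shows "\<lfloor>real p * u\<rfloor> = a \<longleftrightarrow> of_int a / real p \<le> u \<and> u < (of_int a + 1) / real p"
  using assms by (simp add: floor_eq_iff pos_divide_le_eq pos_less_divide_eq mult.commute)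

text \<open>The cell of \<open>y\<close> is a half-open box inside the strip, which reduces the
  integral to one over a closed box. At \<open>snd y = 1\<close> the floor would be p and the box
  would stick out of the strip, a case excluded by \<open>\<bar>snd y\<bar> < 1\<close>.\<close>

lemma LINT_ker:
  fixes y :: "('n::finite) pt" and F :: "'n pt \<Rightarrow> real"
  assumes p: "p \<ge> 1" and y: "fst y \<in> cell" "\<bar>snd y\<bar> < 1" and F: "continuous_on UNIV F"
  shows "\<exists>lo hi l. (\<forall>j. hi $ j = lo $ j + 1 / real p) \<and>
    (LINT x|OmegaM. ker p x y * F x) = integral (cbox (lo, l) (hi, l + 2 / real p)) F"
proof -
  define a where "a j = \<lfloor>real p * fst y $ j\<rfloor>" for j
  define b where "b = \<lfloor>real p * (snd y + 1) / 2\<rfloor>"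
  define lo :: "real^'n" where "lo = (\<chi> j. of_int (a j) / real p)"
  define hi :: "real^'n" where "hi = (\<chi> j. (of_int (a j) + 1) / real p)"
  define l where "l = 2 * of_int b / real p - 1"
  define Q where "Q = {x :: 'n pt. same_cell p x y}"
  have P: "real p > 0" using p by simp
  have memQ: "x \<in> Q \<longleftrightarrow> (\<forall>j. lo $ j \<le> fst x $ j \<and> fst x $ j < hi $ j) \<and> l \<le> snd x \<and> snd x < l + 2 / real p" for x
  proof -
    have "\<lfloor>real p * (snd x + 1) / 2\<rfloor> = b \<longleftrightarrow> l \<le> snd x \<and> snd x < l + 2 / real p"
      using P by (simp add: floor_eq_iff l_def field_simps)
    then show ?thesis
      unfolding Q_def same_cell_def mem_Collect_eq a_def[symmetric] b_def[symmetric] floor_eq_iff_interval[OF p]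
      by (simp add: lo_def hi_def)
  qed
  have a01: "0 \<le> a j" "a j + 1 \<le> int p" for j
  proof -
    have "0 \<le> fst y $ j" "fst y $ j < 1" using y(1) by (auto simp: cell_def)
    then have "0 \<le> real p * fst y $ j" "real p * fst y $ j < real p" using P by auto
    then show "0 \<le> a j" "a j + 1 \<le> int p" unfolding a_def by linarith+
  qed
  have b01: "0 \<le> b" "b + 1 \<le> int p"
  proof -
    have "0 \<le> real p * (snd y + 1) / 2" "real p * (snd y + 1) / 2 < real p" using y(2) P by auto
    then show "0 \<le> b" "b + 1 \<le> int p" unfolding b_def by linarith+
  qed
  have Qsub: "Q \<subseteq> cell \<times> {-1..1}"
  proof
    fix x assume "x \<in> Q"
    then have x: "\<And>j. lo $ j \<le> fst x $ j \<and> fst x $ j < hi $ j" "l \<le> snd x" "snd x < l + 2 / real p"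
      by (auto simp: memQ)
    have "0 \<le> lo $ j" "hi $ j \<le> 1" for j
    proof -
      show "0 \<le> lo $ j" using a01(1)[of j] by (simp add: lo_def)
      have "of_int (a j + 1) \<le> real_of_int (int p)" using a01(2)[of j] by (simp only: of_int_le_iff)
      then show "hi $ j \<le> 1" using P by (simp add: hi_def)
    qed
    then have "fst x \<in> cell" using x(1) by (auto simp: cell_def intro: order_trans less_le_trans)
    moreover have "-1 \<le> l" using b01(1) by (simp add: l_def)
    moreover have "l + 2 / real p \<le> 1"
    proof -
      have "of_int (b + 1) \<le> real_of_int (int p)" using b01(2) by (simp only: of_int_le_iff)
      then show ?thesis using P by (simp add: l_def field_simps)
    qed
    ultimately show "x \<in> cell \<times> {-1..1}" using x(2,3) by (cases x) auto
  qed
  have lbox: "box (lo, l) (hi, l + 2 / real p) \<subseteq> Q" "Q \<subseteq> cbox (lo, l) (hi, l + 2 / real p)"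
    by (auto simp: memQ box_Pair_eq cbox_Pair_eq mem_box_cart less_imp_le)
  have Qb: "Q \<in> sets borel"
  proof -
    have "Q = (\<Inter>j. {x. lo $ j \<le> fst x $ j} \<inter> {x. fst x $ j < hi $ j}) \<inter> {x. l \<le> snd x} \<inter> {x. snd x < l + 2 / real p}"
      by (auto simp: memQ)
    moreover have "\<dots> \<in> sets borel"
      by (intro sets.Int sets.finite_INT borel_closed borel_open closed_Collect_le open_Collect_less continuous_intros) auto
    ultimately show ?thesis by simp
  qed
  have "(LINT x|OmegaM. ker p x y * F x) = (LINT x|lborel. indicator (cell \<times> {-1..1}) x *\<^sub>R (ker p x y * F x))"
    unfolding OmegaM_def using strip_borel by (subst integral_restrict_space) auto
  also have "\<dots> = (LINT x|lborel. indicator Q x *\<^sub>R F x)"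
  proof (rule Bochner_Integration.integral_cong[OF refl])
    show "indicator (cell \<times> {-1..1}) x *\<^sub>R (ker p x y * F x) = indicator Q x *\<^sub>R F x" for x
      using Qsub by (auto simp: indicator_def ker_def Q_def)
  qed
  also have "\<dots> = (LINT x|restrict_space lborel Q. F x)"
    using Qb by (subst integral_restrict_space) auto
  also have "\<dots> = integral (cbox (lo, l) (hi, l + 2 / real p)) F"
    by (rule restrict_lborel_continuous(2)[OF Qb lbox]) (rule continuous_on_subset[OF F], simp)
  finally have "(LINT x|OmegaM. ker p x y * F x) = integral (cbox (lo, l) (hi, l + 2 / real p)) F" .
  moreover have "\<forall>j. hi $ j = lo $ j + 1 / real p"
    by (simp add: lo_def hi_def add_divide_distrib)
  ultimately show ?thesis by blast
qed

definition cellvol :: "'n itself \<Rightarrow> nat \<Rightarrow> real" where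
  "cellvol _ p = 2 / real p * (1 / real p) ^ CARD('n)"

lemma LINT_ker_1:
  fixes y :: "('n::finite) pt"
  assumes p: "p \<ge> 1" and y: "fst y \<in> cell" "\<bar>snd y\<bar> < 1"
  shows "(LINT x|OmegaM. ker p x y) = cellvol TYPE('n) p"
proof -
  obtain lo hi :: "real^'n" and l where h: "\<And>j. hi $ j = lo $ j + 1 / real p"
    and eq: "(LINT x|OmegaM. ker p x y * 1) = integral (cbox (lo, l) (hi, l + 2 / real p)) (\<lambda>x. 1)"
    using LINT_ker[OF assms, of "\<lambda>x. 1"] by auto
  have "cbox lo hi \<noteq> {}"
    using h by (auto simp: interval_ne_empty_cart)
  then have c: "measure lborel (cbox lo hi) = (1 / real p) ^ CARD('n)"
    by (simp add: content_cbox_cart h)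
  have "integral (cbox (lo, l) (hi, l + 2 / real p)) (\<lambda>x. 1 :: real) =
      integral (cbox lo hi) (\<lambda>y. integral (cbox l (l + 2 / real p)) (\<lambda>z. 1))"
    by (rule integral_prod_continuous) auto
  also have "\<dots> = cellvol TYPE('n) p"
    by (simp add: c cellvol_def)
  finally show ?thesis using eq by simp
qed

lemma LINT_ker_tmode:
  fixes y :: "('n::finite) pt"
  assumes p: "p \<ge> 1" and y: "fst y \<in> cell" "\<bar>snd y\<bar> < 1"
  shows "(LINT x|OmegaM. ker p x y * tmode i p k x) = 0"
proof -
  define \<beta> where "\<beta> = - (pi / 2) + real k * (pi / 2)"
  have cont: "continuous_on UNIV (tmode i p k)"
    by (rule smooth_continuous_on[OF smooth_stripD[OF tmode_strip]])
  obtain lo hi :: "real^'n" and l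
    where eq: "(LINT x|OmegaM. ker p x y * tmode i p k x) = integral (cbox (lo, l) (hi, l + 2 / real p)) (tmode i p k)"
    using LINT_ker[OF assms cont] by auto
  have P: "real p > 0" using p by simp
  define F where "F z = sin (pi * real p * z + \<beta>) / (pi * real p)" for z
  have inner: "integral (cbox l (l + 2 / real p)) (\<lambda>z. tmode i p k (y, z)) = 0" for y :: "real^'n"
  proof -
    have "((\<lambda>z. cos (pi * real p * z + \<beta>)) has_integral F (l + 2 / real p) - F l) {l..l + 2 / real p}"
    proof (rule fundamental_theorem_of_calculus)
      fix z :: real
      have "(F has_real_derivative (cos (pi * real p * z + \<beta>) * (pi * real p)) / (pi * real p)) (at z within {l..l + 2 / real p})"
        unfolding F_def[abs_def] by (intro DERIV_cdivide) (auto intro!: derivative_eq_intros)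
      then show "(F has_vector_derivative cos (pi * real p * z + \<beta>)) (at z within {l..l + 2 / real p})"
        using P by (simp add: has_real_derivative_iff_has_vector_derivative)
    qed (use P in simp)
    moreover have "F (l + 2 / real p) = F l"
    proof -
      have "pi * real p * (l + 2 / real p) + \<beta> = (pi * real p * l + \<beta>) + 2 * pi"
        using P by (simp add: distrib_left)
      then show ?thesis unfolding F_def by (simp only: sin_periodic)
    qed
    ultimately have "((\<lambda>z. cos (pi * real p * z + \<beta>)) has_integral 0) {l..l + 2 / real p}" by simp
    from has_integral_mult_right[OF this, of "cos (2 * pi * y $ i)"]
    show ?thesis
      unfolding tmode_def wave_def \<beta>_def[symmetric] by (intro integral_unique) simp
  qed
  have "integral (cbox (lo, l) (hi, l + 2 / real p)) (tmode i p k) =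
      integral (cbox lo hi) (\<lambda>y. integral (cbox l (l + 2 / real p)) (\<lambda>z. tmode i p k (y, z)))"
    by (rule integral_prod_continuous[OF continuous_on_subset[OF cont]]) simp
  then show ?thesis using eq inner by simp
qed

lemma AE_OmegaM_interior:
  "AE y in (OmegaM :: ('n::finite) pt measure). fst y \<in> cell \<and> \<bar>snd y\<bar> < 1"
  using AE_OmegaM_snd AE_space
  by eventually_elim (auto simp: space_OmegaM)

interpretation OO: pair_sigma_finite "OmegaM :: ('n::finite) pt measure" "OmegaM :: 'n pt measure" ..

text \<open>The cell averages of \<open>g\<close> are orthogonal to the mode, since the mode has mean zero on each cell;
  the Cauchy-Schwarz inequality is used first on a cell, then on the strip.\<close>

lemma cell_differences_lower_bound:
  fixes g :: "('n::finite) pt \<Rightarrow> real"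
  assumes g: "g \<in> L2" and p: "p \<ge> 1"
  shows "ennreal (cellvol TYPE('n) p / 2 * (LINT x|OmegaM. g x * tmode i p k x)\<^sup>2) \<le>
    (\<integral>\<^sup>+ x. \<integral>\<^sup>+ y. ennreal (ker p x y * (g x - g y)\<^sup>2) \<partial>OmegaM \<partial>OmegaM)"
proof -
  define V where "V = cellvol TYPE('n) p"
  have V: "V > 0" using p by (simp add: V_def cellvol_def)
  let ?T = "tmode i p k :: 'n pt \<Rightarrow> real"
  have sT: "smooth ?T" by (rule smooth_stripD[OF tmode_strip])
  note TL = smooth_L2[OF sT]
  define A where "A x = (LINT y|OmegaM. ker p x y * g y)" for x
  define h where "h x = (LINT y|OmegaM. ker p x y * (g x - g y)\<^sup>2)" for x
  have gm: "g \<in> borel_measurable OmegaM" by (rule L2D(1)[OF g])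
  have mA: "A \<in> borel_measurable OmegaM"
    unfolding A_def[abs_def]
  proof (rule OmegaM.borel_measurable_lebesgue_integral)
    show "(\<lambda>(x, y). ker p x y * g y) \<in> borel_measurable (OmegaM \<Otimes>\<^sub>M OmegaM)"
      using borel_measurable_times[OF measurable_ker measurable_compose[OF measurable_snd gm]]
      by (simp add: split_beta)
  qed
  have AL: "A \<in> L2"
  proof (rule L2_bounded[OF mA])
    fix x
    have "\<bar>A x\<bar> \<le> (LINT y|OmegaM. \<bar>ker p x y * g y\<bar>)"
      unfolding A_def by (rule integral_abs_bound)
    also have "\<dots> \<le> (LINT y|OmegaM. \<bar>g y\<bar>)"
    proof (rule integral_mono)
      show "integrable OmegaM (\<lambda>y. \<bar>ker p x y * g y\<bar>)"
        by (intro integrable_abs L2_mult_integrable ker_L2 g)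
      show "integrable OmegaM (\<lambda>y. \<bar>g y\<bar>)"
        by (intro integrable_abs L2_integrable g)
      show "\<bar>ker p x y * g y\<bar> \<le> \<bar>g y\<bar>" for y
        by (simp add: ker_def)
    qed
    finally show "\<bar>A x\<bar> \<le> (LINT y|OmegaM. \<bar>g y\<bar>)" .
  qed
  \<comment> \<open>Fubini moves the kernel from g to the mode, whose integral over the cell of y is
    0.\<close>
  have orth: "(LINT x|OmegaM. A x * ?T x) = 0"
  proof -
    define f where "f x y = ker p x y * g y * ?T x" for x y
    have fm: "case_prod f \<in> borel_measurable (OmegaM \<Otimes>\<^sub>M OmegaM)"
      using borel_measurable_times[OF borel_measurable_times[OF measurable_ker measurable_compose[OF measurable_snd gm]]
          measurable_compose[OF measurable_fst smooth_measurable_OmegaM[OF sT]]]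
      by (simp add: split_beta f_def[abs_def])
    have fb: "\<bar>f x y\<bar> \<le> \<bar>g y\<bar>" for x y
    proof -
      have "\<bar>ker p x y\<bar> * \<bar>g y\<bar> * \<bar>?T x\<bar> \<le> 1 * \<bar>g y\<bar> * 1"
        by (intro mult_mono tmode_le_1) (auto simp: ker_def)
      then show ?thesis by (simp add: f_def abs_mult)
    qed
    have f1: "integrable OmegaM (\<lambda>y. f x y)" for x
      unfolding f_def by (intro integrable_mult_left L2_mult_integrable ker_L2 g)
    have int: "integrable (OmegaM \<Otimes>\<^sub>M OmegaM) (case_prod f)"
    proof (rule OO.Fubini_integrable[OF fm])
      show "AE x in OmegaM. integrable OmegaM (\<lambda>y. case_prod f (x, y))" using f1 by simp
      show "integrable OmegaM (\<lambda>x. LINT y|OmegaM. norm (case_prod f (x, y)))"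
      proof (rule OmegaM.integrable_const_bound)
        show "AE x in OmegaM. norm (LINT y|OmegaM. norm (case_prod f (x, y))) \<le> (LINT y|OmegaM. \<bar>g y\<bar>)"
        proof (rule AE_I2)
          fix x
          have "(LINT y|OmegaM. \<bar>f x y\<bar>) \<le> (LINT y|OmegaM. \<bar>g y\<bar>)"
            by (intro integral_mono integrable_abs f1 L2_integrable g fb)
          then show "norm (LINT y|OmegaM. norm (case_prod f (x, y))) \<le> (LINT y|OmegaM. \<bar>g y\<bar>)"
            by simp
        qed
        show "(\<lambda>x. LINT y|OmegaM. norm (case_prod f (x, y))) \<in> borel_measurable OmegaM"
          using measurable_compose[OF fm borel_measurable_norm]
          by (intro OmegaM.borel_measurable_lebesgue_integral) (simp add: split_beta)
      qed
    qed
    have "(LINT x|OmegaM. A x * ?T x) = (LINT x|OmegaM. LINT y|OmegaM. f x y)"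
      unfolding A_def f_def by (simp only: integral_mult_left_zero)
    also have "\<dots> = (LINT y|OmegaM. LINT x|OmegaM. f x y)"
      by (rule OO.Fubini_integral[OF int, symmetric])
    also have "\<dots> = (LINT y|(OmegaM :: 'n pt measure). 0)"
    proof (rule integral_cong_AE)
      show "(\<lambda>y. LINT x|OmegaM. f x y) \<in> borel_measurable OmegaM"
        by (rule borel_measurable_integrable[OF OO.integrable_snd[OF int]])
      show "AE y in OmegaM. (LINT x|OmegaM. f x y) = 0"
        using AE_OmegaM_interior
      proof eventually_elim
        case (elim y)
        have "f x y = g y * (ker p x y * ?T x)" for x by (simp add: f_def)
        then show ?case using LINT_ker_tmode[OF p, of y i k] elim by simp
      qed
    qed simp
    finally show ?thesis by simp
  qed
  have i1: "integrable OmegaM (\<lambda>y. ker p x y * (g x - g y)\<^sup>2)" for x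
  proof -
    have d: "(\<lambda>y. g x - g y) \<in> L2" by (intro L2_diff L2_const g)
    show ?thesis
    proof (rule Bochner_Integration.integrable_bound[OF L2D(2)[OF d]])
      show "(\<lambda>y. ker p x y * (g x - g y)\<^sup>2) \<in> borel_measurable OmegaM"
        by (intro borel_measurable_times measurable_ker_snd borel_measurable_power L2D(1)[OF d])
      show "AE y in OmegaM. norm (ker p x y * (g x - g y)\<^sup>2) \<le> norm ((g x - g y)\<^sup>2)"
        by (auto simp: ker_def)
    qed
  qed
  \<comment> \<open>The quantity squared on the left is the integral over y of the kernel times g x
    - g y. As the kernel equals its own square, Cauchy-Schwarz costs only the cell volume V.\<close>
  have CS1: "(V * g x - A x)\<^sup>2 \<le> V * h x" if x: "fst x \<in> cell" "\<bar>snd x\<bar> < 1" for x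
  proof -
    have d: "(\<lambda>y. g x - g y) \<in> L2" by (intro L2_diff L2_const g)
    have kd: "(\<lambda>y. ker p x y * (g x - g y)) \<in> L2"
      unfolding L2_def mem_Collect_eq
    proof
      show "(\<lambda>y. ker p x y * (g x - g y)) \<in> borel_measurable OmegaM"
        by (intro borel_measurable_times measurable_ker_snd L2D(1)[OF d])
      have "(ker p x y * (g x - g y))\<^sup>2 = ker p x y * (g x - g y)\<^sup>2" for y
        by (simp add: ker_def)
      then show "integrable OmegaM (\<lambda>y. (ker p x y * (g x - g y))\<^sup>2)" using i1 by simp
    qed
    have k1: "(LINT y|OmegaM. ker p x y) = V"
      using LINT_ker_1[OF p x] by (simp add: ker_commute[of p x] V_def)
    have "(LINT y|OmegaM. ker p x y * (ker p x y * (g x - g y))) = V * g x - A x"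
    proof -
      have "ker p x y * (ker p x y * (g x - g y)) = ker p x y * g x - ker p x y * g y" for y
        by (simp add: ker_def)
      then have "(LINT y|OmegaM. ker p x y * (ker p x y * (g x - g y))) = (LINT y|OmegaM. ker p x y * g x - ker p x y * g y)"
        by (simp only:)
      also have "\<dots> = (LINT y|OmegaM. ker p x y * g x) - (LINT y|OmegaM. ker p x y * g y)"
        by (intro Bochner_Integration.integral_diff integrable_mult_left L2_mult_integrable L2_integrable ker_L2 g)
      finally show ?thesis using k1 by (simp add: A_def)
    qed
    moreover have "(LINT y|OmegaM. (ker p x y)\<^sup>2) = V"
      using k1 by (simp add: power2_eq_square ker_bounds(3))
    moreover have "(LINT y|OmegaM. (ker p x y * (g x - g y))\<^sup>2) = h x"
    proof -
      have "(ker p x y * (g x - g y))\<^sup>2 = ker p x y * (g x - g y)\<^sup>2" for y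
        by (simp add: ker_def)
      then show ?thesis by (simp add: h_def)
    qed
    ultimately show ?thesis using L2_Cauchy_Schwarz[OF ker_L2 kd, of p x] by simp
  qed
  \<comment> \<open>V times the deviation of g from its cell average. In the pairing with the mode
    the average drops out, and V times the pairing of g remains.\<close>
  define w where "w x = V * g x - A x" for x
  have wL: "w \<in> L2" unfolding w_def[abs_def] by (intro L2_diff L2_cmult g AL)
  have "(LINT x|OmegaM. w x * ?T x) = V * (LINT x|OmegaM. g x * ?T x)"
    unfolding w_def using L2_mult_integrable[OF g TL] L2_mult_integrable[OF AL TL] orth
    by (simp add: left_diff_distrib mult.assoc)
  then have "(V * (LINT x|OmegaM. g x * ?T x))\<^sup>2 \<le> (LINT x|OmegaM. (w x)\<^sup>2) * (LINT x|OmegaM. (?T x)\<^sup>2)"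
    using L2_Cauchy_Schwarz[OF wL TL] by simp
  also have "\<dots> \<le> (LINT x|OmegaM. (w x)\<^sup>2) * 2"
    by (rule mult_left_mono[OF LINT_tmode_square]) simp
  finally have CS2: "V * (LINT x|OmegaM. g x * ?T x)\<^sup>2 * V \<le> 2 * (LINT x|OmegaM. (w x)\<^sup>2)"
    by (simp add: power2_eq_square mult_ac)
  then have "V / 2 * (LINT x|OmegaM. g x * ?T x)\<^sup>2 \<le> (LINT x|OmegaM. (w x)\<^sup>2 / V)"
    using V by (simp add: field_simps)
  then have "ennreal (V / 2 * (LINT x|OmegaM. g x * ?T x)\<^sup>2) \<le> ennreal (LINT x|OmegaM. (w x)\<^sup>2 / V)"
    by (rule ennreal_leI)
  also have "\<dots> = (\<integral>\<^sup>+ x. ennreal ((w x)\<^sup>2 / V) \<partial>OmegaM)"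
    using L2D(2)[OF wL] V by (intro nn_integral_eq_integral[symmetric]) auto
  also have "\<dots> \<le> (\<integral>\<^sup>+ x. \<integral>\<^sup>+ y. ennreal (ker p x y * (g x - g y)\<^sup>2) \<partial>OmegaM \<partial>OmegaM)"
  proof (rule nn_integral_mono_AE)
    show "AE x in OmegaM. ennreal ((w x)\<^sup>2 / V) \<le> (\<integral>\<^sup>+ y. ennreal (ker p x y * (g x - g y)\<^sup>2) \<partial>OmegaM)"
      using AE_OmegaM_interior
    proof eventually_elim
      case (elim x)
      have "(w x)\<^sup>2 / V \<le> h x"
        using CS1[of x] elim V by (simp add: w_def pos_divide_le_eq mult.commute)
      then have "ennreal ((w x)\<^sup>2 / V) \<le> ennreal (h x)" by (rule ennreal_leI)
      also have "ennreal (h x) = (\<integral>\<^sup>+ y. ennreal (ker p x y * (g x - g y)\<^sup>2) \<partial>OmegaM)"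
        unfolding h_def
        by (intro nn_integral_eq_integral[symmetric] i1 AE_I2 mult_nonneg_nonneg ker_bounds zero_le_power2)
      finally show ?case .
    qed
  qed
  finally show ?thesis unfolding V_def .
qed

text \<open>The upper bound takes the zero translation in the infimum. For positivity, a nonzero
  integer vector leaves some coordinate of the difference at least 1 - 1/p >= 1/2 in size.
  Positivity matters because division by 0 would make the Gagliardo integrand 0.\<close>

lemma strip_dist_bounds:
  fixes x y :: "('n::finite) pt"
  assumes p: "p \<ge> 2" and s: "same_cell p x y" and ne: "x \<noteq> y"
  shows "0 < strip_dist x y" "strip_dist x y \<le> (real CARD('n) + 2) / real p"
proof -
  let ?N = "\<lambda>k :: int^'n. norm (fst x - fst y + (\<chi> i. real_of_int (k $ i)), snd x - snd y)"
  have P: "real p > 0" using p by simp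
  have d: "\<bar>fst x $ j - fst y $ j\<bar> < 1 / real p" for j
  proof -
    have "\<lfloor>real p * fst x $ j\<rfloor> = \<lfloor>real p * fst y $ j\<rfloor>" using s by (simp add: same_cell_def)
    then have "\<bar>real p * fst x $ j - real p * fst y $ j\<bar> < 1" by linarith
    then have "real p * \<bar>fst x $ j - fst y $ j\<bar> < 1"
      by (simp add: right_diff_distrib[symmetric] abs_mult)
    then show ?thesis using P by (simp add: pos_less_divide_eq mult.commute)
  qed
  have dz: "\<bar>snd x - snd y\<bar> < 2 / real p"
  proof -
    have "\<lfloor>real p * (snd x + 1) / 2\<rfloor> = \<lfloor>real p * (snd y + 1) / 2\<rfloor>" using s by (simp add: same_cell_def)
    then have "\<bar>real p * (snd x + 1) / 2 - real p * (snd y + 1) / 2\<bar> < 1" by linarith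
    moreover have "real p * (snd x + 1) / 2 - real p * (snd y + 1) / 2 = real p / 2 * (snd x - snd y)"
      by (simp add: field_simps)
    ultimately have "real p / 2 * \<bar>snd x - snd y\<bar> < 1" by (simp add: abs_mult)
    then show ?thesis using P by (simp add: field_simps)
  qed
  have bdd: "bdd_below (range ?N)" by (rule bdd_belowI[of _ 0]) auto
  have "strip_dist x y \<le> ?N 0"
    unfolding strip_dist_def by (rule cINF_lower[OF bdd]) simp
  also have "?N 0 \<le> norm (fst x - fst y) + norm (snd x - snd y)"
    using norm_Pair_le[of "fst x - fst y" "snd x - snd y"] by (simp add: zero_vec_def[symmetric])
  also have "\<dots> \<le> (\<Sum>j\<in>(UNIV :: 'n set). 1 / real p) + 2 / real p"
  proof (rule add_mono)
    show "norm (fst x - fst y) \<le> (\<Sum>j\<in>(UNIV :: 'n set). 1 / real p)"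
      by (rule order_trans[OF norm_le_l1_cart sum_mono]) (use less_imp_le[OF d] in simp)
    show "norm (snd x - snd y) \<le> 2 / real p" using dz by simp
  qed
  also have "\<dots> = (real CARD('n) + 2) / real p"
    by (simp add: add_divide_distrib)
  finally show "strip_dist x y \<le> (real CARD('n) + 2) / real p" .
  have "min (norm (x - y)) (1 / 2) \<le> strip_dist x y"
    unfolding strip_dist_def
  proof (rule cINF_greatest)
    fix k :: "int^'n"
    show "min (norm (x - y)) (1 / 2) \<le> ?N k"
    proof (cases "k = 0")
      case True
      then have "?N k = norm (x - y)"
        by (cases x; cases y) (simp add: zero_vec_def[symmetric])
      then show ?thesis by simp
    next
      case False
      then obtain j where j: "k $ j \<noteq> 0" by (auto simp: vec_eq_iff)
      have "1 \<le> \<bar>real_of_int (k $ j)\<bar>" using j by linarith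
      moreover have "1 / real p \<le> 1 / 2" using p by (simp add: field_simps)
      ultimately have "1 / 2 \<le> \<bar>fst x $ j - fst y $ j + real_of_int (k $ j)\<bar>"
        using d[of j] by linarith
      then have "1 / 2 \<le> \<bar>(fst x - fst y + (\<chi> i. real_of_int (k $ i))) $ j\<bar>"
        by simp
      also have "\<dots> \<le> norm (fst x - fst y + (\<chi> i. real_of_int (k $ i)))"
        by (rule component_le_norm_cart)
      also have "\<dots> \<le> ?N k" by (rule norm_fst_le)
      finally show ?thesis by simp
    qed
  qed simp
  moreover have "0 < min (norm (x - y)) (1 / 2)" using ne by simp
  ultimately show "0 < strip_dist x y" by linarith
qed

text \<open>Only pairs in a common cell are kept. Their distance is at most (d + 1)/p in dimension d
  = \<open>CARD('n) + 1\<close>, so the singular weight is at least a constant times p^(d + 2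
  sigma); the cell volume takes back p^d.\<close>

lemma gagliardo_lower_bound:
  fixes g :: "('n::finite) pt \<Rightarrow> real"
  assumes g: "g \<in> L2" and p: "p \<ge> 2" and \<sigma>: "\<sigma> > 0"
  shows "ennreal ((real CARD('n) + 2) powr (- (real CARD('n) + 1 + 2 * \<sigma>)) * real p powr (2 * \<sigma>)
      * (LINT x|OmegaM. g x * tmode i p k x)\<^sup>2) \<le> gagliardo_sq \<sigma> g"
proof -
  let ?I = "LINT x|OmegaM. g x * tmode i p k x"
  define C where "C = real CARD('n) + 2"
  define e where "e = real CARD('n) + 1 + 2 * \<sigma>"
  have P: "real p > 0" and C: "C > 0" using p by (auto simp: C_def)
  have De: "real DIM('n pt) + 2 * \<sigma> = e" by (simp add: e_def)
  define \<delta> where "\<delta> = (C / real p) powr e"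
  have \<delta>: "\<delta> > 0" using P C by (simp add: \<delta>_def)
  have \<delta>V: "cellvol TYPE('n) p / 2 / \<delta> = C powr (- e) * real p powr (2 * \<sigma>)"
  proof -
    have "real p powr (real CARD('n) + 1) = real p ^ CARD('n) * real p"
      using P by (simp add: powr_add powr_realpow)
    moreover have "cellvol TYPE('n) p / 2 = 1 / (real p ^ CARD('n) * real p)"
      by (simp add: cellvol_def power_divide mult.commute)
    ultimately have "cellvol TYPE('n) p / 2 = real p powr (- (real CARD('n) + 1))"
      unfolding powr_minus_divide by simp
    moreover have "1 / \<delta> = C powr (- e) * real p powr e"
      unfolding \<delta>_def powr_minus_divide using P C by (subst powr_divide) auto
    moreover have "cellvol TYPE('n) p / 2 / \<delta> = cellvol TYPE('n) p / 2 * (1 / \<delta>)" by simp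
    ultimately have "cellvol TYPE('n) p / 2 / \<delta> = C powr (- e) * (real p powr (- (real CARD('n) + 1)) * real p powr e)"
      by (simp only: mult_ac)
    then show ?thesis by (simp add: powr_add[symmetric] e_def)
  qed
  have pt: "ennreal (1 / \<delta>) * ennreal (ker p x y * (g x - g y)\<^sup>2) \<le> ennreal ((g x - g y)\<^sup>2 / strip_dist x y powr (real DIM('n pt) + 2 * \<sigma>))"
    for x y :: "'n pt"
  proof (cases "same_cell p x y \<and> x \<noteq> y")
    case True
    note sd = strip_dist_bounds[OF p conjunct1[OF True] conjunct2[OF True]]
    have "strip_dist x y powr e \<le> \<delta>"
      unfolding \<delta>_def using sd \<sigma> by (intro powr_mono2) (auto simp: C_def e_def)
    then have "(g x - g y)\<^sup>2 / \<delta> \<le> (g x - g y)\<^sup>2 / strip_dist x y powr e"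
      using sd(1) by (intro divide_left_mono) (auto intro!: mult_pos_pos simp: \<delta>)
    then show ?thesis
      using True \<delta> unfolding De by (simp add: ker_def ennreal_mult[symmetric] ennreal_leI)
  next
    case False
    then have z: "ker p x y * (g x - g y)\<^sup>2 = 0" by (auto simp: ker_def)
    show ?thesis unfolding z by simp
  qed
  have "ennreal (C powr (- e) * real p powr (2 * \<sigma>) * ?I\<^sup>2) = ennreal (1 / \<delta>) * ennreal (cellvol TYPE('n) p / 2 * ?I\<^sup>2)"
    unfolding \<delta>V[symmetric] using \<delta> by (simp add: ennreal_mult'[symmetric] cellvol_def)
  also have "\<dots> \<le> ennreal (1 / \<delta>) * (\<integral>\<^sup>+ x. \<integral>\<^sup>+ y. ennreal (ker p x y * (g x - g y)\<^sup>2) \<partial>OmegaM \<partial>OmegaM)"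
    by (intro mult_left_mono cell_differences_lower_bound g) (use p in auto)
  also have "\<dots> = (\<integral>\<^sup>+ x. \<integral>\<^sup>+ y. ennreal (1 / \<delta>) * ennreal (ker p x y * (g x - g y)\<^sup>2) \<partial>OmegaM \<partial>OmegaM)"
  proof -
    have gm: "g \<in> borel_measurable OmegaM" by (rule L2D(1)[OF g])
    have m: "(\<lambda>z. ennreal (ker p (fst z) (snd z) * (g (fst z) - g (snd z))\<^sup>2)) \<in> borel_measurable (OmegaM \<Otimes>\<^sub>M OmegaM)"
      using measurable_ker[of p, where 'n = 'n] measurable_compose[OF measurable_fst gm] measurable_compose[OF measurable_snd gm]
      by (intro measurable_compose[OF _ measurable_ennreal] borel_measurable_times borel_measurable_power borel_measurable_diff)
        (simp_all add: split_beta)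
    have m1: "(\<lambda>y. ennreal (ker p x y * (g x - g y)\<^sup>2)) \<in> borel_measurable OmegaM" for x
      by (intro measurable_compose[OF _ measurable_ennreal] borel_measurable_times borel_measurable_power
          borel_measurable_diff gm measurable_ker_snd borel_measurable_const)
    have m2: "(\<lambda>x. \<integral>\<^sup>+ y. ennreal (ker p x y * (g x - g y)\<^sup>2) \<partial>OmegaM) \<in> borel_measurable OmegaM"
      using OmegaM.borel_measurable_nn_integral_fst[OF m] by simp
    show ?thesis
      by (simp only: nn_integral_cmult[OF m1] nn_integral_cmult[OF m2])
  qed
  also have "\<dots> \<le> gagliardo_sq \<sigma> g"
    unfolding gagliardo_sq_def by (intro nn_integral_mono pt)
  finally show ?thesis unfolding C_def e_def .
qed


section \<open>Sobolev norms bounded below by a single mode\<close>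

lemma ennreal_le_of_square:
  assumes "ennreal (x\<^sup>2) \<le> H\<^sup>2" "0 \<le> x"
  shows "ennreal x \<le> H"
proof (cases H)
  case (real r)
  then have r: "0 \<le> r" "H = ennreal r" by auto
  have "ennreal (x\<^sup>2) \<le> ennreal (r\<^sup>2)"
    using assms(1) r(1) unfolding r(2) by (simp only: ennreal_power)
  then have "x\<^sup>2 \<le> r\<^sup>2" using ennreal_le_iff[of "r\<^sup>2" "x\<^sup>2"] by simp
  then have "x \<le> r" by (rule power2_le_imp_le) (rule r(1))
  then show ?thesis unfolding r(2) by (rule ennreal_leI)
qed simp

lemma Hnorm_ge_gagliardo:
  assumes "f \<in> sobolev (nat \<lfloor>s\<rfloor>)" "s \<noteq> real (nat \<lfloor>s\<rfloor>)" "set bs \<subseteq> Basis" "length bs = nat \<lfloor>s\<rfloor>"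
  shows "gagliardo_sq (s - real (nat \<lfloor>s\<rfloor>)) (weak_deriv bs f) \<le> (Hnorm s f)\<^sup>2"
proof -
  let ?A = "{bs :: 'a pt list. set bs \<subseteq> Basis \<and> length bs = nat \<lfloor>s\<rfloor>}"
  let ?S = "\<Sum>bs\<in>?A. gagliardo_sq (s - real (nat \<lfloor>s\<rfloor>)) (weak_deriv bs f)"
  have "finite ?A" by (rule finite_subset[OF _ finite_direction_lists[of "nat \<lfloor>s\<rfloor>"]]) auto
  then have 1: "gagliardo_sq (s - real (nat \<lfloor>s\<rfloor>)) (weak_deriv bs f) \<le> ?S"
    using assms(3,4) by (intro member_le_sum) auto
  have ne: "s - real (nat \<lfloor>s\<rfloor>) \<noteq> 0" using assms(2) by simp
  have "esqrt ?S \<le> Hnorm s f"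
    unfolding Hnorm_def Let_def if_P[OF assms(1)] if_not_P[OF ne] by (intro esqrt_mono) simp
  then have "?S \<le> (Hnorm s f)\<^sup>2"
    using le_esqrt_square[of ?S] by (meson order_trans power_mono zero_le)
  with 1 show ?thesis by (rule order_trans)
qed

text \<open>For s = k + sigma, integration by parts gains p^k and the Gagliardo bound gains p^sigma.
  The constant depends neither on p nor on the function, and the pairing is that of f even when
  \<open>F\<close> is the fluctuation. If \<open>F\<close> lies outside the Sobolev space of order
  k, the norm is infinite.\<close>

lemma Hnorm_mode_lower_bound:
  assumes "0 \<le> s" "s \<le> real m"
  shows "\<exists>c>0. \<forall>p\<ge>2. \<forall>f\<in>X_space m. \<forall>F. F = f \<or> F = fluctuation f \<longrightarrow>
    ennreal (c * real p powr s * \<bar>LINT x|OmegaM. f x * mode i p x\<bar>) \<le> Hnorm s (F :: ('n::finite) pt \<Rightarrow> real)"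
proof -
  define k where "k = nat \<lfloor>s\<rfloor>"
  define \<sigma> where "\<sigma> = s - real k"
  have k: "k \<le> m" "0 \<le> \<sigma>" using assms by (auto simp: k_def \<sigma>_def le_floor_iff nat_le_iff floor_le_iff)
  define K where "K = (real CARD('n) + 2) powr (- (real CARD('n) + 1 + 2 * \<sigma>))"
  \<comment> \<open>For sigma = 0 the squared norm of \<open>tmode\<close> is at most 2, so |I| is
    at most twice the norm of G and 1/2 suffices. Otherwise the square root undoes the square in the
    Gagliardo bound.\<close>
  define c where "c = (if \<sigma> = 0 then 1 / 2 else sqrt K)"
  have K: "K > 0" by (simp add: K_def)
  have c: "c > 0" using K by (simp add: c_def)
  have "ennreal (c * real p powr s * \<bar>LINT x|OmegaM. f x * mode i p x\<bar>) \<le> Hnorm s F"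
    if p: "p \<ge> 2" and f: "f \<in> X_space m" and F: "F = f \<or> F = fluctuation f" for p f and F :: "'n pt \<Rightarrow> real"
  proof (cases "F \<in> sobolev k")
    case False
    then have "Hnorm s F = \<infinity>" unfolding Hnorm_def Let_def k_def by simp
    then show ?thesis by simp
  next
    case True
    let ?bs = "replicate k (0, 1) :: 'n pt list"
    define G where "G = weak_deriv ?bs F"
    have bs: "set ?bs \<subseteq> Basis" "length ?bs = k" using vertical_in_Basis by (auto simp: set_replicate_conv_if)
    have FL: "F \<in> L2" using True by (simp add: sobolev_def)
    have G: "has_weak_deriv ?bs F G"
      using True bs has_weak_deriv_weak_deriv unfolding G_def sobolev_def by fastforce
    then have GL: "G \<in> L2" by (simp add: has_weak_deriv_def)
    define J where "J = (LINT x|OmegaM. f x * mode i p x)"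
    define I where "I = (LINT x|OmegaM. G x * tmode i p k x)"
    have I: "I = (pi * real p) ^ k * J"
      using F
    proof
      assume "F = f"
      then show ?thesis using LINT_tmode[OF f _ k(1), of G i p] G by (simp add: I_def J_def)
    next
      assume "F = fluctuation f"
      then show ?thesis using LINT_tmode_fluctuation[OF f _ k(1), of G i p] G FL by (simp add: I_def J_def)
    qed
    have P: "real p > 0" using p by simp
    have "real p ^ k * \<bar>J\<bar> \<le> (pi * real p) ^ k * \<bar>J\<bar>"
      using pi_ge_two P by (intro mult_right_mono power_mono) auto
    then have I2: "real p ^ k * \<bar>J\<bar> \<le> \<bar>I\<bar>" by (simp add: I abs_mult)
    show ?thesis
    proof (cases "\<sigma> = 0")
      case True
      have "I\<^sup>2 \<le> (LINT x|OmegaM. (G x)\<^sup>2) * (LINT x|OmegaM. (tmode i p k x)\<^sup>2)"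
        unfolding I_def by (rule L2_Cauchy_Schwarz[OF GL smooth_L2[OF smooth_stripD[OF tmode_strip]]])
      also have "\<dots> \<le> (LINT x|OmegaM. (G x)\<^sup>2) * 2"
        by (rule mult_left_mono[OF LINT_tmode_square]) simp
      finally have "I\<^sup>2 \<le> (LINT x|OmegaM. (G x)\<^sup>2) * 2" .
      moreover have "0 \<le> (LINT x|OmegaM. (G x)\<^sup>2)" by simp
      moreover have "(\<bar>I\<bar> / 2)\<^sup>2 = I\<^sup>2 / 4" by (simp add: power_divide)
      ultimately have "(\<bar>I\<bar> / 2)\<^sup>2 \<le> (LINT x|OmegaM. (G x)\<^sup>2)" by linarith
      then have "ennreal ((\<bar>I\<bar> / 2)\<^sup>2) \<le> (\<integral>\<^sup>+ x. ennreal ((G x)\<^sup>2) \<partial>OmegaM)"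
        unfolding nn_integral_square_L2[OF GL] by (rule ennreal_leI)
      also have "\<dots> \<le> (Hnorm s F)\<^sup>2"
        using bs by (intro Hnorm_ge_weak_deriv[OF G]) (auto simp: k_def)
      finally have "ennreal (\<bar>I\<bar> / 2) \<le> Hnorm s F"
        by (rule ennreal_le_of_square) simp
      moreover have "c * real p powr s * \<bar>J\<bar> \<le> \<bar>I\<bar> / 2"
        using I2 True P by (simp add: c_def \<sigma>_def powr_realpow)
      ultimately show ?thesis unfolding J_def by (meson ennreal_leI order_trans)
    next
      case False
      then have \<sigma>: "\<sigma> > 0" using k(2) by simp
      have "ennreal ((sqrt K * real p powr \<sigma> * \<bar>I\<bar>)\<^sup>2) = ennreal (K * real p powr (2 * \<sigma>) * I\<^sup>2)"
      proof -
        have "(real p powr \<sigma>)\<^sup>2 = real p powr (2 * \<sigma>)"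
          by (simp add: power2_eq_square powr_add[symmetric])
        then show ?thesis using K by (simp add: power_mult_distrib)
      qed
      also have "\<dots> \<le> gagliardo_sq \<sigma> G"
        unfolding K_def I_def by (rule gagliardo_lower_bound[OF GL p \<sigma>])
      also have "\<dots> \<le> (Hnorm s F)\<^sup>2"
        using Hnorm_ge_gagliardo[of F s ?bs] \<open>F \<in> sobolev k\<close> False bs
        by (simp add: G_def k_def \<sigma>_def)
      finally have "ennreal (sqrt K * real p powr \<sigma> * \<bar>I\<bar>) \<le> Hnorm s F"
        by (rule ennreal_le_of_square) (use K in simp)
      moreover have "c * real p powr s * \<bar>J\<bar> \<le> sqrt K * real p powr \<sigma> * \<bar>I\<bar>"
      proof -
        have "real p powr s = real p powr \<sigma> * real p ^ k"
          using P by (simp add: \<sigma>_def powr_realpow[symmetric] powr_add[symmetric])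
        then have "c * real p powr s * \<bar>J\<bar> = sqrt K * real p powr \<sigma> * (real p ^ k * \<bar>J\<bar>)"
          using False by (simp add: c_def)
        also have "\<dots> \<le> sqrt K * real p powr \<sigma> * \<bar>I\<bar>"
          using K by (intro mult_left_mono I2) auto
        finally show ?thesis .
      qed
      ultimately show ?thesis unfolding J_def by (meson ennreal_leI order_trans)
    qed
  qed
  then show ?thesis using c by blast
qed

section \<open>The linear system at a single frequency\<close>

text \<open>The product with the integrating factor exp (mu t) has zero derivative on the convex set
  of all t >= 0, hence is constant.\<close>

lemma scalar_ode_unique:
  fixes y :: "real \<Rightarrow> 'a::banach"
  assumes "\<And>t. t \<ge> 0 \<Longrightarrow> (y has_vector_derivative - (\<mu> *\<^sub>R y t)) (at t within {0..})" and "t \<ge> 0"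
  shows "y t = exp (- \<mu> * t) *\<^sub>R y 0"
proof -
  have "((\<lambda>t. exp (\<mu> * t) *\<^sub>R y t) has_derivative (\<lambda>h. 0)) (at t within {0..})" if "t \<ge> 0" for t
  proof -
    have "((\<lambda>t. exp (\<mu> * t)) has_real_derivative exp (\<mu> * t) * \<mu>) (at t within {0..})"
      by (auto intro!: derivative_eq_intros)
    from has_vector_derivative_scaleR[OF this assms(1)[OF that]]
    have "((\<lambda>t. exp (\<mu> * t) *\<^sub>R y t) has_vector_derivative 0) (at t within {0..})"
      by simp
    then show ?thesis by (simp add: has_vector_derivative_def)
  qed
  then obtain c where c: "\<And>t. t \<ge> 0 \<Longrightarrow> exp (\<mu> * t) *\<^sub>R y t = c"
    using has_derivative_zero_constant[of "{0..}" "\<lambda>t. exp (\<mu> * t) *\<^sub>R y t"] by auto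
  have "exp (\<mu> * t) *\<^sub>R y t = y 0" using c[of 0] c[OF assms(2)] by simp
  then have "exp (- \<mu> * t) *\<^sub>R (exp (\<mu> * t) *\<^sub>R y t) = exp (- \<mu> * t) *\<^sub>R y 0" by simp
  then show ?thesis by (simp add: exp_add[symmetric])
qed

text \<open>If \<open>l\<close> and \<open>\<mu>\<close> are the eigenvalues, then \<open>V - l \<Theta>\<close> satisfies a scalar equation with rate \<open>\<mu>\<close>.\<close>

lemma system_ode_unique:
  fixes V \<Theta> :: "real \<Rightarrow> complex"
  assumes V: "\<And>t. t \<ge> 0 \<Longrightarrow> (V has_vector_derivative - (of_real (l + \<mu>) * V t - of_real (l * \<mu>) * \<Theta> t)) (at t within {0..})"
    and \<Theta>: "\<And>t. t \<ge> 0 \<Longrightarrow> (\<Theta> has_vector_derivative - V t) (at t within {0..})"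
    and init: "V 0 = of_real l * \<Theta> 0" and t: "t \<ge> 0"
  shows "\<Theta> t = of_real (exp (- l * t)) * \<Theta> 0" "V t = of_real l * \<Theta> t"
proof -
  define y where "y t = V t - of_real l * \<Theta> t" for t
  have "(y has_vector_derivative - (\<mu> *\<^sub>R y t)) (at t within {0..})" if "t \<ge> 0" for t
  proof -
    have "(y has_vector_derivative (- (of_real (l + \<mu>) * V t - of_real (l * \<mu>) * \<Theta> t) - of_real l * (- V t))) (at t within {0..})"
      unfolding y_def[abs_def]
      by (intro has_vector_derivative_diff has_vector_derivative_mult_right V \<Theta> that)
    moreover have "- (of_real (l + \<mu>) * V t - of_real (l * \<mu>) * \<Theta> t) - of_real l * (- V t) = - (\<mu> *\<^sub>R y t)"
      by (simp add: y_def scaleR_conv_of_real algebra_simps)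
    ultimately show ?thesis by simp
  qed
  from scalar_ode_unique[OF this] have y: "y t = 0" if "t \<ge> 0" for t
    using init that by (simp add: y_def)
  then have Vl: "V t = of_real l * \<Theta> t" if "t \<ge> 0" for t using that by (simp add: y_def)
  then show "V t = of_real l * \<Theta> t" using t by simp
  \<comment> \<open>With V = l \<Theta> the second equation decouples and is again scalar, now with
    rate l.\<close>
  have "(\<Theta> has_vector_derivative - (l *\<^sub>R \<Theta> t)) (at t within {0..})" if "t \<ge> 0" for t
    using \<Theta>[OF that] Vl[OF that] by (simp add: scaleR_conv_of_real)
  from scalar_ode_unique[OF this t] show "\<Theta> t = of_real (exp (- l * t)) * \<Theta> 0"
    by (simp add: scaleR_conv_of_real)
qed

text \<open>At the frequencies with \<open>n = \<plusminus>e\<^sub>i\<close> and \<open>q = 2 p\<close>, the matrix has trace \<open>coefA\<close>, determinant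
  \<open>coefB\<close> and eigenvalues \<open>slow\<close> and \<open>fast\<close>.\<close>

definition freq_sq :: "nat \<Rightarrow> real" where
  "freq_sq p = (2 * pi)\<^sup>2 + (pi * real p)\<^sup>2"

lemma norm_eta_axis:
  assumes "n = axis i 1 \<or> n = - axis i (1 :: int)"
  shows "(norm (fst (eta n q)))\<^sup>2 = (2 * pi)\<^sup>2" "(norm (eta n (2 * p)))\<^sup>2 = freq_sq p"
proof -
  have fe: "fst (eta n q) = (2 * pi) *\<^sub>R axis i 1 \<or> fst (eta n q) = - ((2 * pi) *\<^sub>R axis i 1)" for q
    using assms by (auto simp: eta_def vec_eq_iff axis_def)
  have 1: "norm (fst (eta n q)) = 2 * pi" for q
  proof (rule disjE[OF fe[of q]])
    assume e: "fst (eta n q) = (2 * pi) *\<^sub>R axis i 1"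
    show ?thesis unfolding e by simp
  next
    assume e: "fst (eta n q) = - ((2 * pi) *\<^sub>R axis i 1)"
    show ?thesis unfolding e by simp
  qed
  then show "(norm (fst (eta n q)))\<^sup>2 = (2 * pi)\<^sup>2" by simp
  have "(norm (eta n (2 * p)))\<^sup>2 = (norm (fst (eta n (2 * p))))\<^sup>2 + (norm (snd (eta n (2 * p))))\<^sup>2"
    by (cases "eta n (2 * p)") (simp add: norm_Pair)
  also have "\<dots> = freq_sq p" unfolding 1 by (simp add: eta_def freq_sq_def)
  finally show "(norm (eta n (2 * p)))\<^sup>2 = freq_sq p" .
qed

definition coefA :: "nat \<Rightarrow> nat \<Rightarrow> real" where "coefA \<alpha> p = freq_sq p ^ \<alpha>"
definition coefB :: "nat \<Rightarrow> real" where "coefB p = (2 * pi)\<^sup>2 / freq_sq p"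
definition slow :: "nat \<Rightarrow> nat \<Rightarrow> real" where
  "slow \<alpha> p = (coefA \<alpha> p - sqrt ((coefA \<alpha> p)\<^sup>2 - 4 * coefB p)) / 2"
definition fast :: "nat \<Rightarrow> nat \<Rightarrow> real" where
  "fast \<alpha> p = (coefA \<alpha> p + sqrt ((coefA \<alpha> p)\<^sup>2 - 4 * coefB p)) / 2"

lemma M_mat_mult:
  fixes x :: "complex ^ 2"
  assumes "n = axis i 1 \<or> n = - axis i (1 :: int)"
  shows "(M_mat \<alpha> (eta n (2 * p)) *v x) $ 1 = of_real (coefA \<alpha> p) * x $ 1 - of_real (coefB p) * x $ 2"
    "(M_mat \<alpha> (eta n (2 * p)) *v x) $ 2 = x $ 1"
proof -
  have a: "norm (eta n (2 * p)) ^ (2 * \<alpha>) = coefA \<alpha> p"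
    by (simp add: power_mult norm_eta_axis(2)[OF assms] coefA_def)
  have b: "- (norm (fst (eta n (2 * p))))\<^sup>2 / (norm (eta n (2 * p)))\<^sup>2 = - coefB p"
    by (simp add: norm_eta_axis[OF assms] coefB_def)
  show "(M_mat \<alpha> (eta n (2 * p)) *v x) $ 1 = of_real (coefA \<alpha> p) * x $ 1 - of_real (coefB p) * x $ 2"
    unfolding M_mat_def a b by (simp add: matrix_vector_mult_def sum_2)
  show "(M_mat \<alpha> (eta n (2 * p)) *v x) $ 2 = x $ 1"
    by (simp add: M_mat_def matrix_vector_mult_def sum_2)
qed

text \<open>From p >= 4 the vertical frequency is at least twice the horizontal one. The factor 5
  yields 4 \<open>coefB p\<close> <= 1, so the discriminant is nonnegative even when the trace of
  the matrix is 1, the case alpha = 0.\<close>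

lemma freq_sq_bounds:
  assumes "p \<ge> 4"
  shows "(pi * real p)\<^sup>2 \<le> freq_sq p" "freq_sq p \<le> 2 * (pi * real p)\<^sup>2" "5 * (2 * pi)\<^sup>2 \<le> freq_sq p" "1 \<le> freq_sq p"
proof -
  show 1: "(pi * real p)\<^sup>2 \<le> freq_sq p" by (simp add: freq_sq_def)
  have "4 \<le> real p" using assms by simp
  then have "2 * (2 * pi) \<le> pi * real p" by simp
  then have "(2 * (2 * pi))\<^sup>2 \<le> (pi * real p)\<^sup>2" by (intro power_mono) auto
  then have 4: "4 * (2 * pi)\<^sup>2 \<le> (pi * real p)\<^sup>2" by (simp add: power_mult_distrib)
  then show "5 * (2 * pi)\<^sup>2 \<le> freq_sq p" by (simp add: freq_sq_def)
  show "freq_sq p \<le> 2 * (pi * real p)\<^sup>2"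
    unfolding freq_sq_def using 4 zero_le_power2[of "2 * pi"] by linarith
  have "1 \<le> pi * real p" using pi_ge_two \<open>4 \<le> real p\<close> mult_mono[of 1 pi 1 "real p"] by simp
  then have "1 \<le> (pi * real p)\<^sup>2" by (simp add: one_le_power)
  then show "1 \<le> freq_sq p" using 1 by linarith
qed

lemma slow_fast:
  assumes "p \<ge> 4"
  shows "slow \<alpha> p + fast \<alpha> p = coefA \<alpha> p" "slow \<alpha> p * fast \<alpha> p = coefB p"
    "coefB p / coefA \<alpha> p \<le> slow \<alpha> p" "slow \<alpha> p \<le> 2 * coefB p / coefA \<alpha> p" "0 < slow \<alpha> p"
proof -
  note fb = freq_sq_bounds[OF assms]
  define A B where "A = coefA \<alpha> p" "B = coefB p"
  have A: "1 \<le> A" unfolding A_B_def coefA_def using fb(4) by (rule one_le_power)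
  have B: "0 < B" "4 * B \<le> 1"
    using fb(3,4) by (auto simp: A_B_def coefB_def pos_divide_le_eq intro!: divide_pos_pos)
  have "1 \<le> A\<^sup>2" using A by (rule one_le_power)
  then have disc: "0 \<le> A\<^sup>2 - 4 * B" using B by linarith
  define r where "r = sqrt (A\<^sup>2 - 4 * B)"
  have r: "0 \<le> r" "r\<^sup>2 = A\<^sup>2 - 4 * B" using disc by (simp_all add: r_def)
  have rA: "r \<le> A"
    by (rule power2_le_imp_le) (use r B A in auto)
  have sf: "slow \<alpha> p = (A - r) / 2" "fast \<alpha> p = (A + r) / 2"
    by (simp_all add: slow_def fast_def A_B_def r_def)
  show "slow \<alpha> p + fast \<alpha> p = coefA \<alpha> p"
    by (simp add: sf A_B_def[symmetric] field_simps)
  have "(A - r) * (A + r) = 4 * B"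
    using r(2) by (simp add: power2_eq_square algebra_simps)
  then show prod: "slow \<alpha> p * fast \<alpha> p = coefB p"
    by (simp add: sf A_B_def[symmetric])
  have fast: "A / 2 \<le> fast \<alpha> p" "fast \<alpha> p \<le> A" "0 < fast \<alpha> p" using r rA A by (auto simp: sf)
  \<comment> \<open>The slow root is estimated through the product of the roots and A/2 <=
    \<open>fast \<alpha> p\<close> <= A, since its defining formula is a difference of nearly equal
    numbers.\<close>
  have slow: "slow \<alpha> p = B / fast \<alpha> p" using prod fast(3) by (simp add: A_B_def field_simps)
  show "0 < slow \<alpha> p" unfolding slow using B fast by simp
  show "coefB p / coefA \<alpha> p \<le> slow \<alpha> p"
    unfolding slow A_B_def[symmetric] using B fast A by (intro divide_left_mono) auto
  have "B / fast \<alpha> p \<le> B / (A / 2)"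
    using B fast A by (intro divide_left_mono) auto
  then show "slow \<alpha> p \<le> 2 * coefB p / coefA \<alpha> p"
    unfolding slow A_B_def[symmetric] by (simp add: mult.commute)
qed

text \<open>The 8 is 2 (2 pi)^2 / pi^2: the slow root is at most 2 B / A, and freq_sq p^(1+alpha) is
  at least pi^2 p^(2(1+alpha)). The lower constant comes from freq_sq p <= 2 (pi p)^2.\<close>

lemma slow_bounds:
  assumes "p \<ge> 4"
  shows "slow \<alpha> p \<le> 8 / real p ^ (2 * (1 + \<alpha>))"
    "4 * pi\<^sup>2 / (2 * pi\<^sup>2) ^ (1 + \<alpha>) / real p ^ (2 * (1 + \<alpha>)) \<le> slow \<alpha> p"
proof -
  note fb = freq_sq_bounds[OF assms]
  have P: "real p > 0" using assms by simp
  have q: "coefB p / coefA \<alpha> p = 4 * pi\<^sup>2 / freq_sq p ^ (1 + \<alpha>)"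
    by (simp add: coefA_def coefB_def power_mult_distrib)
  have "(pi * real p)\<^sup>2 ^ (1 + \<alpha>) \<le> freq_sq p ^ (1 + \<alpha>)"
    using fb(1) by (intro power_mono) auto
  moreover have "pi\<^sup>2 * real p ^ (2 * (1 + \<alpha>)) \<le> (pi * real p)\<^sup>2 ^ (1 + \<alpha>)"
  proof -
    have "1 \<le> pi\<^sup>2" using pi_ge_two by (intro one_le_power) linarith
    then have "(pi\<^sup>2) ^ 1 \<le> (pi\<^sup>2) ^ (1 + \<alpha>)" by (intro power_increasing) auto
    then have "pi\<^sup>2 * (real p)\<^sup>2 ^ (1 + \<alpha>) \<le> (pi\<^sup>2) ^ (1 + \<alpha>) * (real p)\<^sup>2 ^ (1 + \<alpha>)"
      by (intro mult_right_mono) auto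
    then show ?thesis by (simp only: power_mult power_mult_distrib[symmetric])
  qed
  ultimately have "pi\<^sup>2 * real p ^ (2 * (1 + \<alpha>)) \<le> freq_sq p ^ (1 + \<alpha>)" by linarith
  then have "8 * pi\<^sup>2 / freq_sq p ^ (1 + \<alpha>) \<le> 8 * pi\<^sup>2 / (pi\<^sup>2 * real p ^ (2 * (1 + \<alpha>)))"
    using P fb(4) by (intro divide_left_mono) (auto intro!: mult_pos_pos zero_less_power)
  also have "\<dots> = 8 / real p ^ (2 * (1 + \<alpha>))" by simp
  finally show "slow \<alpha> p \<le> 8 / real p ^ (2 * (1 + \<alpha>))"
  proof (rule order_trans[rotated])
    have "2 * coefB p / coefA \<alpha> p = 2 * (coefB p / coefA \<alpha> p)" by simp
    also have "\<dots> = 8 * pi\<^sup>2 / freq_sq p ^ (1 + \<alpha>)" unfolding q by simp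
    finally show "slow \<alpha> p \<le> 8 * pi\<^sup>2 / freq_sq p ^ (1 + \<alpha>)"
      using slow_fast(4)[OF assms, of \<alpha>] by (simp only:)
  qed
  have "freq_sq p ^ (1 + \<alpha>) \<le> (2 * (pi * real p)\<^sup>2) ^ (1 + \<alpha>)"
    using fb(2,4) by (intro power_mono) auto
  also have "\<dots> = (2 * pi\<^sup>2) ^ (1 + \<alpha>) * real p ^ (2 * (1 + \<alpha>))"
    by (simp only: power_mult power_mult_distrib[symmetric]) (simp only: power_mult_distrib mult.assoc)
  finally have a: "4 * pi\<^sup>2 / ((2 * pi\<^sup>2) ^ (1 + \<alpha>) * real p ^ (2 * (1 + \<alpha>))) \<le> 4 * pi\<^sup>2 / freq_sq p ^ (1 + \<alpha>)"
    using P fb(4) by (intro divide_left_mono) (auto intro!: mult_pos_pos zero_less_power)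
  have "4 * pi\<^sup>2 / freq_sq p ^ (1 + \<alpha>) \<le> slow \<alpha> p"
    using slow_fast(3)[OF assms, of \<alpha>] unfolding q .
  then show "4 * pi\<^sup>2 / (2 * pi\<^sup>2) ^ (1 + \<alpha>) / real p ^ (2 * (1 + \<alpha>)) \<le> slow \<alpha> p"
    unfolding divide_divide_eq_left by (rule order_trans[OF a])
qed


section \<open>Lacunary data\<close>

text \<open>The shift by 2 starts the sequence at 4, where the eigenvalue bounds begin to
  hold.\<close>

definition freq :: "nat \<Rightarrow> nat" where "freq j = 2 ^ (j + 2)"

definition amp :: "nat \<Rightarrow> real \<Rightarrow> nat \<Rightarrow> real" where
  "amp m \<delta> j = real (freq j) powr (- real m - \<delta>)"

definition ser :: "'n \<Rightarrow> (nat \<Rightarrow> real) \<Rightarrow> ('n::finite) pt \<Rightarrow> real" where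
  "ser i a x = (\<Sum>j. wave i (freq j) (a j) 0 (- (pi / 2)) x)"

lemma freq_ge_4: "freq j \<ge> 4"
proof -
  have "(2::nat) ^ 2 \<le> 2 ^ (j + 2)" by (rule power_increasing) auto
  then show ?thesis by (simp add: freq_def)
qed

lemma freq_inj: "freq j = freq k \<longleftrightarrow> j = k"
  by (simp add: freq_def)

lemma freq_pos: "0 < real (freq j)"
  by (simp add: freq_def)

lemma amp_pos: "0 < amp m \<delta> j"
  using freq_pos[of j] by (simp add: amp_def)

lemma amp_mult_power: "amp m \<delta> j * (pi * real (freq j)) ^ m = pi ^ m * (2 powr (- \<delta>)) ^ (j + 2)"
proof -
  have "real (freq j) = 2 powr (real (j + 2))"
    by (simp only: freq_def of_nat_power of_nat_numeral powr_realpow zero_less_numeral)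
  then have "real (freq j) powr (- \<delta>) = (2 powr (- \<delta>)) ^ (j + 2)"
    by (simp only: powr_powr powr_power)
  moreover have "amp m \<delta> j * real (freq j) ^ m = real (freq j) powr (- \<delta>)"
    using freq_pos[of j] by (simp add: amp_def powr_realpow[symmetric] powr_add[symmetric])
  ultimately show ?thesis by (simp add: power_mult_distrib mult.left_commute)
qed

lemma summable_amp:
  assumes "\<delta> > 0"
  shows "summable (\<lambda>j. amp m \<delta> j * (pi * real (freq j)) ^ m)"
proof -
  have "(2::real) powr (- \<delta>) < 1" using assms by (simp add: powr_less_one)
  then have "summable (\<lambda>j. ((2::real) powr (- \<delta>)) ^ j)" by (intro summable_geometric) simp
  from summable_mult[OF summable_ignore_initial_segment[OF this, of 2], of "pi ^ m"]
  show ?thesis unfolding amp_mult_power .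
qed

lemma smooth_series_ser:
  fixes i :: "'n::finite"
  assumes a: "\<And>j. \<bar>a j\<bar> \<le> M * amp m \<delta> j" and \<delta>: "\<delta> > 0"
  shows "smooth_series (\<lambda>j. wave i (freq j) (a j) 0 (- (pi / 2)) :: 'n pt \<Rightarrow> real) m
    (\<lambda>j. M * (amp m \<delta> j * (pi * real (freq j)) ^ m))"
proof
  show "wave i (freq j) (a j) 0 (- (pi / 2)) \<in> smooth_strip" for j by (rule wave_smooth_strip)
  show "summable (\<lambda>j. M * (amp m \<delta> j * (pi * real (freq j)) ^ m))"
    by (intro summable_mult summable_amp \<delta>)
  fix bs :: "'n pt list" and j and x :: "'n pt"
  assume bs: "set bs \<subseteq> Basis" "length bs \<le> m"
  have f: "2 \<le> freq j" using freq_ge_4[of j] by simp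
  have "1 * 1 \<le> pi * real (freq j)"
    using pi_ge_two f by (intro mult_mono) auto
  then have p: "(pi * real (freq j)) ^ length bs \<le> (pi * real (freq j)) ^ m"
    using bs(2) by (intro power_increasing) auto
  have "\<bar>partials bs (wave i (freq j) (a j) 0 (- (pi / 2))) x\<bar> \<le> \<bar>a j\<bar> * (pi * real (freq j)) ^ length bs"
    by (rule partials_wave_bound[OF bs(1) f])
  also have "\<dots> \<le> (M * amp m \<delta> j) * (pi * real (freq j)) ^ m"
    using a[of j] by (intro mult_mono[OF a p]) auto
  finally show "\<bar>partials bs (wave i (freq j) (a j) 0 (- (pi / 2))) x\<bar> \<le> M * (amp m \<delta> j * (pi * real (freq j)) ^ m)"
    by (simp only: mult.assoc)
qed

lemma ser_X_space:
  fixes i :: "'n::finite"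
  assumes a: "\<And>j. \<bar>a j\<bar> \<le> M * amp m \<delta> j" and \<delta>: "\<delta> > 0" and m: "m \<ge> 1"
  shows "ser i a \<in> X_space m"
proof -
  interpret S: smooth_series "\<lambda>j. wave i (freq j) (a j) 0 (- (pi / 2)) :: 'n pt \<Rightarrow> real" m
    "\<lambda>j. M * (amp m \<delta> j * (pi * real (freq j)) ^ m)"
    by (rule smooth_series_ser[OF a \<delta>])
  have D: "ser i a = S.D []" by (simp add: fun_eq_iff ser_def S.D_def)
  have "has_trace (vert_deriv k (ser i a)) (\<lambda>_. 0)" if k: "even k" "k \<le> mstar m" for k
  proof -
    let ?as = "replicate k (0, 1) :: 'n pt list"
    have km: "k < m" using k m by (cases "even m") (auto simp: mstar_def)
    have as: "set ?as \<subseteq> Basis" using vertical_in_Basis by (auto simp: set_replicate_conv_if)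
    have wd: "has_weak_deriv ?as (S.D []) (S.D ?as)"
      using S.has_weak_deriv_D[of "[]" ?as] as km by simp
    show ?thesis
      unfolding D
    proof (rule S.has_trace_D[OF as])
      show "length ?as < m" using km by simp
      show "partials ?as (wave i (freq j) (a j) 0 (- (pi / 2))) (y, 1) = 0"
        "partials ?as (wave i (freq j) (a j) 0 (- (pi / 2))) (y, - 1) = 0" for j y
        by (rule partials_mode_boundary[OF k(1)], simp)+
      show "AE x in OmegaM. vert_deriv k (S.D []) x = S.D ?as x"
        unfolding vert_deriv_def by (rule weak_deriv_AE[OF wd])
      show "vert_deriv k (S.D []) \<in> L2"
        using has_weak_deriv_weak_deriv[OF wd] by (simp add: has_weak_deriv_def vert_deriv_def)
    qed
  qed
  then show ?thesis unfolding X_space_def using S.D_sobolev D by auto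
qed

lemma Fb_wave: "Fb (wave i p c 0 \<beta>) n q = of_real c * Fb (wave i p 1 0 \<beta>) n q"
proof -
  have "of_real (wave i p c 0 \<beta> x) * cnj (B_fun n q x) = of_real c * (of_real (wave i p 1 0 \<beta> x) * cnj (B_fun n q x))" for x
    by (simp add: wave_def)
  then show ?thesis unfolding Fb_def by (simp only: integral_mult_right_zero)
qed

lemma Fb_ser_sums:
  fixes i :: "'n::finite"
  assumes a: "\<And>j. \<bar>a j\<bar> \<le> M * amp m \<delta> j" and \<delta>: "\<delta> > 0"
  shows "(\<lambda>j. of_real (a j) * Fb (mode i (freq j)) n q) sums Fb (ser i a) n q"
proof -
  interpret S: smooth_series "\<lambda>j. wave i (freq j) (a j) 0 (- (pi / 2)) :: 'n pt \<Rightarrow> real" m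
    "\<lambda>j. M * (amp m \<delta> j * (pi * real (freq j)) ^ m)"
    by (rule smooth_series_ser[OF a \<delta>])
  have D: "ser i a = S.D []" by (simp add: fun_eq_iff ser_def S.D_def)
  have "(\<lambda>j. LINT x|OmegaM. partials [] (wave i (freq j) (a j) 0 (- (pi / 2))) x *\<^sub>R cnj (B_fun n q x)) sums
      (LINT x|OmegaM. S.D [] x *\<^sub>R cnj (B_fun n q x))"
    by (rule S.LINT_D[OF _ _ B_fun_integrable]) auto
  then have "(\<lambda>j. Fb (wave i (freq j) (a j) 0 (- (pi / 2))) n q) sums Fb (ser i a) n q"
    unfolding Fb_def D by (simp only: scaleR_conv_of_real partials.simps(1))
  then show ?thesis by (simp only: Fb_wave[of _ _ "a _"])
qed

text \<open>Of the lacunary modes only the j-th has vertical index 2 \<open>freq j\<close>; all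
  others are orthogonal to the basis function, whatever n is.\<close>

lemma Fb_ser_single:
  fixes i :: "'n::finite"
  assumes a: "\<And>j. \<bar>a j\<bar> \<le> M * amp m \<delta> j" and \<delta>: "\<delta> > 0"
  shows "Fb (ser i a) n (2 * freq j) = of_real (a j) * Fb (mode i (freq j)) n (2 * freq j)"
proof -
  let ?f = "\<lambda>k. of_real (a k) * Fb (mode i (freq k)) n (2 * freq j)"
  have "?f sums (\<Sum>k\<in>{j}. ?f k)"
  proof (rule sums_finite)
    show "?f k = 0" if "k \<notin> {j}" for k
      using that freq_ge_4[of j] freq_ge_4[of k] freq_inj[of j k] by (subst Fb_mode_zero) auto
  qed simp
  from sums_unique2[OF Fb_ser_sums[OF a \<delta>] this] show ?thesis by simp
qed

lemma Fb_ser_zero: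
  fixes i :: "'n::finite"
  assumes a: "\<And>j. \<bar>a j\<bar> \<le> M * amp m \<delta> j" and \<delta>: "\<delta> > 0" and q: "q \<ge> 1"
    and 0: "(\<forall>j. q \<noteq> 2 * freq j) \<or> (n \<noteq> axis i 1 \<and> n \<noteq> - axis i 1)"
  shows "Fb (ser i a) n q = 0"
proof -
  have "Fb (mode i (freq j)) n q = 0" for j
    using 0 freq_ge_4[of j] q by (intro Fb_mode_zero) auto
  then have "(\<lambda>j. of_real (a j) * Fb (mode i (freq j)) n q) = (\<lambda>j. 0)" by simp
  then show ?thesis using Fb_ser_sums[OF a \<delta>, of i n q] sums_unique2[OF _ sums_zero] by metis
qed

section \<open>The explicit solution\<close>

definition sol\<theta> :: "'n \<Rightarrow> nat \<Rightarrow> nat \<Rightarrow> real \<Rightarrow> real \<Rightarrow> ('n::finite) pt \<Rightarrow> real" where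
  "sol\<theta> i \<alpha> m \<delta> t = ser i (\<lambda>j. exp (- slow \<alpha> (freq j) * t) * amp m \<delta> j)"

definition solv :: "'n \<Rightarrow> nat \<Rightarrow> nat \<Rightarrow> real \<Rightarrow> real \<Rightarrow> ('n::finite) pt \<Rightarrow> real" where
  "solv i \<alpha> m \<delta> t = ser i (\<lambda>j. slow \<alpha> (freq j) * (exp (- slow \<alpha> (freq j) * t) * amp m \<delta> j))"

text \<open>The 8 bounds the slow eigenvalue. It is used for both components, so that both series
  meet the same hypothesis.\<close>

lemma coeff_bounds:
  assumes "t \<ge> 0"
  shows "\<bar>exp (- slow \<alpha> (freq j) * t) * amp m \<delta> j\<bar> \<le> 8 * amp m \<delta> j"
    "\<bar>slow \<alpha> (freq j) * (exp (- slow \<alpha> (freq j) * t) * amp m \<delta> j)\<bar> \<le> 8 * amp m \<delta> j"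
proof -
  note f = freq_ge_4[of j]
  have s0: "0 < slow \<alpha> (freq j)" by (rule slow_fast(5)[OF f])
  have "1 \<le> real (freq j) ^ (2 * (1 + \<alpha>))" using f by (intro one_le_power) simp
  then have "8 / real (freq j) ^ (2 * (1 + \<alpha>)) \<le> 8" by (simp add: divide_le_eq)
  then have s8: "slow \<alpha> (freq j) \<le> 8" using slow_bounds(1)[OF f, of \<alpha>] by linarith
  have e: "exp (- slow \<alpha> (freq j) * t) \<le> 1" using s0 assms by simp
  have "exp (- slow \<alpha> (freq j) * t) * amp m \<delta> j \<le> 1 * amp m \<delta> j"
    using amp_pos[of m \<delta> j] by (intro mult_right_mono[OF e]) simp
  then have 1: "\<bar>exp (- slow \<alpha> (freq j) * t) * amp m \<delta> j\<bar> \<le> amp m \<delta> j"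
    using amp_pos[of m \<delta> j] by (simp add: abs_mult)
  then show "\<bar>exp (- slow \<alpha> (freq j) * t) * amp m \<delta> j\<bar> \<le> 8 * amp m \<delta> j"
    using amp_pos[of m \<delta> j] by linarith
  have "\<bar>slow \<alpha> (freq j)\<bar> * \<bar>exp (- slow \<alpha> (freq j) * t) * amp m \<delta> j\<bar> \<le> 8 * amp m \<delta> j"
    using s0 s8 by (intro mult_mono 1) auto
  then show "\<bar>slow \<alpha> (freq j) * (exp (- slow \<alpha> (freq j) * t) * amp m \<delta> j)\<bar> \<le> 8 * amp m \<delta> j"
    by (simp only: abs_mult)
qed

lemma sol_X_space:
  assumes "\<delta> > 0" "m \<ge> 1" "t \<ge> 0"
  shows "sol\<theta> i \<alpha> m \<delta> t \<in> X_space m" "solv i \<alpha> m \<delta> t \<in> X_space m"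
  unfolding sol\<theta>_def solv_def
  by (rule ser_X_space[OF coeff_bounds(1)[OF assms(3)] assms(1,2)],
      rule ser_X_space[OF coeff_bounds(2)[OF assms(3)] assms(1,2)])

lemma Fb_sol:
  assumes "\<delta> > 0" "t \<ge> 0"
  shows "Fb (sol\<theta> i \<alpha> m \<delta> t) n (2 * freq j) = of_real (exp (- slow \<alpha> (freq j) * t)) * (of_real (amp m \<delta> j) * Fb (mode i (freq j)) n (2 * freq j))"
    "Fb (solv i \<alpha> m \<delta> t) n (2 * freq j) = of_real (slow \<alpha> (freq j)) * Fb (sol\<theta> i \<alpha> m \<delta> t) n (2 * freq j)"
  unfolding sol\<theta>_def solv_def
    Fb_ser_single[OF coeff_bounds(1)[OF assms(2)] assms(1)] Fb_ser_single[OF coeff_bounds(2)[OF assms(2)] assms(1)]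
  by (simp_all only: of_real_mult mult.assoc)

lemma Fb_sol_zero:
  assumes "\<delta> > 0" "t \<ge> 0" "q \<ge> 1" "(\<forall>j. q \<noteq> 2 * freq j) \<or> (n \<noteq> axis i 1 \<and> n \<noteq> - axis i 1)"
  shows "Fb (sol\<theta> i \<alpha> m \<delta> t) n q = 0" "Fb (solv i \<alpha> m \<delta> t) n q = 0"
  unfolding sol\<theta>_def solv_def
  by (rule Fb_ser_zero[OF coeff_bounds(1)[OF assms(2)] assms(1,3,4)],
      rule Fb_ser_zero[OF coeff_bounds(2)[OF assms(2)] assms(1,3,4)])

text \<open>At every frequency the coefficient vector is a decaying or constant exponential times a
  vector w with M w = r w: the zero vector where nothing is excited, a multiple of (slow, 1)
  elsewhere. The differential equation can then be verified for all frequencies at once.\<close>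

lemma Fb_vec_sol:
  fixes i :: "'n::finite"
  assumes \<delta>: "\<delta> > 0" and q: "q \<ge> 1"
  shows "\<exists>r w. M_mat \<alpha> (eta n q) *v w = r *\<^sub>R w \<and>
    (\<forall>t\<ge>0. Fb_vec (solv i \<alpha> m \<delta> t) (sol\<theta> i \<alpha> m \<delta> t) n q = exp (- r * t) *\<^sub>R w)"
proof (cases "(\<forall>j. q \<noteq> 2 * freq j) \<or> (n \<noteq> axis i 1 \<and> n \<noteq> - axis i 1)")
  case True
  have "Fb_vec (solv i \<alpha> m \<delta> t) (sol\<theta> i \<alpha> m \<delta> t) n q = 0" if "t \<ge> 0" for t
    unfolding Fb_vec_def Fb_sol_zero[OF \<delta> that q True] by (simp add: vec_eq_iff forall_2)
  then show ?thesis by (intro exI[of _ 0]) simp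
next
  case False
  then obtain j where j: "q = 2 * freq j" and n: "n = axis i 1 \<or> n = - axis i 1" by blast
  define \<kappa> where "\<kappa> = of_real (amp m \<delta> j) * Fb (mode i (freq j)) n (2 * freq j)"
  define r where "r = slow \<alpha> (freq j)"
  define w :: "complex^2" where "w = vector [of_real r * \<kappa>, \<kappa>]"
  have "Fb_vec (solv i \<alpha> m \<delta> t) (sol\<theta> i \<alpha> m \<delta> t) n q = exp (- r * t) *\<^sub>R w" if "t \<ge> 0" for t
    unfolding Fb_vec_def j Fb_sol[OF \<delta> that] w_def \<kappa>_def[symmetric] r_def[symmetric]
    by (simp add: vec_eq_iff forall_2 scaleR_conv_of_real[where 'a = complex])
  moreover have "M_mat \<alpha> (eta n q) *v w = r *\<^sub>R w"
  proof -
    note sf = slow_fast(1,2)[OF freq_ge_4, of \<alpha> j, folded r_def]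
    \<comment> \<open>The characteristic equation, which is the first row of the eigenvector
      equation; the second row holds because the first component of \<open>w\<close> is r times the
      second.\<close>
    have "coefA \<alpha> (freq j) * r - coefB (freq j) = r * r"
      unfolding sf[symmetric] by (simp add: algebra_simps)
    then have "complex_of_real (coefA \<alpha> (freq j) * r - coefB (freq j)) = of_real (r * r)" by simp
    then have "of_real (coefA \<alpha> (freq j)) * (of_real r * \<kappa>) - of_real (coefB (freq j)) * \<kappa> = of_real r * (of_real r * \<kappa>)"
      by (simp only: of_real_diff of_real_mult left_diff_distrib[symmetric] mult.assoc[symmetric])
    then show ?thesis
      unfolding j by (simp add: vec_eq_iff forall_2 M_mat_mult[OF n] w_def scaleR_conv_of_real[where 'a = complex])
  qed
  ultimately show ?thesis by blast
qed

lemma solution_exists: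
  fixes i :: "'n::finite"
  assumes \<delta>: "\<delta> > 0" and m: "m \<ge> 1"
  shows "is_solution \<alpha> m (solv i \<alpha> m \<delta> 0) (sol\<theta> i \<alpha> m \<delta> 0) (solv i \<alpha> m \<delta>) (sol\<theta> i \<alpha> m \<delta>)"
  unfolding is_solution_def
proof (intro conjI allI impI)
  fix n :: "int^'n" and q :: nat and t :: real
  assume q: "q \<ge> 1" and t: "t \<ge> 0"
  obtain r w where w: "M_mat \<alpha> (eta n q) *v w = r *\<^sub>R w"
    and F: "\<And>t. t \<ge> 0 \<Longrightarrow> Fb_vec (solv i \<alpha> m \<delta> t) (sol\<theta> i \<alpha> m \<delta> t) n q = exp (- r * t) *\<^sub>R w"
    using Fb_vec_sol[OF \<delta> q] by blast
  have "((\<lambda>t. exp (- r * t)) has_real_derivative exp (- r * t) * (- r)) (at t within {0..})"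
    by (auto intro!: derivative_eq_intros)
  from has_vector_derivative_scaleR[OF this has_vector_derivative_const[of w]]
  have "((\<lambda>t. exp (- r * t) *\<^sub>R w) has_vector_derivative (exp (- r * t) * (- r)) *\<^sub>R w) (at t within {0..})"
    by simp
  moreover have "(exp (- r * t) * (- r)) *\<^sub>R w = - (M_mat \<alpha> (eta n q) *v Fb_vec (solv i \<alpha> m \<delta> t) (sol\<theta> i \<alpha> m \<delta> t) n q)"
  proof -
    have "M_mat \<alpha> (eta n q) *v (exp (- r * t) *\<^sub>R w) = exp (- r * t) *\<^sub>R (M_mat \<alpha> (eta n q) *v w)"
      by (simp add: matrix_vector_mult_def vec_eq_iff scaleR_sum_right)
    then show ?thesis unfolding F[OF t] w by simp
  qed
  ultimately have d: "((\<lambda>t. exp (- r * t) *\<^sub>R w) has_vector_derivative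
      - (M_mat \<alpha> (eta n q) *v Fb_vec (solv i \<alpha> m \<delta> t) (sol\<theta> i \<alpha> m \<delta> t) n q)) (at t within {0..})"
    by simp
  show "((\<lambda>t'. Fb_vec (solv i \<alpha> m \<delta> t') (sol\<theta> i \<alpha> m \<delta> t') n q) has_vector_derivative
      - (M_mat \<alpha> (eta n q) *v Fb_vec (solv i \<alpha> m \<delta> t) (sol\<theta> i \<alpha> m \<delta> t) n q)) (at t within {0..})"
    by (rule has_vector_derivative_transform[OF _ _ d]) (use t F in auto)
qed (use sol_X_space[OF \<delta> m] in auto)

text \<open>Applies to an arbitrary solution: its coefficients at n = e_i and q = 2 p obey a closed
  system whose initial value lies on the slow eigenvector, and data that agree up to null sets have
  equal coefficients. The 1/2 is the squared norm of the mode.\<close>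

lemma LINT_solution_mode:
  fixes i :: "'n::finite"
  assumes \<delta>: "\<delta> > 0" and m: "m \<ge> 1" and t: "t \<ge> 0"
    and sol: "is_solution \<alpha> m (solv i \<alpha> m \<delta> 0) (sol\<theta> i \<alpha> m \<delta> 0) v \<theta>"
  shows "(LINT x|OmegaM. \<theta> t x * mode i (freq j) x) = exp (- slow \<alpha> (freq j) * t) * amp m \<delta> j / 2"
    "(LINT x|OmegaM. v t x * mode i (freq j) x) = slow \<alpha> (freq j) * (exp (- slow \<alpha> (freq j) * t) * amp m \<delta> j / 2)"
proof -
  define n :: "int^'n" where "n = axis i 1"
  define q where "q = 2 * freq j"
  define l where "l = slow \<alpha> (freq j)"
  define \<mu> where "\<mu> = fast \<alpha> (freq j)"
  note f4 = freq_ge_4[of j]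
  have q1: "q \<ge> 1" using f4 by (simp add: q_def)
  have X: "\<And>t. t \<ge> 0 \<Longrightarrow> v t \<in> X_space m" "\<And>t. t \<ge> 0 \<Longrightarrow> \<theta> t \<in> X_space m"
    and init: "AE x in OmegaM. v 0 x = solv i \<alpha> m \<delta> 0 x" "AE x in OmegaM. \<theta> 0 x = sol\<theta> i \<alpha> m \<delta> 0 x"
    and ode: "\<And>t. t \<ge> 0 \<Longrightarrow> ((\<lambda>t'. Fb_vec (v t') (\<theta> t') n q) has_vector_derivative
           - (M_mat \<alpha> (eta n q) *v Fb_vec (v t) (\<theta> t) n q)) (at t within {0..})"
    using sol q1 unfolding is_solution_def by auto
  have L: "v t \<in> L2" "\<theta> t \<in> L2" if "t \<ge> 0" for t using X(1,2)[OF that] X_spaceD(1) by auto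
  note L0 = sol_X_space[OF \<delta> m order_refl, of i \<alpha>, THEN X_spaceD(1)]
  have n': "n = axis i 1 \<or> n = - axis i 1" by (simp add: n_def)
  note sf = slow_fast(1,2)[OF f4, of \<alpha>, folded l_def \<mu>_def]
  have comp: "((\<lambda>t'. Fb_vec (v t') (\<theta> t') n q $ k) has_vector_derivative
      (- (M_mat \<alpha> (eta n q) *v Fb_vec (v t) (\<theta> t) n q)) $ k) (at t within {0..})" if "t \<ge> 0" for t k
    by (rule bounded_linear.has_vector_derivative[OF bounded_linear_vec_nth ode[OF that]])
  have F1: "Fb_vec f g n q $ 1 = Fb f n q" "Fb_vec f g n q $ 2 = Fb g n q" for f g :: "'n pt \<Rightarrow> real" and q
    by (simp_all add: Fb_vec_def)
  have d1: "((\<lambda>t. Fb (v t) n q) has_vector_derivative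
      - (of_real (l + \<mu>) * Fb (v t) n q - of_real (l * \<mu>) * Fb (\<theta> t) n q)) (at t within {0..})" if "t \<ge> 0" for t
    using comp[OF that, of 1]
    unfolding vector_uminus_component F1 sf q_def M_mat_mult(1)[OF n'] .
  have d2: "((\<lambda>t. Fb (\<theta> t) n q) has_vector_derivative - Fb (v t) n q) (at t within {0..})" if "t \<ge> 0" for t
    using comp[OF that, of 2]
    unfolding vector_uminus_component F1 q_def M_mat_mult(2)[OF n'] .
  have Fb_cong: "Fb f n q = Fb g n q" if "AE x in OmegaM. f x = g x" "f \<in> L2" "g \<in> L2" for f g :: "'n pt \<Rightarrow> real"
    unfolding Fb_def using that by (intro integral_cong_AE Fb_integrand_measurable) auto
  define \<kappa> where "\<kappa> = Fb (mode i (freq j)) n q"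
  have i1: "Fb (\<theta> 0) n q = of_real (amp m \<delta> j) * \<kappa>"
    using Fb_cong[OF init(2) L(2)[OF order_refl] L0(1)] Fb_sol(1)[OF \<delta> order_refl, of i \<alpha> m n j]
    by (simp add: q_def \<kappa>_def)
  have i2: "Fb (v 0) n q = of_real l * Fb (\<theta> 0) n q"
    using Fb_cong[OF init(1) L(1)[OF order_refl] L0(2)] Fb_cong[OF init(2) L(2)[OF order_refl] L0(1)]
      Fb_sol(2)[OF \<delta> order_refl, of i \<alpha> m n j]
    by (simp add: q_def l_def)
  note uni = system_ode_unique[where V = "\<lambda>t. Fb (v t) n q" and \<Theta> = "\<lambda>t. Fb (\<theta> t) n q", OF d1 d2 i2 t]
  have Rk: "Re \<kappa> = 1 / 2"
    unfolding \<kappa>_def n_def q_def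
    using LINT_mode_square[of "freq j" i] f4
    by (subst Re_Fb[OF smooth_L2[OF smooth_wave]]) simp
  have rk: "Re (complex_of_real c * \<kappa>) = c / 2" for c using Rk by simp
  have \<theta>F: "Fb (\<theta> t) n q = of_real (exp (- l * t) * amp m \<delta> j) * \<kappa>"
    using uni(1) i1 by (simp only: of_real_mult mult.assoc)
  show "(LINT x|OmegaM. \<theta> t x * mode i (freq j) x) = exp (- slow \<alpha> (freq j) * t) * amp m \<delta> j / 2"
    using Re_Fb[OF L(2)[OF t], of i "freq j", folded n_def q_def] unfolding \<theta>F rk l_def by simp
  have vF: "Fb (v t) n q = of_real (l * (exp (- l * t) * amp m \<delta> j)) * \<kappa>"
    using uni(2) \<theta>F by (simp only: of_real_mult mult.assoc)
  show "(LINT x|OmegaM. v t x * mode i (freq j) x) = slow \<alpha> (freq j) * (exp (- slow \<alpha> (freq j) * t) * amp m \<delta> j / 2)"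
    using Re_Fb[OF L(1)[OF t], of i "freq j", folded n_def q_def] unfolding vF rk l_def by simp
qed

section \<open>Choice of the frequency\<close>

text \<open>The least power of two that is at least R is at most 2 R. The bound 4 on R puts this
  power into the range of \<open>freq\<close>.\<close>

lemma dyadic_frequency:
  assumes "4 \<le> R"
  shows "\<exists>j. R \<le> real (freq j) \<and> real (freq j) \<le> 2 * R"
proof -
  obtain n0 where "R < 2 ^ n0" using real_arch_pow[of 2 R] by auto
  then have ex: "\<exists>n. R \<le> 2 ^ n" by (auto intro: less_imp_le)
  define N where "N = (LEAST n. R \<le> 2 ^ n)"
  have N: "R \<le> 2 ^ N" unfolding N_def by (rule LeastI_ex[OF ex])
  have N2: "2 \<le> N"
  proof (rule ccontr)
    assume "\<not> 2 \<le> N"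
    then have "(2::real) ^ N \<le> 2 ^ 1" by (intro power_increasing) auto
    then show False using N assms by simp
  qed
  then obtain j where j: "N = Suc (j + 1)" by (metis Suc_1 add.commute le_Suc_ex plus_1_eq_Suc add_Suc)
  have "\<not> R \<le> 2 ^ (j + 1)"
    using not_less_Least[of "j + 1" "\<lambda>n. R \<le> 2 ^ n"] by (simp add: N_def[symmetric] j)
  then have "real (freq j) \<le> 2 * R" by (simp add: freq_def)
  moreover have "R \<le> real (freq j)" using N by (simp add: freq_def j)
  ultimately show ?thesis by blast
qed

text \<open>For p between t^(1/b) and 2 t^(1/b) the exponent \<open>slow\<close> times t is at most
  8, and p^s times the amplitude is p^e with e/b = -(m - s)/b - epsilon, because delta = epsilon b.
  The slow eigenvalue is at least a constant over t, which accounts for the additional factor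
  1/t.\<close>

lemma decay_rate:
  fixes \<alpha> m :: nat and s \<epsilon> :: real
  assumes s: "s \<le> real m" and \<epsilon>: "\<epsilon> > 0"
  defines "b \<equiv> 2 * (1 + real \<alpha>)"
  defines "\<delta> \<equiv> \<epsilon> * b"
  shows "\<exists>C>0. \<forall>t\<ge>4 powr b. \<exists>j.
    C * t powr (- (real m - s) / b - \<epsilon>) \<le> real (freq j) powr s * (exp (- slow \<alpha> (freq j) * t) * amp m \<delta> j) \<and>
    C * t powr (- 1 - (real m - s) / b - \<epsilon>) \<le> real (freq j) powr s * (slow \<alpha> (freq j) * (exp (- slow \<alpha> (freq j) * t) * amp m \<delta> j))"
proof -
  have b: "b > 0" by (simp add: b_def)
  define e where "e = s - real m - \<delta>"
  have "\<delta> > 0" using \<epsilon> b by (simp add: \<delta>_def)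
  then have e: "e \<le> 0" using s by (simp add: e_def)
  \<comment> \<open>exp (-8) bounds the exponential from below, and 2^e appears because p <= 2
    t^(1/b) while e <= 0.\<close>
  define C1 where "C1 = exp (- 8) * 2 powr e"
  define \<kappa> where "\<kappa> = 4 * pi\<^sup>2 / (2 * pi\<^sup>2) ^ (1 + \<alpha>)"
  \<comment> \<open>2^(-b) comes from p^b <= 2^b t.\<close>
  define C2 where "C2 = \<kappa> * 2 powr (- b)"
  have pos: "C1 > 0" "C2 > 0" by (simp_all add: C1_def C2_def \<kappa>_def)
  have main: "\<exists>j. C1 * t powr (- (real m - s) / b - \<epsilon>) \<le> real (freq j) powr s * (exp (- slow \<alpha> (freq j) * t) * amp m \<delta> j) \<and>
      C2 * t powr (- 1) \<le> slow \<alpha> (freq j)" if t: "4 powr b \<le> t" for t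
  proof -
    have t0: "t > 0" by (rule less_le_trans[OF _ t]) simp
    define R where "R = t powr (1 / b)"
    \<comment> \<open>The threshold 4^b for t is what makes R at least 4.\<close>
    have "(4 powr b) powr (1 / b) \<le> R"
      unfolding R_def using t b by (intro powr_mono2) auto
    then have R4: "4 \<le> R" using b by (simp add: powr_powr)
    then have R0: "R > 0" by simp
    have Rb: "R powr b = t" using b t0 by (simp add: R_def powr_powr)
    obtain j where j: "R \<le> real (freq j)" "real (freq j) \<le> 2 * R"
      using dyadic_frequency[OF R4] by blast
    define p where "p = real (freq j)"
    have p0: "p > 0" using freq_pos by (simp add: p_def)
    have pb: "real (freq j) ^ (2 * (1 + \<alpha>)) = p powr b"
    proof -
      have "b = real (2 * (1 + \<alpha>))" by (simp add: b_def)
      then show ?thesis using p0 by (simp only: powr_realpow p_def)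
    qed
    have tp: "t \<le> p powr b"
      unfolding Rb[symmetric] using j R0 b by (intro powr_mono2) (auto simp: p_def)
    have pt: "p powr b \<le> 2 powr b * t"
    proof -
      have "p powr b \<le> (2 * R) powr b" using j p0 b by (intro powr_mono2) (auto simp: p_def)
      then show ?thesis using R0 by (simp add: powr_mult Rb)
    qed
    have "slow \<alpha> (freq j) * t \<le> 8 / p powr b * t"
      using slow_bounds(1)[OF freq_ge_4, of \<alpha> j] t0 unfolding pb by (intro mult_right_mono) auto
    also have "\<dots> \<le> 8" using tp p0 by (simp add: divide_le_eq)
    finally have ex: "exp (- 8) \<le> exp (- slow \<alpha> (freq j) * t)" by simp
    have "2 powr e * t powr (- (real m - s) / b - \<epsilon>) = (2 * R) powr e"
    proof -
      have "1 / b * e = - (real m - s) / b - \<epsilon>" using b by (simp add: e_def \<delta>_def field_simps)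
      then have "R powr e = t powr (- (real m - s) / b - \<epsilon>)"
        unfolding R_def powr_powr by (simp only:)
      then show ?thesis using R0 by (simp add: powr_mult)
    qed
    also have "\<dots> \<le> p powr e" using j e p0 by (intro powr_mono2') (auto simp: p_def)
    also have "p powr e = p powr s * amp m \<delta> j"
    proof -
      have "e = s + (- real m - \<delta>)" by (simp add: e_def)
      then show ?thesis unfolding amp_def p_def[symmetric] by (simp only: powr_add)
    qed
    finally have pe: "2 powr e * t powr (- (real m - s) / b - \<epsilon>) \<le> p powr s * amp m \<delta> j" .
    have "exp (- 8) * (2 powr e * t powr (- (real m - s) / b - \<epsilon>)) \<le>
        exp (- slow \<alpha> (freq j) * t) * (p powr s * amp m \<delta> j)"
      by (rule mult_mono[OF ex pe]) auto
    then have 1: "C1 * t powr (- (real m - s) / b - \<epsilon>) \<le> p powr s * (exp (- slow \<alpha> (freq j) * t) * amp m \<delta> j)"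
      by (simp only: C1_def mult_ac)
    have "C2 * t powr (- 1) = \<kappa> / (2 powr b * t)"
      using t0 by (simp add: C2_def powr_minus_divide powr_minus divide_inverse)
    also have "\<dots> \<le> \<kappa> / p powr b"
      using pt p0 t0 by (intro divide_left_mono) (auto simp: \<kappa>_def)
    also have "\<dots> \<le> slow \<alpha> (freq j)"
      using slow_bounds(2)[OF freq_ge_4, of \<alpha> j] unfolding pb \<kappa>_def .
    finally show ?thesis using 1 unfolding p_def by blast
  qed
  have "\<exists>j. min C1 (C1 * C2) * t powr (- (real m - s) / b - \<epsilon>) \<le> real (freq j) powr s * (exp (- slow \<alpha> (freq j) * t) * amp m \<delta> j) \<and>
    min C1 (C1 * C2) * t powr (- 1 - (real m - s) / b - \<epsilon>) \<le> real (freq j) powr s * (slow \<alpha> (freq j) * (exp (- slow \<alpha> (freq j) * t) * amp m \<delta> j))"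
    if t: "4 powr b \<le> t" for t
  proof -
    obtain j where j: "C1 * t powr (- (real m - s) / b - \<epsilon>) \<le> real (freq j) powr s * (exp (- slow \<alpha> (freq j) * t) * amp m \<delta> j)"
      "C2 * t powr (- 1) \<le> slow \<alpha> (freq j)"
      using main[OF t] by blast
    have "min C1 (C1 * C2) * t powr (- (real m - s) / b - \<epsilon>) \<le> C1 * t powr (- (real m - s) / b - \<epsilon>)"
      by (intro mult_right_mono) auto
    moreover have "min C1 (C1 * C2) * t powr (- 1 - (real m - s) / b - \<epsilon>) \<le>
        real (freq j) powr s * (slow \<alpha> (freq j) * (exp (- slow \<alpha> (freq j) * t) * amp m \<delta> j))"
    proof -
      have "- 1 - (real m - s) / b - \<epsilon> = - 1 + (- (real m - s) / b - \<epsilon>)"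
        unfolding minus_divide_left[symmetric] by linarith
      then have "t powr (- 1 - (real m - s) / b - \<epsilon>) = t powr (- 1) * t powr (- (real m - s) / b - \<epsilon>)"
        by (simp only: powr_add)
      then have "min C1 (C1 * C2) * t powr (- 1 - (real m - s) / b - \<epsilon>) \<le>
          (C1 * C2) * (t powr (- 1) * t powr (- (real m - s) / b - \<epsilon>))"
        by (simp only:) (intro mult_right_mono, auto)
      also have "\<dots> = (C2 * t powr (- 1)) * (C1 * t powr (- (real m - s) / b - \<epsilon>))"
        by (simp only: mult_ac)
      also have "\<dots> \<le> slow \<alpha> (freq j) * (real (freq j) powr s * (exp (- slow \<alpha> (freq j) * t) * amp m \<delta> j))"
        using pos slow_fast(5)[OF freq_ge_4, of \<alpha> j] by (intro mult_mono[OF j(2,1)]) auto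
      finally show ?thesis by (simp only: mult_ac)
    qed
    ultimately show ?thesis using j(1) by (meson order_trans)
  qed
  moreover have "min C1 (C1 * C2) > 0" using pos by simp
  ultimately show ?thesis by blast
qed

text \<open>The data are fixed before s: delta depends on epsilon and alpha alone, while the
  constants may depend on s. Existence of a solution is asserted so that the statement about all
  solutions is not vacuous.\<close>

theorem proposition7p1:
  fixes \<alpha> m :: nat and \<epsilon> :: real
  assumes "\<alpha> \<in> {0, 1}" and "m \<ge> 1" and "\<epsilon> > 0"
  shows "\<exists>v0 \<theta>0 :: ('n::finite) pt \<Rightarrow> real.
    v0 \<in> X_space m \<and> \<theta>0 \<in> X_space m \<and>
    (\<exists>v \<theta>. is_solution \<alpha> m v0 \<theta>0 v \<theta>) \<and>
    (\<forall>v \<theta>. is_solution \<alpha> m v0 \<theta>0 v \<theta> \<longrightarrow>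
      (\<forall>s\<in>{0..real m}.
        (\<exists>C>0. \<exists>T>0. \<forall>t\<ge>T.
          Hnorm s (fluctuation (\<theta> t))
            \<ge> ennreal (C * t powr (- (real m - s) / (2 * (1 + real \<alpha>)) - \<epsilon>))) \<and>
        (\<exists>C>0. \<exists>T>0. \<forall>t\<ge>T.
          Hnorm s (v t)
            \<ge> ennreal (C * t powr (- 1 - (real m - s) / (2 * (1 + real \<alpha>)) - \<epsilon>)))))"
proof -
  define b where "b = 2 * (1 + real \<alpha>)"
  define \<delta> where "\<delta> = \<epsilon> * b"
  have \<delta>: "\<delta> > 0" using assms(3) by (simp add: \<delta>_def b_def)
  note m = assms(2)
  \<comment> \<open>Any horizontal coordinate serves; the type \<open>'n\<close> has at least one
    element.\<close>
  define i :: 'n where "i = undefined"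
  let ?v0 = "solv i \<alpha> m \<delta> 0" and ?\<theta>0 = "sol\<theta> i \<alpha> m \<delta> 0"
  have lower: "(\<exists>C>0. \<exists>T>0. \<forall>t\<ge>T. ennreal (C * t powr (- (real m - s) / b - \<epsilon>)) \<le> Hnorm s (fluctuation (\<theta> t))) \<and>
      (\<exists>C>0. \<exists>T>0. \<forall>t\<ge>T. ennreal (C * t powr (- 1 - (real m - s) / b - \<epsilon>)) \<le> Hnorm s (v t))"
    if sol: "is_solution \<alpha> m ?v0 ?\<theta>0 v \<theta>" and s: "s \<in> {0..real m}" for v \<theta> s
  proof -
    obtain c where c: "c > 0" and H: "\<And>p f F. p \<ge> 2 \<Longrightarrow> f \<in> X_space m \<Longrightarrow> F = f \<or> F = fluctuation f \<Longrightarrow>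
        ennreal (c * real p powr s * \<bar>LINT x|OmegaM. f x * mode i p x\<bar>) \<le> Hnorm s (F :: 'n pt \<Rightarrow> real)"
      using Hnorm_mode_lower_bound[of s m i] s by auto
    obtain C where C: "C > 0" and rate: "\<And>t. t \<ge> 4 powr b \<Longrightarrow> \<exists>j.
        C * t powr (- (real m - s) / b - \<epsilon>) \<le> real (freq j) powr s * (exp (- slow \<alpha> (freq j) * t) * amp m \<delta> j) \<and>
        C * t powr (- 1 - (real m - s) / b - \<epsilon>) \<le> real (freq j) powr s * (slow \<alpha> (freq j) * (exp (- slow \<alpha> (freq j) * t) * amp m \<delta> j))"
      using decay_rate[of s m \<epsilon> \<alpha>] s assms(3) unfolding b_def[symmetric] \<delta>_def[symmetric] by auto
    have T: "(4::real) powr b > 0" by simp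
    have both: "ennreal (c / 2 * C * t powr (- (real m - s) / b - \<epsilon>)) \<le> Hnorm s (fluctuation (\<theta> t)) \<and>
        ennreal (c / 2 * C * t powr (- 1 - (real m - s) / b - \<epsilon>)) \<le> Hnorm s (v t)" if t: "t \<ge> 4 powr b" for t
    proof -
      obtain j where j: "C * t powr (- (real m - s) / b - \<epsilon>) \<le> real (freq j) powr s * (exp (- slow \<alpha> (freq j) * t) * amp m \<delta> j)"
        "C * t powr (- 1 - (real m - s) / b - \<epsilon>) \<le> real (freq j) powr s * (slow \<alpha> (freq j) * (exp (- slow \<alpha> (freq j) * t) * amp m \<delta> j))"
        using rate[OF t] by blast
      have t0: "t \<ge> 0" using t T by linarith
      have f2: "freq j \<ge> 2" using freq_ge_4[of j] by simp
      have X: "v t \<in> X_space m" "\<theta> t \<in> X_space m" using sol t0 by (auto simp: is_solution_def)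
      note I = LINT_solution_mode[OF \<delta> m t0 sol, of j]
      have sl: "0 < slow \<alpha> (freq j)" by (rule slow_fast(5)[OF freq_ge_4])
      \<comment> \<open>The 1/2 next to c pays for the factor 1/2 in the pairing of the solution
        with the mode.\<close>
      have "c / 2 * (C * t powr (- (real m - s) / b - \<epsilon>)) \<le> c / 2 * (real (freq j) powr s * (exp (- slow \<alpha> (freq j) * t) * amp m \<delta> j))"
        using c by (intro mult_left_mono j) auto
      also have "\<dots> = c * real (freq j) powr s * \<bar>LINT x|OmegaM. \<theta> t x * mode i (freq j) x\<bar>"
        unfolding I(1) by (simp add: abs_mult abs_of_pos[OF amp_pos])
      finally have x: "c / 2 * (C * t powr (- (real m - s) / b - \<epsilon>)) \<le> c * real (freq j) powr s * \<bar>LINT x|OmegaM. \<theta> t x * mode i (freq j) x\<bar>" .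
      have 1: "ennreal (c / 2 * C * t powr (- (real m - s) / b - \<epsilon>)) \<le> Hnorm s (fluctuation (\<theta> t))"
        by (rule order_trans[OF ennreal_leI H[OF f2 X(2) disjI2[OF refl]]]) (use x in \<open>simp only: mult.assoc\<close>)
      have "c / 2 * (C * t powr (- 1 - (real m - s) / b - \<epsilon>)) \<le> c / 2 * (real (freq j) powr s * (slow \<alpha> (freq j) * (exp (- slow \<alpha> (freq j) * t) * amp m \<delta> j)))"
        using c by (intro mult_left_mono j) auto
      also have "\<dots> = c * real (freq j) powr s * \<bar>LINT x|OmegaM. v t x * mode i (freq j) x\<bar>"
        unfolding I(2) using sl by (simp add: abs_mult abs_of_pos[OF amp_pos])
      finally have x: "c / 2 * (C * t powr (- 1 - (real m - s) / b - \<epsilon>)) \<le> c * real (freq j) powr s * \<bar>LINT x|OmegaM. v t x * mode i (freq j) x\<bar>" .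
      have "ennreal (c / 2 * C * t powr (- 1 - (real m - s) / b - \<epsilon>)) \<le> Hnorm s (v t)"
        by (rule order_trans[OF ennreal_leI H[OF f2 X(1) disjI1[OF refl]]]) (use x in \<open>simp only: mult.assoc\<close>)
      with 1 show ?thesis by blast
    qed
    have "c / 2 * C > 0" using c C by simp
    then show ?thesis using both T by blast
  qed
  show ?thesis
  proof (rule exI[of _ ?v0], rule exI[of _ ?\<theta>0], intro conjI)
    show "?v0 \<in> X_space m" "?\<theta>0 \<in> X_space m"
      by (rule sol_X_space[OF \<delta> m order_refl])+
    show "\<exists>v \<theta>. is_solution \<alpha> m ?v0 ?\<theta>0 v \<theta>"
      using solution_exists[OF \<delta> m] by blast
    show "\<forall>v \<theta>. is_solution \<alpha> m ?v0 ?\<theta>0 v \<theta> \<longrightarrow>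
      (\<forall>s\<in>{0..real m}.
        (\<exists>C>0. \<exists>T>0. \<forall>t\<ge>T.
          Hnorm s (fluctuation (\<theta> t))
            \<ge> ennreal (C * t powr (- (real m - s) / (2 * (1 + real \<alpha>)) - \<epsilon>))) \<and>
        (\<exists>C>0. \<exists>T>0. \<forall>t\<ge>T.
          Hnorm s (v t)
            \<ge> ennreal (C * t powr (- 1 - (real m - s) / (2 * (1 + real \<alpha>)) - \<epsilon>))))"
      by (intro allI impI ballI) (rule lower[unfolded b_def])
  qed
qed

end
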